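(* Let $\gamma\colon(-1,1)\to\mathbb{C}$ be an initial curve of $F$, let $H=I_F(\gamma)$ be its initial region, and let $d\in H$. Then there is at most one function $\alpha$ on $H$ such that: (i) $\alpha$ is holomorphic and injective on $H$; (ii) $\alpha$ is an Abel function of $F$ on $H$, i.e. $\alpha(F(z))=\alpha(z)+1$ for all $z\in H\cap F^{-1}(H)$; (iii) $\alpha(d)=0$; and (iv) $\bigcup_{k\in\mathbb{Z}}\bigl(\alpha(H)+k\bigr)=\mathbb{C}$.
   Context: Conventions: a curve is a continuous map on the open interval $(-1,1)$; in set contexts a curve stands for its image. For $A\subseteq\mathbb{C}$ and $z\in\mathbb{C}$, $A+z=\{a+z: a\in A\}$. A function is holomorphic on a (not necessarily open) set if each point of the set has a neighborhood on which the function is holomorphic. $\uplus$ denotes disjoint union. Initial curve: let $F$ be a complex function. A curve $\gamma\colon(-1,1)\to\mathbb{C}$ on which $F$ is holomorphic is an initial curve of $F$ if $\gamma$ and $F\circ\gamma$ are injective and their images are disjoint, and the limits $\gamma(\pm1):=\lim_{t\to\pm1}\gamma(t)$ exist, satisfy $\gamma(-1)\neq\gamma(1)$, and are two fixed points of $F$. It is understood that then $F(\gamma(t))\to\gamma(\pm1)$ as $t\to\pm1$ and that $\gamma\cup(F\circ\gamma)\cup\{\gamma(-1),\gamma(1)\}$ is a closed Jordan curve. Initial region: with $C$ the inner (bounded) component of the complement of this Jordan curve, the initial region of $\gamma$ is $I_F(\gamma):=\gamma\uplus C\uplus F(\gamma)=\overline{C}\setminus\{\gamma(-1),\gamma(1)\}$.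 *)

theory Defs
  imports "HOL-Complex_Analysis.Complex_Analysis"
begin

abbreviation curve_image :: "(real \<Rightarrow> complex) \<Rightarrow> complex set"
  where "curve_image \<gamma> \<equiv> \<gamma> ` {-1<..<1}"

text \<open>The endpoints are limits, not the values of the total function at \<open>-1\<close> and \<open>1\<close>,
  which are irrelevant. They are meaningful only if the limits exist, as
  \<open>initial_curve\<close> demands.\<close>

definition curve_start :: "(real \<Rightarrow> complex) \<Rightarrow> complex"
  where "curve_start \<gamma> = Lim (at_right (-1)) \<gamma>"

definition curve_end :: "(real \<Rightarrow> complex) \<Rightarrow> complex"
  where "curve_end \<gamma> = Lim (at_left 1) \<gamma>"

definition closed_Jordan_curve :: "complex set \<Rightarrow> bool"
  where "closed_Jordan_curve J \<longleftrightarrow>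
    (\<exists>g. simple_path g \<and> pathfinish g = pathstart g \<and> path_image g = J)"

definition initial_boundary :: "(complex \<Rightarrow> complex) \<Rightarrow> (real \<Rightarrow> complex) \<Rightarrow> complex set"
  where "initial_boundary F \<gamma> =
    curve_image \<gamma> \<union> curve_image (F \<circ> \<gamma>) \<union> {curve_start \<gamma>, curve_end \<gamma>}"

text \<open>\<open>F\<close> need not be continuous at the two fixed points; the convergence of
  \<open>F \<circ> \<gamma>\<close> to them and the Jordan curve property are therefore part of the definition.\<close>

definition initial_curve :: "(complex \<Rightarrow> complex) \<Rightarrow> (real \<Rightarrow> complex) \<Rightarrow> bool"
  where "initial_curve F \<gamma> \<longleftrightarrow>
    continuous_on {-1<..<1} \<gamma> \<and>
    F analytic_on curve_image \<gamma> \<and>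
    inj_on \<gamma> {-1<..<1} \<and>
    inj_on (F \<circ> \<gamma>) {-1<..<1} \<and>
    curve_image \<gamma> \<inter> curve_image (F \<circ> \<gamma>) = {} \<and>
    (\<gamma> \<longlongrightarrow> curve_start \<gamma>) (at_right (-1)) \<and>
    (\<gamma> \<longlongrightarrow> curve_end \<gamma>) (at_left 1) \<and>
    curve_start \<gamma> \<noteq> curve_end \<gamma> \<and>
    F (curve_start \<gamma>) = curve_start \<gamma> \<and>
    F (curve_end \<gamma>) = curve_end \<gamma> \<and>
    ((F \<circ> \<gamma>) \<longlongrightarrow> curve_start \<gamma>) (at_right (-1)) \<and>
    ((F \<circ> \<gamma>) \<longlongrightarrow> curve_end \<gamma>) (at_left 1) \<and>
    closed_Jordan_curve (initial_boundary F \<gamma>)"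

definition initial_region :: "(complex \<Rightarrow> complex) \<Rightarrow> (real \<Rightarrow> complex) \<Rightarrow> complex set"
  where "initial_region F \<gamma> =
    curve_image \<gamma> \<union> inside (initial_boundary F \<gamma>) \<union> curve_image (F \<circ> \<gamma>)"

definition Abel_function_on ::
    "(complex \<Rightarrow> complex) \<Rightarrow> complex set \<Rightarrow> (complex \<Rightarrow> complex) \<Rightarrow> bool"
  where "Abel_function_on F H \<alpha> \<longleftrightarrow> (\<forall>z \<in> H \<inter> F -` H. \<alpha> (F z) = \<alpha> z + 1)"

end

theory Submission
  imports Defs
begin

text \<open>
  Let \<open>C\<close> be the inner region. Since \<open>\<alpha> (F z) = \<alpha> z + 1\<close> on \<open>\<gamma>\<close>, the function \<open>G (\<alpha> z + k) = \<beta> z + k\<close> is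
  an automorphism of the plane commuting with the translation by one, hence a translation, as soon as the
  integer translates of \<open>\<alpha> (C \<union> \<gamma>)\<close> are pairwise disjoint; this disjointness is the heart of the matter. If
  \<open>\<alpha> z\<^sub>2 = \<alpha> z\<^sub>1 + 1\<close> for two points of \<open>C\<close>, then a loop joins the two sides of the curve \<open>\<alpha> \<circ> \<gamma>\<close> and
  meets the curve in a single crossing, so its winding numbers about the two ends of the curve differ. On the
  other hand, both are zero: by a length-area argument there are small crosscuts of \<open>C\<close> near either
  fixed point whose images under \<open>\<alpha>\<close> are tiny or far out. If they are tiny, they extend to an arc
  from \<open>\<alpha> (\<gamma> t)\<close> to \<open>\<alpha> (\<gamma> t) + 1\<close> whose translates form a ray to infinity that misses the loop. Chords of
  integral length are reduced to chords of length one as in Hopf's chord theorem. Finally, \<open>G\<close> is entire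
  because \<open>F\<close> carries the outer side of \<open>\<gamma>\<close> into \<open>C\<close>; zeros of \<open>\<alpha>'\<close> on \<open>\<gamma>\<close> yield removable
  singularities.
\<close>

section \<open>Winding numbers and crossings\<close>

text \<open>The obstacle is that nothing is known about \<open>\<alpha>\<close> near the two fixed
  points: along the curve it may oscillate or be unbounded there, so the image of the tile is not
  visibly a strip and cannot be compared with its translates from the boundary. Only univalence is
  available. The length-area estimate turns it into control, but merely along some arbitrarily small
  crosscuts. Tiny crosscut images are useful because a set of diameter below one has no unit chord;
  the chord theorem then restricts the translates of the curve that such an image meets to the two
  on which it ends. This is the origin of the radius 1/4. A translate of the arc could still reach
  the image of the tile through the opposite fixed point. Hence both fixed points are treated at
  once: small crosscuts at the second one must miss an arc built at the first. For this a limit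
  value at the second is fixed beforehand, and the radius at the first avoids a countable set
  depending on it.\<close>

lemma winding_number_eq_log:
  assumes "path p" "continuous_on {0..1} l" "\<And>t. t \<in> {0..1} \<Longrightarrow> p t - z = exp (l t)"
  shows "winding_number p z = (l 1 - l 0) / (2 * of_real pi * \<i>)"
proof -
  have "z \<notin> path_image p"
    using assms(3) by (force simp: path_image_def)
  then obtain q where q: "path q" "pathfinish q - pathstart q = 2 * of_real pi * \<i> * winding_number p z"
      "\<And>t. t \<in> {0..1} \<Longrightarrow> p t = z + exp (q t)"
    using winding_number_as_continuous_log[OF assms(1)] by blast
  \<comment> \<open>Both are continuous logarithms of \<open>p - z\<close>, so the difference takes
    values in 2 pi i Z. Distinct values are at least \<open>2 * pi\<close> apart.\<close>
  have "(\<lambda>t. l t - q t) constant_on {0..1}"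
  proof (rule continuous_discrete_range_constant)
    show "connected {0..1::real}" by simp
    show "continuous_on {0..1} (\<lambda>t. l t - q t)"
      using assms(2) q(1) by (auto intro!: continuous_intros simp: path_def)
    show "\<exists>e>0. \<forall>y. y \<in> {0..1} \<and> l y - q y \<noteq> l x - q x \<longrightarrow> e \<le> norm (l y - q y - (l x - q x))"
      if x: "x \<in> {0..1}" for x
    proof (intro exI[of _ "2 * pi"] conjI allI impI)
      fix y assume y: "y \<in> {0..1} \<and> l y - q y \<noteq> l x - q x"
      have one: "exp (l t - q t) = 1" if "t \<in> {0..1}" for t
      proof -
        have "exp (q t) = exp (l t)" using q(3)[OF that] assms(3)[OF that] by (simp add: algebra_simps)
        then show ?thesis by (simp add: exp_diff)
      qed
      then have "exp (l y - q y) = exp (l x - q x)" using x y by simp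
      then obtain n :: int where n: "l y - q y = l x - q x + (of_int (2 * n) * pi) * \<i>"
        unfolding exp_eq by blast
      then have "n \<noteq> 0" using y by auto
      then have "1 \<le> \<bar>real_of_int n\<bar>" by linarith
      moreover have "norm (l y - q y - (l x - q x)) = 2 * \<bar>real_of_int n\<bar> * pi"
        unfolding n by (simp add: norm_mult)
      ultimately show "2 * pi \<le> norm (l y - q y - (l x - q x))" by simp
    qed auto
  qed
  then obtain k where k: "\<And>t. t \<in> {0..1} \<Longrightarrow> l t - q t = k" unfolding constant_on_def by blast
  have "l 1 = q 1 + k" "l 0 = q 0 + k" using k[of 1] k[of 0] by (auto simp: algebra_simps)
  then have "l 1 - l 0 = q 1 - q 0" by simp
  also have "\<dots> = 2 * of_real pi * \<i> * winding_number p z"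
    using q(2) by (simp add: pathfinish_def pathstart_def)
  finally show ?thesis by (simp add: field_simps)
qed

text \<open>On the square, which is contractible, \<open>p s - q t\<close> has a continuous
  logarithm. Its alternating sum over the four corners can be collected along one pair of opposite
  sides or along the other; up to the factor 2 pi i these are the two sides of the equation.\<close>

lemma winding_number_exchange:
  assumes "path p" "path q" "path_image p \<inter> path_image q = {}"
  shows "winding_number p (q 1) - winding_number p (q 0) =
         winding_number q (p 1) - winding_number q (p 0)"
proof -
  let ?S = "{0..1::real} \<times> {0..1::real}"
  have "continuous_on ?S (\<lambda>z. p (fst z))"
    by (rule continuous_on_compose2[of "{0..1}" p])
      (use assms(1) in \<open>auto simp: path_def intro!: continuous_on_fst continuous_on_id\<close>)
  moreover have "continuous_on ?S (\<lambda>z. q (snd z))"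
    by (rule continuous_on_compose2[of "{0..1}" q])
      (use assms(2) in \<open>auto simp: path_def intro!: continuous_on_snd continuous_on_id\<close>)
  ultimately have "continuous_on ?S (\<lambda>z. p (fst z) - q (snd z))"
    by (rule continuous_on_diff)
  moreover have "contractible ?S"
    by (intro convex_imp_contractible convex_Times) auto
  moreover have "p (fst z) - q (snd z) \<noteq> 0" if "z \<in> ?S" for z
    using assms(3) that by (auto simp: path_image_def)
  ultimately obtain l where l: "continuous_on ?S l" "\<And>z. z \<in> ?S \<Longrightarrow> p (fst z) - q (snd z) = exp (l z)"
    using continuous_logarithm_on_contractible[of ?S "\<lambda>z. p (fst z) - q (snd z)"] by blast
  have 1: "winding_number p (q t) = (l (1,t) - l (0,t)) / (2 * of_real pi * \<i>)" if "t \<in> {0..1}" for t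
  proof (rule winding_number_eq_log[OF assms(1), of "\<lambda>s. l (s,t)"])
    show "continuous_on {0..1} (\<lambda>s. l (s, t))"
      by (rule continuous_on_compose2[OF l(1)]) (use that in \<open>auto intro!: continuous_intros\<close>)
    show "p s - q t = exp (l (s, t))" if "s \<in> {0..1}" for s using l(2)[of "(s,t)"] that \<open>t \<in> _\<close> by auto
  qed
  have 2: "winding_number q (p s) = (l (s,1) - l (s,0)) / (2 * of_real pi * \<i>)" if "s \<in> {0..1}" for s
  proof -
    \<comment> \<open>\<open>q t - p s\<close> is the negative of \<open>p s - q t\<close>, hence
      the summand pi i in the logarithm.\<close>
    have "winding_number q (p s) = ((l (s,1) + of_real pi * \<i>) - (l (s,0) + of_real pi * \<i>)) / (2 * of_real pi * \<i>)"
    proof (rule winding_number_eq_log[OF assms(2), of "\<lambda>t. l (s,t) + of_real pi * \<i>"])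
      show "continuous_on {0..1} (\<lambda>t. l (s, t) + of_real pi * \<i>)"
        by (intro continuous_on_add continuous_on_const, rule continuous_on_compose2[OF l(1)]) (use that in \<open>auto intro!: continuous_intros\<close>)
      show "q t - p s = exp (l (s, t) + of_real pi * \<i>)" if "t \<in> {0..1}" for t
        using l(2)[of "(s,t)"] that \<open>s \<in> _\<close> by (auto simp: exp_add algebra_simps)
    qed
    then show ?thesis by simp
  qed
  show ?thesis
    by (simp add: 1 2 flip: diff_divide_distrib)
qed

text \<open>The signed number of crossings of two paths. It vanishes for disjoint paths by
  \<open>winding_number_exchange\<close>.\<close>

definition crossing :: "(real \<Rightarrow> complex) \<Rightarrow> (real \<Rightarrow> complex) \<Rightarrow> complex" where
  "crossing p q = (winding_number p (q 1) - winding_number p (q 0)) -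
                  (winding_number q (p 1) - winding_number q (p 0))"

text \<open>On \<open>N\<close> the difference quotient of \<open>f\<close>, divided by
  \<open>k\<close>, stays in the right half-plane, where the principal logarithm is continuous.
  Added to a logarithm of \<open>p - y\<close> and a constant, it gives a logarithm of
  \<open>f \<circ> p - f y\<close>, so \<open>f\<close> alters the winding number only by an
  end-point term.\<close>

lemma winding_number_comp_local:
  assumes "path p" "path_image p \<subseteq> N" "y \<in> N" "y \<notin> path_image p" "continuous_on N f"
    and "\<And>x y. x \<in> N \<Longrightarrow> y \<in> N \<Longrightarrow> x \<noteq> y \<Longrightarrow> 0 < Re ((f x - f y) / (k * (x - y)))"
  shows "winding_number (f \<circ> p) (f y) = winding_number p y +
     (Ln ((f (p 1) - f y) / (k * (p 1 - y))) - Ln ((f (p 0) - f y) / (k * (p 0 - y)))) / (2 * of_real pi * \<i>)"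
proof -
  obtain q where q: "path q" "pathfinish q - pathstart q = 2 * of_real pi * \<i> * winding_number p y"
      "\<And>t. t \<in> {0..1} \<Longrightarrow> p t = y + exp (q t)"
    using winding_number_as_continuous_log[OF assms(1,4)] by blast
  define L where "L = (\<lambda>t. Ln ((f (p t) - f y) / (k * (p t - y))))"
  have pN: "p t \<in> N" "p t \<noteq> y" if "t \<in> {0..1}" for t
    using assms(2,4) that by (auto simp: path_image_def)
  have pos: "0 < Re ((f (p t) - f y) / (k * (p t - y)))" if "t \<in> {0..1}" for t
    using assms(3,6) pN[OF that] by blast
  have k: "k \<noteq> 0" using pos[of 0] by auto
  have cp: "continuous_on {0..1} p" using assms(1) by (simp add: path_def)
  have "continuous_on {0..1} (\<lambda>t. f (p t))"
    by (rule continuous_on_compose2[OF assms(5) cp]) (use pN in auto)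
  then have "continuous_on {0..1} (\<lambda>t. (f (p t) - f y) / (k * (p t - y)))"
    using cp k pN(2) by (intro continuous_on_divide continuous_on_diff continuous_on_mult continuous_on_const) auto
  then have "continuous_on {0..1} L" unfolding L_def
  proof (rule continuous_on_Ln')
    fix t :: real assume "t \<in> {0..1}"
    from pos[OF this] show "(f (p t) - f y) / (k * (p t - y)) \<notin> \<real>\<^sub>\<le>\<^sub>0"
      by (simp add: complex_nonpos_Reals_iff)
  qed
  have "winding_number (f \<circ> p) (f y) =
      ((Ln k + q 1 + L 1) - (Ln k + q 0 + L 0)) / (2 * of_real pi * \<i>)"
  proof (rule winding_number_eq_log[of _ "\<lambda>t. Ln k + q t + L t"])
    show "path (f \<circ> p)"
      by (meson assms(1,2,5) continuous_on_subset path_continuous_image)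
    show "continuous_on {0..1} (\<lambda>t. Ln k + q t + L t)"
      using \<open>continuous_on {0..1} L\<close> q(1) by (auto intro!: continuous_intros simp: path_def)
    show "(f \<circ> p) t - f y = exp (Ln k + q t + L t)" if t: "t \<in> {0..1}" for t
    proof -
      have "exp (L t) = (f (p t) - f y) / (k * (p t - y))"
        unfolding L_def using pos[OF t] by (intro exp_Ln) auto
      moreover have "exp (q t) = p t - y" using q(3)[OF t] by simp
      ultimately show ?thesis using k pN(2)[OF t] by (simp add: exp_add)
    qed
  qed
  moreover have "q 1 - q 0 = 2 * of_real pi * \<i> * winding_number p y"
    using q(2) by (simp add: pathfinish_def pathstart_def)
  then have "q 1 = q 0 + 2 * of_real pi * \<i> * winding_number p y" by (simp add: algebra_simps)
  ultimately show ?thesis by (simp add: L_def field_simps)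
qed

text \<open>The end-point term of \<open>winding_number_comp_local\<close> is symmetric in its two
  arguments. Each of the four pairs of end points occurs in both halves of the crossing, with
  opposite signs, so these terms cancel.\<close>

lemma crossing_comp_local:
  assumes "path p" "path q" "path_image p \<subseteq> N" "path_image q \<subseteq> N"
    and "q 0 \<notin> path_image p" "q 1 \<notin> path_image p" "p 0 \<notin> path_image q" "p 1 \<notin> path_image q"
    and "continuous_on N f"
    and "\<And>x y. x \<in> N \<Longrightarrow> y \<in> N \<Longrightarrow> x \<noteq> y \<Longrightarrow> 0 < Re ((f x - f y) / (k * (x - y)))"
  shows "crossing (f \<circ> p) (f \<circ> q) = crossing p q"
proof -
  define L where "L = (\<lambda>x y. Ln ((f x - f y) / (k * (x - y))) / (2 * of_real pi * \<i>))"
  have sym: "L x y = L y x" for x y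
  proof -
    have "(f x - f y) / (k * (x - y)) = (f y - f x) / (k * (y - x))"
      by (metis minus_diff_eq minus_divide_divide mult_minus_right)
    then show ?thesis by (simp add: L_def)
  qed
  have e: "q 0 \<in> N" "q 1 \<in> N" "p 0 \<in> N" "p 1 \<in> N"
    using assms(3,4) by (auto simp: path_image_def)
  have a: "winding_number (f \<circ> p) (f y) = winding_number p y + (L (p 1) y - L (p 0) y)"
    if "y \<in> N" "y \<notin> path_image p" for y
    unfolding L_def using winding_number_comp_local[OF assms(1,3) that assms(9,10)]
    by (simp add: diff_divide_distrib)
  have b: "winding_number (f \<circ> q) (f y) = winding_number q y + (L (q 1) y - L (q 0) y)"
    if "y \<in> N" "y \<notin> path_image q" for y
    unfolding L_def using winding_number_comp_local[OF assms(2,4) that assms(9,10)]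
    by (simp add: diff_divide_distrib)
  show ?thesis
    unfolding crossing_def o_apply
    using a[OF e(1) assms(5), unfolded o_def] a[OF e(2) assms(6), unfolded o_def]
      b[OF e(3) assms(7), unfolded o_def] b[OF e(4) assms(8), unfolded o_def]
      sym[of "p 0" "q 0"] sym[of "p 1" "q 0"] sym[of "p 0" "q 1"] sym[of "p 1" "q 1"]
    unfolding o_def by algebra
qed

text \<open>Once the derivative varies by less than half its modulus at \<open>c\<close>, the mean
  value inequality for \<open>f w - deriv f c * w\<close> puts the normalised quotient within 1/2 of
  1. The bound also yields injectivity on the ball.\<close>

lemma holomorphic_quotient_pos:
  assumes "f holomorphic_on S" "open S" "c \<in> S" "deriv f c \<noteq> 0"
  obtains e where "e > 0" "ball c e \<subseteq> S"
    "\<And>x y. x \<in> ball c e \<Longrightarrow> y \<in> ball c e \<Longrightarrow> x \<noteq> y \<Longrightarrow> 0 < Re ((f x - f y) / (deriv f c * (x - y)))"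
proof -
  let ?k = "deriv f c"
  have "continuous_on S (deriv f)"
    using assms(1,2) holomorphic_deriv holomorphic_on_imp_continuous_on by blast
  then have "\<exists>d>0. \<forall>w\<in>S. dist w c < d \<longrightarrow> dist (deriv f w) ?k < norm ?k / 2"
    unfolding continuous_on_iff using assms(3,4) by (metis half_gt_zero zero_less_norm_iff)
  then obtain d where d: "d > 0" "\<And>w. w \<in> S \<Longrightarrow> dist w c < d \<Longrightarrow> dist (deriv f w) ?k < norm ?k / 2"
    by blast
  obtain d' where d': "d' > 0" "ball c d' \<subseteq> S" using openE[OF assms(2,3)] by blast
  define e where "e = min d d'"
  have e: "e > 0" "ball c e \<subseteq> S"
    using d(1) d' subset_ball[of e d' c] by (auto simp: e_def)
  have "0 < Re ((f x - f y) / (?k * (x - y)))" if xy: "x \<in> ball c e" "y \<in> ball c e" "x \<noteq> y" for x y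
  proof -
    have "norm ((f x - ?k * x) - (f y - ?k * y)) \<le> norm ?k / 2 * norm (x - y)"
    proof (rule field_differentiable_bound[of "ball c e" "\<lambda>w. f w - ?k * w" "\<lambda>w. deriv f w - ?k"])
      show "((\<lambda>w. f w - ?k * w) has_field_derivative deriv f z - ?k) (at z within ball c e)" if "z \<in> ball c e" for z
      proof -
        have "(f has_field_derivative deriv f z) (at z)"
          using that e(2) by (intro holomorphic_derivI[OF assms(1,2)]) auto
        then have "((\<lambda>w. f w - ?k * w) has_field_derivative deriv f z - ?k * 1) (at z)"
          by (intro DERIV_diff DERIV_cmult DERIV_ident)
        then show ?thesis by (simp add: has_field_derivative_at_within)
      qed
      show "norm (deriv f z - ?k) \<le> norm ?k / 2" if "z \<in> ball c e" for z
        using that e(2) d(2)[of z] by (auto simp: e_def dist_norm norm_minus_commute intro: less_imp_le)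
    qed (use xy in auto)
    then have n: "norm ((f x - ?k * x) - (f y - ?k * y)) \<le> norm (?k * (x - y)) / 2"
      by (simp add: norm_mult)
    have pos: "0 < norm (?k * (x - y))" using assms(4) xy(3) by simp
    have "(f x - f y) / (?k * (x - y)) - 1 = ((f x - ?k * x) - (f y - ?k * y)) / (?k * (x - y))"
      using assms(4) xy(3) by (simp add: field_simps)
    then have "norm ((f x - f y) / (?k * (x - y)) - 1)
        = norm ((f x - ?k * x) - (f y - ?k * y)) / norm (?k * (x - y))"
      by (metis norm_divide)
    also have "\<dots> \<le> 1/2"
      using n pos by (subst pos_divide_le_eq) auto
    finally have "norm ((f x - f y) / (?k * (x - y)) - 1) \<le> 1/2" .
    then have "\<bar>Re ((f x - f y) / (?k * (x - y)) - 1)\<bar> \<le> 1/2"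
      using abs_Re_le_cmod order_trans by blast
    then show ?thesis unfolding minus_complex.sel one_complex.sel by linarith
  qed
  with e that show ?thesis by blast
qed

text \<open>Only the piece of \<open>g\<close> between \<open>u1\<close> and \<open>u2\<close> can
  meet \<open>k\<close>. The other two pieces obey \<open>winding_number_exchange\<close>, and the
  three contributions telescope up to the crossing of the middle piece.\<close>

lemma winding_number_jump:
  assumes "path g" "path k" "0 \<le> u1" "u1 \<le> u2" "u2 \<le> 1"
    and "k 0 \<notin> path_image g" "k 1 \<notin> path_image g"
    and "path_image k \<inter> g ` {0..u1} = {}" "path_image k \<inter> g ` {u2..1} = {}"
  shows "winding_number g (k 1) - winding_number g (k 0) =
     winding_number k (g 1) - winding_number k (g 0) - crossing k (subpath u1 u2 g)"
proof -
  have dec: "winding_number g z = winding_number (subpath 0 u1 g) z + winding_number (subpath u1 u2 g) z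
        + winding_number (subpath u2 1 g) z" if "z \<notin> path_image g" for z
    using winding_number_subpath_combine[OF assms(1) that, of 0 u1 1]
      winding_number_subpath_combine[OF assms(1) that, of u1 u2 1] assms(3-5)
    by (auto simp: subpath_trivial add.assoc)
  have p1: "path (subpath 0 u1 g)" and p3: "path (subpath u2 1 g)"
    using assms by auto
  have i1: "path_image k \<inter> path_image (subpath 0 u1 g) = {}"
    and i3: "path_image k \<inter> path_image (subpath u2 1 g) = {}"
    using assms by (auto simp: path_image_subpath_gen closed_segment_eq_real_ivl)
  have e1: "winding_number (subpath 0 u1 g) (k 1) - winding_number (subpath 0 u1 g) (k 0)
     = winding_number k (g u1) - winding_number k (g 0)"
    using winding_number_exchange[OF assms(2) p1 i1] by (simp add: subpath_def)
  have e3: "winding_number (subpath u2 1 g) (k 1) - winding_number (subpath u2 1 g) (k 0)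
     = winding_number k (g 1) - winding_number k (g u2)"
    using winding_number_exchange[OF assms(2) p3 i3] by (simp add: subpath_def)
  have e2: "crossing k (subpath u1 u2 g) = (winding_number k (g u2) - winding_number k (g u1)) -
     (winding_number (subpath u1 u2 g) (k 1) - winding_number (subpath u1 u2 g) (k 0))"
    by (simp add: crossing_def subpath_def)
  show ?thesis
    unfolding e2 dec[OF assms(6)] dec[OF assms(7)] using e1 e3 by algebra
qed

section \<open>Integral chords\<close>

text \<open>Used after a quarter turn, where a horizontal translation becomes vertical. On the
  imaginary axis the argument is \<open>pi / 2\<close> or \<open>- pi / 2\<close>, hence the
  separate case.\<close>

lemma Im_Ln_antimono:
  assumes "0 \<le> Re w" "w \<noteq> 0" "0 \<le> d" "w - \<i> * of_real d \<noteq> 0"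
  shows "Im (Ln (w - \<i> * of_real d)) \<le> Im (Ln w)"
proof (cases "Re w = 0")
  case True
  show ?thesis
  proof (cases "Im w > 0")
    case True
    then have "Im (Ln w) = pi / 2" using assms \<open>Re w = 0\<close> Im_Ln_eq_pi_half(1) by blast
    moreover have "\<bar>Im (Ln (w - \<i> * of_real d))\<bar> \<le> pi / 2"
      using assms by (subst Re_Ln_pos_le) auto
    ultimately show ?thesis by linarith
  next
    case False
    then have "Im w < 0" using True assms(2) by (auto simp: complex_eq_iff)
    then have "Im (Ln w) = - pi / 2" using assms \<open>Re w = 0\<close> Im_Ln_eq_pi_half(2) by blast
    moreover have "Im (Ln (w - \<i> * of_real d)) = - pi / 2"
      using assms(3,4) \<open>Im w < 0\<close> True Im_Ln_eq_pi_half(2)[OF assms(4)] by simp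
    ultimately show ?thesis by simp
  qed
next
  case False
  then have "0 < Re w" using assms by simp
  then have "(Im w - d) / Re w \<le> Im w / Re w" using assms by (intro divide_right_mono) auto
  then have "arctan ((Im w - d) / Re w) \<le> arctan (Im w / Re w)" by (simp add: arctan_monotone')
  then show ?thesis
    using \<open>0 < Re w\<close> assms Im_Ln_eq[OF assms(2)] Im_Ln_eq[OF assms(4)] by simp
qed

lemma Re_divide_i: "Re (w / \<i>) = Im w"
  by simp

text \<open>The factor \<open>\<i>\<close> turns the closed half-plane below \<open>z\<close> into
  the closed right half-plane, on which the principal logarithm is continuous away from the origin;
  so only the end points matter.\<close>

lemma Re_winding_number_lower_half:
  assumes "path p" "z \<notin> path_image p" "\<And>t. t \<in> {0..1} \<Longrightarrow> Im (p t) \<le> Im z"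
  shows "Re (winding_number p z) = (Im (Ln (\<i> * (p 1 - z))) - Im (Ln (\<i> * (p 0 - z)))) / (2 * pi)"
proof -
  have nz: "p t - z \<noteq> 0" if "t \<in> {0..1}" for t
    using assms(2) that by (auto simp: path_image_def)
  have "winding_number p z =
     ((Ln (\<i> * (p 1 - z)) - of_real pi / 2 * \<i>) - (Ln (\<i> * (p 0 - z)) - of_real pi / 2 * \<i>)) / (2 * of_real pi * \<i>)"
  proof (rule winding_number_eq_log[OF assms(1), of "\<lambda>t. Ln (\<i> * (p t - z)) - of_real pi / 2 * \<i>"])
    have "continuous_on {0..1} (\<lambda>t. Ln (\<i> * (p t - z)))"
    proof (rule continuous_on_Ln')
      show "continuous_on {0..1} (\<lambda>t. \<i> * (p t - z))"
        using assms(1) by (intro continuous_on_mult continuous_on_diff continuous_on_const) (simp add: path_def)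
      show "\<i> * (p t - z) \<notin> \<real>\<^sub>\<le>\<^sub>0" if "t \<in> {0..1}" for t
        using nz[OF that] assms(3)[OF that] by (auto simp: complex_nonpos_Reals_iff complex_eq_iff)
    qed
    then show "continuous_on {0..1} (\<lambda>t. Ln (\<i> * (p t - z)) - of_real pi / 2 * \<i>)"
      by (intro continuous_on_diff continuous_on_const)
    show "p t - z = exp (Ln (\<i> * (p t - z)) - of_real pi / 2 * \<i>)" if "t \<in> {0..1}" for t
      using nz[OF that] exp_Ln[of \<i>] by (simp add: exp_diff mult.commute)
  qed
  then have "winding_number p z = (Ln (\<i> * (p 1 - z)) - Ln (\<i> * (p 0 - z))) / (2 * of_real pi * \<i>)"
    by simp
  also have "\<dots> = (Ln (\<i> * (p 1 - z)) - Ln (\<i> * (p 0 - z))) / \<i> / of_real (2 * pi)"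
    by (simp only: divide_divide_eq_left of_real_mult of_real_numeral mult.commute mult.left_commute mult.assoc)
  finally have "Re (winding_number p z) = Re ((Ln (\<i> * (p 1 - z)) - Ln (\<i> * (p 0 - z))) / \<i>) / (2 * pi)"
    by (simp only: Re_divide_of_real)
  then show ?thesis by (simp only: Re_divide_i minus_complex.sel)
qed

lemma Re_winding_number_upper_half:
  assumes "path p" "z \<notin> path_image p" "\<And>t. t \<in> {0..1} \<Longrightarrow> Im z \<le> Im (p t)"
  shows "Re (winding_number p z) = (Im (Ln (- \<i> * (p 1 - z))) - Im (Ln (- \<i> * (p 0 - z)))) / (2 * pi)"
proof -
  have nz: "p t - z \<noteq> 0" if "t \<in> {0..1}" for t
    using assms(2) that by (auto simp: path_image_def)
  have "winding_number p z =
     ((Ln (- \<i> * (p 1 - z)) + of_real pi / 2 * \<i>) - (Ln (- \<i> * (p 0 - z)) + of_real pi / 2 * \<i>)) / (2 * of_real pi * \<i>)"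
  proof (rule winding_number_eq_log[OF assms(1), of "\<lambda>t. Ln (- \<i> * (p t - z)) + of_real pi / 2 * \<i>"])
    have "continuous_on {0..1} (\<lambda>t. Ln (- \<i> * (p t - z)))"
    proof (rule continuous_on_Ln')
      show "continuous_on {0..1} (\<lambda>t. - \<i> * (p t - z))"
        using assms(1) by (intro continuous_on_mult continuous_on_diff continuous_on_const) (simp add: path_def)
      show "- \<i> * (p t - z) \<notin> \<real>\<^sub>\<le>\<^sub>0" if "t \<in> {0..1}" for t
        using nz[OF that] assms(3)[OF that] by (auto simp: complex_nonpos_Reals_iff complex_eq_iff)
    qed
    then show "continuous_on {0..1} (\<lambda>t. Ln (- \<i> * (p t - z)) + of_real pi / 2 * \<i>)"
      by (intro continuous_on_add continuous_on_const)
    show "p t - z = exp (Ln (- \<i> * (p t - z)) + of_real pi / 2 * \<i>)" if "t \<in> {0..1}" for t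
      using nz[OF that] exp_Ln[of \<i>] by (simp add: exp_add mult.commute)
  qed
  then have "winding_number p z = (Ln (- \<i> * (p 1 - z)) - Ln (- \<i> * (p 0 - z))) / (2 * of_real pi * \<i>)"
    by simp
  also have "\<dots> = (Ln (- \<i> * (p 1 - z)) - Ln (- \<i> * (p 0 - z))) / \<i> / of_real (2 * pi)"
    by (simp only: divide_divide_eq_left of_real_mult of_real_numeral mult.commute mult.left_commute mult.assoc)
  finally have "Re (winding_number p z) = Re ((Ln (- \<i> * (p 1 - z)) - Ln (- \<i> * (p 0 - z))) / \<i>) / (2 * pi)"
    by (simp only: Re_divide_of_real)
  then show ?thesis by (simp only: Re_divide_i minus_complex.sel)
qed

lemma path_image_translate: "path_image (\<lambda>t. p t + c) = (\<lambda>w. w + c) ` path_image p"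
  by (auto simp: path_image_def)

text \<open>The inductive step of Hopf's argument. The path is continued periodically and restarted
  at a highest point. The translate by one of its piece from a highest to a lowest point would have
  to get from above the continuation to below it. Without chords of length one and \<open>m\<close>
  the two are disjoint, and half-plane estimates of the four winding numbers contradict
  \<open>winding_number_exchange\<close>.\<close>

lemma no_chord_path_step:
  fixes p :: "real \<Rightarrow> complex"
  assumes p: "path p" "p 1 = p 0 + of_nat (Suc m)" and "m \<ge> 1"
    and one: "\<And>x y. x \<in> path_image p \<Longrightarrow> y \<in> path_image p \<Longrightarrow> y \<noteq> x + 1"
    and m: "\<And>x y. x \<in> path_image p \<Longrightarrow> y \<in> path_image p \<Longrightarrow> y \<noteq> x + of_nat m"
  shows False
proof -
  have cp: "continuous_on {0..1} (\<lambda>t. Im (p t))"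
    using p(1) by (simp add: path_def continuous_on_Im)
  obtain u where u: "u \<in> {0..1}" "\<And>t. t \<in> {0..1} \<Longrightarrow> Im (p t) \<le> Im (p u)"
    using continuous_attains_sup[OF compact_Icc _ cp] by auto
  obtain v where v: "v \<in> {0..1}" "\<And>t. t \<in> {0..1} \<Longrightarrow> Im (p v) \<le> Im (p t)"
    using continuous_attains_inf[OF compact_Icc _ cp] by auto
  define T where "T = p u"
  define B where "B = p v"
  \<comment> \<open>\<open>f\<close> is one period of the continuation, from the top
    \<open>T\<close> to \<open>T + m + 1\<close>; \<open>q\<close> is the piece from top to bottom,
    moved by one. A common point would be a chord of length one or, on the shifted part of
    \<open>f\<close>, of length \<open>m\<close>.\<close>
  define f where "f = subpath u 1 p +++ (\<lambda>t. subpath 0 u p t + of_nat (Suc m))"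
  define q where "q = (\<lambda>t. subpath u v p t + 1)"
  have TB: "T \<in> path_image p" "B \<in> path_image p" using u v by (auto simp: T_def B_def path_image_def)
  have pim: "path_image (subpath a b p) \<subseteq> path_image p" if "a \<in> {0..1}" "b \<in> {0..1}" for a b
    using that by (intro path_image_subpath_subset) auto
  have sh: "path (\<lambda>t. subpath 0 u p t + of_nat (Suc m))" "path q"
    using p(1) u(1) v(1) path_subpath[of p 0 u] path_subpath[of p u v]
    unfolding q_def path_def by (auto intro!: continuous_on_add continuous_on_const)
  have pf: "path f" unfolding f_def
  proof (rule path_join_imp)
    show "path (subpath u 1 p)" using p(1) u(1) by simp
    show "pathfinish (subpath u 1 p) = pathstart (\<lambda>t. subpath 0 u p t + of_nat (Suc m))"
      using p(2) by (simp add: pathfinish_def pathstart_def subpath_def)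
  qed (rule sh)
  have imf: "path_image f \<subseteq> path_image p \<union> (\<lambda>w. w + of_nat (Suc m)) ` path_image p"
    unfolding f_def using pim[of u 1] pim[of 0 u] u(1)
    by (intro order_trans[OF path_image_join_subset] Un_mono) (auto simp: path_image_translate)
  have imq: "path_image q \<subseteq> (\<lambda>w. w + 1) ` path_image p"
    unfolding q_def path_image_translate using pim[of u v] u(1) v(1) by auto
  have f01: "f 0 = T" "f 1 = T + of_nat (Suc m)" and q01: "q 0 = T + 1" "q 1 = B + 1"
    by (auto simp: f_def q_def T_def B_def joinpaths_def subpath_def)
  have disj: "path_image f \<inter> path_image q = {}"
  proof -
    have "w \<notin> path_image f" if w: "w \<in> path_image q" for w
    proof
      assume "w \<in> path_image f"
      moreover obtain x where x: "x \<in> path_image p" "w = x + 1" using imq w by blast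
      ultimately consider "x + 1 \<in> path_image p"
        | y where "y \<in> path_image p" "x + 1 = y + of_nat (Suc m)" using imf by blast
      then show False
      proof cases
        case 1 then show False using one[OF x(1)] by blast
      next
        case 2
        then have "x = y + of_nat m" by simp
        then show False using m[OF 2(1) x(1)] by blast
      qed
    qed
    then show ?thesis by auto
  qed
  have Imp: "Im B \<le> Im w" "Im w \<le> Im T" if "w \<in> path_image p" for w
    using u(2) v(2) that by (auto simp: T_def B_def path_image_def)
  have Imf: "Im B \<le> Im (f t)" "Im (f t) \<le> Im T" if "t \<in> {0..1}" for t
  proof -
    have "f t \<in> path_image f" using that by (auto simp: path_image_def)
    with imf show "Im B \<le> Im (f t)" "Im (f t) \<le> Im T" using Imp by auto
  qed
  have Imq: "Im (q t) \<le> Im T" if "t \<in> {0..1}" for t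
  proof -
    have "q t \<in> path_image q" using that by (auto simp: path_image_def)
    with imq show ?thesis using Imp by auto
  qed
  have inq: "q 0 \<in> path_image q" "q 1 \<in> path_image q" "f 0 \<in> path_image f" "f 1 \<in> path_image f"
    by (auto simp: path_image_def)
  have n0: "q 0 \<notin> path_image f" "q 1 \<notin> path_image f" "f 0 \<notin> path_image q" "f 1 \<notin> path_image q"
    using disj inq by blast+
  have ex: "Re (winding_number f (q 1)) - Re (winding_number f (q 0)) =
        Re (winding_number q (f 1)) - Re (winding_number q (f 0))"
    using winding_number_exchange[OF pf sh(2) disj] by (metis minus_complex.sel(1))
  have LnI: "Im (Ln (\<i> * of_nat n)) = pi / 2" if "n \<ge> 1" for n :: nat
    using that by (subst Im_Ln_eq_pi_half) auto
  have LnmI: "Im (Ln (- (\<i> * of_nat n))) = - pi / 2" if "n \<ge> 1" for n :: nat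
    using that by (subst Im_Ln_eq_pi_half) auto
  have bd: "\<bar>Im (Ln (\<i> * (w - z)))\<bar> \<le> pi / 2" if "Im w \<le> Im z" "w \<noteq> z" for w z
    using that by (subst Re_Ln_pos_le) auto
  \<comment> \<open>\<open>f\<close> passes below \<open>T + 1\<close> from left to right, half a
    turn in the positive sense. The other three values are only estimated: in \<open>ex\<close> the
    left side is then at most -1/2 and the right side is nonnegative.\<close>
  have a: "Re (winding_number f (q 0)) = 1/2"
  proof -
    have "Re (winding_number f (q 0)) = (Im (Ln (\<i> * (f 1 - q 0))) - Im (Ln (\<i> * (f 0 - q 0)))) / (2 * pi)"
      by (rule Re_winding_number_lower_half[OF pf n0(1)]) (use Imf q01 in auto)
    moreover have "\<i> * (f 1 - q 0) = \<i> * of_nat m" "\<i> * (f 0 - q 0) = - (\<i> * of_nat 1)"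
      by (auto simp: f01 q01 algebra_simps)
    ultimately show ?thesis using LnI[OF \<open>m \<ge> 1\<close>] LnmI[of 1] by simp
  qed
  have b: "Re (winding_number f (q 1)) \<le> 0"
  proof -
    have e: "Re (winding_number f (q 1)) = (Im (Ln (- \<i> * (f 1 - q 1))) - Im (Ln (- \<i> * (f 0 - q 1)))) / (2 * pi)"
      by (rule Re_winding_number_upper_half[OF pf n0(2)]) (use Imf q01 in auto)
    have "f 1 - q 1 \<noteq> 0" "f 0 - q 1 \<noteq> 0" using n0(2) inq by auto
    moreover have "- \<i> * (f 1 - q 1) = - \<i> * (f 0 - q 1) - \<i> * of_real (real (Suc m))"
      by (auto simp: f01 q01 algebra_simps)
    moreover have "0 \<le> Re (- \<i> * (f 0 - q 1))" using Imp(1)[OF TB(1)] by (simp add: f01 q01)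
    ultimately have "Im (Ln (- \<i> * (f 1 - q 1))) \<le> Im (Ln (- \<i> * (f 0 - q 1)))"
      using Im_Ln_antimono[of "- \<i> * (f 0 - q 1)" "real (Suc m)"] by (metis mult_eq_0_iff neg_equal_0_iff_equal complex_i_not_zero of_nat_0_le_iff)
    then show ?thesis unfolding e by (simp add: divide_nonpos_pos)
  qed
  have c: "0 \<le> Re (winding_number q (f 1))"
  proof -
    have e: "Re (winding_number q (f 1)) = (Im (Ln (\<i> * (q 1 - f 1))) - Im (Ln (\<i> * (q 0 - f 1)))) / (2 * pi)"
      by (rule Re_winding_number_lower_half[OF sh(2) n0(4)]) (use Imq f01 in auto)
    have "\<i> * (q 0 - f 1) = - (\<i> * of_nat m)" by (auto simp: f01 q01 algebra_simps)
    moreover have "\<bar>Im (Ln (\<i> * (q 1 - f 1)))\<bar> \<le> pi / 2"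
    proof (rule bd)
      show "Im (q 1) \<le> Im (f 1)" using Imq[of 1] by (simp add: f01)
      show "q 1 \<noteq> f 1" using n0(4) inq(2) by metis
    qed
    ultimately show ?thesis unfolding e using LnmI[OF \<open>m \<ge> 1\<close>] by simp
  qed
  have d: "Re (winding_number q (f 0)) \<le> 0"
  proof -
    have e: "Re (winding_number q (f 0)) = (Im (Ln (\<i> * (q 1 - f 0))) - Im (Ln (\<i> * (q 0 - f 0)))) / (2 * pi)"
      by (rule Re_winding_number_lower_half[OF sh(2) n0(3)]) (use Imq f01 in auto)
    have "\<i> * (q 0 - f 0) = \<i> * of_nat 1" by (auto simp: f01 q01 algebra_simps)
    moreover have "\<bar>Im (Ln (\<i> * (q 1 - f 0)))\<bar> \<le> pi / 2"
    proof (rule bd)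
      show "Im (q 1) \<le> Im (f 0)" using Imq[of 1] by (simp add: f01)
      show "q 1 \<noteq> f 0" using n0(3) inq(2) by metis
    qed
    ultimately show ?thesis unfolding e using LnI[of 1] by (simp add: divide_nonpos_pos)
  qed
  show False using ex a b c d by simp
qed

text \<open>Path-connectedness realises a chord of length \<open>m + 1\<close> by a path in
  \<open>K\<close>, on which chords of length one and \<open>m\<close> are excluded by hypothesis
  and induction.\<close>

lemma path_connected_no_chord:
  fixes K :: "complex set"
  assumes "path_connected K" and one: "\<And>x. x \<in> K \<Longrightarrow> x + 1 \<notin> K"
    and "x \<in> K" "n \<ge> 1"
  shows "x + of_nat n \<notin> K"
proof -
  have "\<forall>x\<in>K. x + of_nat n \<notin> K"
    using \<open>n \<ge> 1\<close>
  proof (induction n rule: dec_induct)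
    case base
    then show ?case using one by simp
  next
    case (step m)
    show ?case
    proof (intro ballI notI)
      fix x assume x: "x \<in> K" "x + of_nat (Suc m) \<in> K"
      then obtain p where p: "path p" "path_image p \<subseteq> K" "pathstart p = x" "pathfinish p = x + of_nat (Suc m)"
        using assms(1) unfolding path_connected_def by blast
      show False
      proof (rule no_chord_path_step[of p m])
        show "p 1 = p 0 + of_nat (Suc m)" using p by (simp add: pathstart_def pathfinish_def)
        show "y \<noteq> x + 1" if "x \<in> path_image p" "y \<in> path_image p" for x y
          using that p(2) one by blast
        show "y \<noteq> x + of_nat m" if "x \<in> path_image p" "y \<in> path_image p" for x y
          using that p(2) step.IH by blast
      qed (use p step.hyps in auto)
    qed
  qed
  with assms(3) show ?thesis by blast
qed

corollary path_connected_no_chord_int: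
  fixes K :: "complex set"
  assumes "path_connected K" and one: "\<And>x. x \<in> K \<Longrightarrow> x + 1 \<notin> K"
    and "x \<in> K" "x + of_int k \<in> K"
  shows "k = 0"
proof (rule ccontr)
  assume "k \<noteq> 0"
  show False
  proof (cases "k > 0")
    case True
    then have "nat k \<ge> 1" "of_nat (nat k) = (of_int k :: complex)" by simp_all
    then show False using path_connected_no_chord[OF assms(1,2,3), of "nat k"] assms(4) by simp
  next
    case False
    then have "nat (-k) \<ge> 1" "x + of_int k + of_nat (nat (-k)) = x" using \<open>k \<noteq> 0\<close> by simp_all
    then show False using path_connected_no_chord[OF assms(1,2,4), of "nat (-k)"] assms(3) by simp
  qed
qed

text \<open>Read along \<open>c\<close>, the indices of the translates of the curve that are met change by at most one
  between consecutive hits, since a jump by two or more would give a path-connected set with an integral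
  chord but without a chord of length one.\<close>

lemma gap_no_chord:
  fixes a c :: "real \<Rightarrow> complex"
  assumes ca: "continuous_on {0<..<1} a"
    and a1: "\<And>u v. u \<in> {0<..<1} \<Longrightarrow> v \<in> {0<..<1} \<Longrightarrow> a v \<noteq> a u + 1"
    and pc: "path c" and c0: "c 0 \<in> a ` {0<..<1}" and c1: "c 1 - 1 \<in> a ` {0<..<1}"
    and cin: "\<And>s u. s \<in> {0<..<1} \<Longrightarrow> u \<in> {0<..<1} \<Longrightarrow> c s \<noteq> a u \<and> c s \<noteq> a u + 1"
    and cc: "\<And>s s'. s \<in> {0..1} \<Longrightarrow> s' \<in> {0..1} \<Longrightarrow> c s' \<noteq> c s + 1"
    and s: "s \<in> {0..1}" and w: "w \<in> {0<..<1}" and k: "c s = a w + of_int k"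
  shows "k = 0 \<or> k = 1"
proof (rule ccontr)
  assume k01: "\<not> (k = 0 \<or> k = 1)"
  have pcA: "path_connected (a ` {0<..<1})"
    using ca by (intro path_connected_continuous_image convex_imp_path_connected) auto
  \<comment> \<open>The curve is path connected and has no unit chord, so its integer translates are
    pairwise disjoint and a hit has a unique index.\<close>
  have disjA: "k' = k''" if "u \<in> {0<..<1}" "v \<in> {0<..<1}" "a u + of_int k' = a v + of_int k''" for u v k' k''
  proof -
    have "a u + of_int (k' - k'') \<in> a ` {0<..<1}" using that by (simp add: algebra_simps)
    then have "k' - k'' = 0"
      by (intro path_connected_no_chord_int[OF pcA, of "a u"]) (use a1 that in force)+
    then show ?thesis by simp
  qed
  obtain w0 where w0: "w0 \<in> {0<..<1}" "c 0 = a w0" using c0 by auto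
  obtain w1 where w1: "w1 \<in> {0<..<1}" "c 1 = a w1 + 1" using c1 by (auto simp: algebra_simps)
  \<comment> \<open>The curve is cut down to a compact piece containing the three parameters
    involved. This makes the hit sets below closed, and only finitely many of them nonempty.\<close>
  define lo where "lo = min w (min w0 w1)"
  define hi where "hi = max w (max w0 w1)"
  have lohi: "{lo..hi} \<subseteq> {0<..<1}" "w \<in> {lo..hi}" "w0 \<in> {lo..hi}" "w1 \<in> {lo..hi}"
    using w w0 w1 by (auto simp: lo_def hi_def)
  define A where "A = a ` {lo..hi}"
  have cmpA: "compact A" unfolding A_def
    using continuous_on_subset[OF ca lohi(1)] by (intro compact_continuous_image) auto
  have pA: "path_connected A" unfolding A_def
    using continuous_on_subset[OF ca lohi(1)] by (intro path_connected_continuous_image convex_imp_path_connected) auto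
  have disjA': "k' = k''" if "x \<in> A" "y \<in> A" "x + of_int k' = y + of_int k''" for x y k' k''
    using that disjA lohi(1) unfolding A_def by blast
  have A1: "x + 1 \<notin> A" if "x \<in> A" for x
    using disjA'[of "x+1" x 0 1] that by auto
  have ccont: "continuous_on {0..1} c" using pc by (simp add: path_def)
  obtain R where R: "R > 0" "\<And>s. s \<in> {0..1} \<Longrightarrow> norm (c s) \<le> R" "\<And>x. x \<in> A \<Longrightarrow> norm x \<le> R"
  proof -
    have "bounded (c ` {0..1} \<union> A)"
      using compact_continuous_image[OF ccont] cmpA by (simp add: compact_imp_bounded)
    then obtain R where "R > 0" "\<forall>x \<in> c ` {0..1} \<union> A. norm x \<le> R" unfolding bounded_pos by blast
    then show ?thesis using that by blast
  qed
  define N where "N = \<lceil>2 * R\<rceil>"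
  have bnd: "\<bar>j\<bar> \<le> N" if "t \<in> {0..1}" "x \<in> A" "c t = x + of_int j" for t x j
  proof -
    have "of_int j = c t - x" using that(3) by simp
    then have "norm (of_int j :: complex) \<le> 2 * R"
      using R(2)[OF that(1)] R(3)[OF that(2)] norm_triangle_ineq4[of "c t" x] by simp
    then have "real_of_int \<bar>j\<bar> \<le> 2 * R" by simp
    then show ?thesis unfolding N_def by linarith
  qed
  define hit where "hit = (\<lambda>j. {t \<in> {0..1}. c t \<in> (\<lambda>x. x + of_int j) ` A})"
  have clhit: "closed (hit j)" for j :: int
  proof -
    have "closed ((\<lambda>x. x + complex_of_int j) ` A)"
      using compact_translation[OF cmpA, of "of_int j"] by (simp add: compact_imp_closed add.commute)
    then have "closed ({0..1} \<inter> c -` ((\<lambda>x. x + complex_of_int j) ` A))"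
      by (intro continuous_closed_preimage[OF ccont]) auto
    moreover have "hit j = {0..1} \<inter> c -` ((\<lambda>x. x + complex_of_int j) ` A)" by (auto simp: hit_def)
    ultimately show ?thesis by simp
  qed
  have hitfin: "hit j = {}" if "\<bar>j\<bar> > N" for j using bnd that by (force simp: hit_def)
  have uniq: "j = j'" if "t \<in> hit j" "t \<in> hit j'" for t j j'
    using that disjA' by (auto simp: hit_def)
  \<comment> \<open>Indices up to 0 and indices from 1 on: time 0 has index 0, time 1 has index 1,
    and no interior time has either of these two indices.\<close>
  define P where "P = (\<Union>j\<in>{-N..0}. hit j)"
  define Q where "Q = (\<Union>j\<in>{1..N}. hit j)"
  have clP: "closed P" and clQ: "closed Q" unfolding P_def Q_def using clhit by (auto intro!: closed_UN)
  have PQ: "t \<in> hit j \<Longrightarrow> j \<le> 0 \<Longrightarrow> t \<in> P" "t \<in> hit j \<Longrightarrow> j \<ge> 1 \<Longrightarrow> t \<in> Q" for t j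
  proof -
    assume t: "t \<in> hit j"
    then have "\<bar>j\<bar> \<le> N" using hitfin by (metis empty_iff not_le)
    then show "j \<le> 0 \<Longrightarrow> t \<in> P" "j \<ge> 1 \<Longrightarrow> t \<in> Q" using t by (auto simp: P_def Q_def)
  qed
  have PQ0: "P \<subseteq> {0..1}" "Q \<subseteq> {0..1}" by (auto simp: P_def Q_def hit_def)
  have h0: "0 \<in> hit 0" using w0 lohi by (auto simp: hit_def A_def)
  have h1: "1 \<in> hit 1" using w1 lohi by (auto simp: hit_def A_def)
  have hs: "s \<in> hit k" using s k lohi by (auto simp: hit_def A_def)
  have only0: "t = 0 \<or> t = 1" if "t \<in> hit 0 \<or> t \<in> hit 1" for t
  proof (rule ccontr)
    assume "\<not> (t = 0 \<or> t = 1)"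
    moreover have "t \<in> {0..1}" using that by (auto simp: hit_def)
    ultimately have "t \<in> {0<..<1}" by auto
    then show False using that cin[of t] lohi(1) unfolding hit_def A_def by fastforce
  qed
  have PQdisj: "P \<inter> Q = {}"
  proof (rule ccontr)
    assume "P \<inter> Q \<noteq> {}"
    then obtain t j j' where "t \<in> hit j" "t \<in> hit j'" "j \<le> 0" "1 \<le> j'" by (auto simp: P_def Q_def)
    then show False using uniq[of t j j'] by simp
  qed
  \<comment> \<open>For negative \<open>k\<close>, let \<open>t1\<close> be the last time of index
    at most 0 and \<open>t2\<close> the next time of positive index. As \<open>t1\<close> is
    interior, its index is at most -1, so the jump is at least two. The case
    \<open>k \<ge> 2\<close> is symmetric and starts from the first time of positive index.\<close>
  have "\<exists>t1 t2 i j. t1 \<in> hit i \<and> t2 \<in> hit j \<and> i \<le> 0 \<and> 1 \<le> j \<and> 2 \<le> j - i \<and> t1 \<le> t2 \<and>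
     (\<forall>t l. t1 < t \<and> t < t2 \<longrightarrow> t \<notin> hit l)"
  proof (cases "k \<le> 0")
    case True
    then have "k \<le> -1" using k01 by simp
    have "P \<noteq> {}" "s \<in> P" using PQ(1)[OF hs True] by auto
    have cpP: "compact P" using clP PQ0 by (meson bounded_closed_interval bounded_subset compact_eq_bounded_closed)
    obtain t1 where t1: "t1 \<in> P" "\<And>t. t \<in> P \<Longrightarrow> t \<le> t1"
      using compact_attains_sup[OF cpP \<open>P \<noteq> {}\<close>] by blast
    have "1 \<in> Q \<inter> {t1..1}" using PQ(2)[OF h1] t1(1) PQ0 by auto
    moreover have "compact (Q \<inter> {t1..1})" using clQ by (simp add: closed_Int_compact)
    ultimately obtain t2 where "t2 \<in> Q \<inter> {t1..1}" "\<forall>t\<in>Q \<inter> {t1..1}. t2 \<le> t"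
      using compact_attains_inf[of "Q \<inter> {t1..1}"] by (metis empty_iff)
    then have t2: "t2 \<in> Q" "t1 \<le> t2" "t2 \<le> 1" "\<And>t. t \<in> Q \<Longrightarrow> t1 \<le> t \<Longrightarrow> t \<le> 1 \<Longrightarrow> t2 \<le> t"
      by auto
    obtain i where i: "i \<le> 0" "t1 \<in> hit i" using t1(1) by (auto simp: P_def)
    obtain j where j: "1 \<le> j" "t2 \<in> hit j" using t2(1) by (auto simp: Q_def)
    have "s \<noteq> 0" using uniq[of s k 0] hs h0 \<open>k \<le> -1\<close> by auto
    then have "0 < t1" using t1(2)[OF \<open>s \<in> P\<close>] s by auto
    have "t1 \<noteq> 1" using uniq[of t1 i 1] i h1 by auto
    then have "i \<noteq> 0" using only0[of t1] i \<open>0 < t1\<close> by auto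
    then have "2 \<le> j - i" using i j by linarith
    moreover have "t \<notin> hit l" if "t1 < t" "t < t2" for t l
    proof
      assume t: "t \<in> hit l"
      show False
      proof (cases "l \<le> 0")
        case True then show False using t1(2)[OF PQ(1)[OF t]] that by simp
      next
        case False then show False using t2(4)[OF PQ(2)[OF t]] that t2(3) by simp
      qed
    qed
    ultimately show ?thesis using i j t2(2) by blast
  next
    case False
    then have "k \<ge> 2" using k01 by simp
    have "Q \<noteq> {}" "s \<in> Q" using PQ(2)[OF hs] False by auto
    have cpQ: "compact Q" using clQ PQ0 by (meson bounded_closed_interval bounded_subset compact_eq_bounded_closed)
    obtain t2 where t2: "t2 \<in> Q" "\<And>t. t \<in> Q \<Longrightarrow> t2 \<le> t"
      using compact_attains_inf[OF cpQ \<open>Q \<noteq> {}\<close>] by blast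
    have "0 \<in> P \<inter> {0..t2}" using PQ(1)[OF h0] t2(1) PQ0 by auto
    moreover have "compact (P \<inter> {0..t2})" using clP by (simp add: closed_Int_compact)
    ultimately obtain t1 where "t1 \<in> P \<inter> {0..t2}" "\<forall>t\<in>P \<inter> {0..t2}. t \<le> t1"
      using compact_attains_sup[of "P \<inter> {0..t2}"] by (metis empty_iff)
    then have t1: "t1 \<in> P" "t1 \<le> t2" "0 \<le> t1" "\<And>t. t \<in> P \<Longrightarrow> t \<le> t2 \<Longrightarrow> 0 \<le> t \<Longrightarrow> t \<le> t1"
      by auto
    obtain i where i: "i \<le> 0" "t1 \<in> hit i" using t1(1) by (auto simp: P_def)
    obtain j where j: "1 \<le> j" "t2 \<in> hit j" using t2(1) by (auto simp: Q_def)
    have "s \<noteq> 1" using uniq[of s k 1] hs h1 \<open>k \<ge> 2\<close> by auto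
    then have "t2 < 1" using t2(2)[OF \<open>s \<in> Q\<close>] s by auto
    have "t2 \<noteq> 0" using uniq[of t2 j 0] j h0 by auto
    then have "j \<noteq> 1" using only0[of t2] j \<open>t2 < 1\<close> by auto
    then have "2 \<le> j - i" using i j by linarith
    moreover have "t \<notin> hit l" if "t1 < t" "t < t2" for t l
    proof
      assume t: "t \<in> hit l"
      show False
      proof (cases "l \<le> 0")
        case True then show False using t1(4)[OF PQ(1)[OF t]] that t1(3) by simp
      next
        case False then show False using t2(2)[OF PQ(2)[OF t]] that by simp
      qed
    qed
    ultimately show ?thesis using i j t1(2) by blast
  qed
  then obtain t1 t2 i j where t: "t1 \<in> hit i" "t2 \<in> hit j" "i \<le> 0" "1 \<le> j" "2 \<le> j - i" "t1 \<le> t2"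
     and nohit: "\<And>t l. t1 < t \<Longrightarrow> t < t2 \<Longrightarrow> t \<notin> hit l"
    by blast
  have t01: "{t1..t2} \<subseteq> {0..1}" using t(1,2) by (auto simp: hit_def)
  have hitI: "t1 \<le> u \<Longrightarrow> u \<le> t2 \<Longrightarrow> u \<in> hit l \<Longrightarrow> l = i \<or> l = j" for u l
  proof -
    assume u: "t1 \<le> u" "u \<le> t2" "u \<in> hit l"
    then consider "u = t1" | "u = t2" | "t1 < u" "u < t2" by linarith
    then show "l = i \<or> l = j"
    proof cases
      case 1 then show ?thesis using uniq[OF u(3), of i] t(1) by simp
    next
      case 2 then show ?thesis using uniq[OF u(3), of j] t(2) by simp
    next
      case 3 then show ?thesis using nohit u(3) by blast
    qed
  qed
  \<comment> \<open>Translate \<open>i\<close> of the curve together with the arc of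
    \<open>c\<close> between the two hits. A unit chord between these two parts would be a hit of
    index \<open>i + 1\<close> or \<open>i - 1\<close>, but only \<open>i\<close> and
    \<open>j\<close> occur. The chord \<open>j - i\<close>, however, is present.\<close>
  define K where "K = (\<lambda>x. x + of_int i) ` A \<union> c ` {t1..t2}"
  have "path_connected K" unfolding K_def
  proof (rule path_connected_Un)
    show "path_connected ((\<lambda>x. x + of_int i) ` A)"
      using pA by (intro path_connected_continuous_image continuous_intros)
    show "path_connected (c ` {t1..t2})"
      using continuous_on_subset[OF ccont t01]
      by (intro path_connected_continuous_image convex_imp_path_connected) auto
    show "(\<lambda>x. x + of_int i) ` A \<inter> c ` {t1..t2} \<noteq> {}"
    proof -
      have "c t1 \<in> (\<lambda>x. x + of_int i) ` A" using t(1) by (simp add: hit_def)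
      moreover have "c t1 \<in> c ` {t1..t2}" using t(6) by simp
      ultimately show ?thesis by blast
    qed
  qed
  moreover have "z + 1 \<notin> K" if zK: "z \<in> K" for z
  proof
    assume z1: "z + 1 \<in> K"
    have noi: "i + 1 \<noteq> i" "i + 1 \<noteq> j" "i - 1 \<noteq> i" "i - 1 \<noteq> j" using t by auto
    consider "z \<in> (\<lambda>x. x + of_int i) ` A" "z + 1 \<in> (\<lambda>x. x + of_int i) ` A"
      | "z \<in> (\<lambda>x. x + of_int i) ` A" "z + 1 \<in> c ` {t1..t2}"
      | "z \<in> c ` {t1..t2}" "z + 1 \<in> (\<lambda>x. x + of_int i) ` A"
      | "z \<in> c ` {t1..t2}" "z + 1 \<in> c ` {t1..t2}"
      using zK z1 unfolding K_def by blast
    then show False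
    proof cases
      case 1
      then obtain x y where "x \<in> A" "y \<in> A" "z = x + of_int i" "z + 1 = y + of_int i" by blast
      then show False using A1[of x] by (simp add: algebra_simps)
    next
      case 2
      then obtain x u where x: "x \<in> A" "z = x + of_int i" and u: "u \<in> {t1..t2}" "z + 1 = c u" by blast
      have "c u = x + of_int (i + 1)" using x(2) u(2)[symmetric] by (simp add: add.assoc)
      then have "u \<in> hit (i + 1)" unfolding hit_def using x u t01 by blast
      then show False using hitI[of u "i+1"] u noi by auto
    next
      case 3
      then obtain x u where x: "x \<in> A" "z + 1 = x + of_int i" and u: "u \<in> {t1..t2}" "z = c u" by blast
      have "c u = x + of_int (i - 1)" using x(2) u(2) by (simp add: algebra_simps)
      then have "u \<in> hit (i - 1)" unfolding hit_def using x u t01 by blast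
      then show False using hitI[of u "i-1"] u noi by auto
    next
      case 4
      then obtain u v where "u \<in> {t1..t2}" "v \<in> {t1..t2}" "c v = c u + 1" by auto
      then show False using cc[of u v] t01 by blast
    qed
  qed
  moreover obtain y where y: "y \<in> A" "c t2 = y + of_int j" using t(2) by (auto simp: hit_def)
  moreover have "y + of_int i \<in> K" using y(1) by (auto simp: K_def)
  moreover have "(y + of_int i) + of_int (j - i) \<in> K"
  proof -
    have "c t2 \<in> c ` {t1..t2}" using t(6) by simp
    then show ?thesis using y(2) by (simp add: K_def)
  qed
  ultimately have "j - i = 0" using path_connected_no_chord_int by blast
  then show False using t(5) by simp
qed

section \<open>The length-area principle\<close>

text \<open>Iterated integrals are formed over \<open>real \<times> real\<close>, Jacobian
  determinants over \<open>real ^ 2\<close>; this map and \<open>vcomplex\<close> below pass between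
  these and the complex plane.\<close>

definition vec2 :: "real \<times> real \<Rightarrow> real ^ 2" where
  "vec2 z = (\<chi> i. if i = 1 then fst z else snd z)"

lemma vec2_nth [simp]: "vec2 z $ 1 = fst z" "vec2 z $ 2 = snd z"
  by (auto simp: vec2_def)

lemma vec2_measurable: "vec2 \<in> borel_measurable borel"
proof -
  have "continuous_on UNIV vec2"
    unfolding vec2_def
  proof (rule continuous_on_vec_lambda)
    show "continuous_on UNIV (\<lambda>z. if i = 1 then fst z else snd z :: real)" for i :: 2
      by (cases "i = 1") (auto intro!: continuous_on_fst continuous_on_snd continuous_on_id)
  qed
  then show ?thesis by (rule borel_measurable_continuous_onI)
qed

lemma Basis_real_2: "(Basis :: (real^2) set) = {axis 1 1, axis 2 1}"
  by (auto simp: Basis_vec_def UNIV_2)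

lemma lborel_vec2: "(lborel :: (real^2) measure) = distr lborel borel vec2"
proof (rule lborel_eqI)
  fix l u :: "real^2" assume le: "\<And>b. b \<in> Basis \<Longrightarrow> l \<bullet> b \<le> u \<bullet> b"
  have ne: "axis 1 (1::real) \<noteq> (axis 2 1 :: real^2)"
    by (simp add: axis_eq_axis)
  have le': "l $ 1 \<le> u $ 1" "l $ 2 \<le> u $ 2"
    using le[of "axis 1 1"] le[of "axis 2 1"] by (auto simp: Basis_real_2 inner_axis)
  have "vec2 -` box l u \<inter> space lborel = box (l $ 1, l $ 2) (u $ 1, u $ 2)"
    by (auto simp: box_def Basis_real_2 inner_axis Basis_prod_def)
  then have "emeasure (distr lborel borel vec2) (box l u) = emeasure lborel (box (l $ 1, l $ 2) (u $ 1, u $ 2))"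
    by (subst emeasure_distr) (use vec2_measurable in auto)
  also have "\<dots> = ennreal (\<Prod>b\<in>Basis. ((u $ 1, u $ 2) - (l $ 1, l $ 2)) \<bullet> b)"
    by (rule emeasure_lborel_box) (use le' in \<open>auto simp: Basis_prod_def\<close>)
  also have "(\<Prod>b\<in>Basis. ((u $ 1, u $ 2) - (l $ 1, l $ 2)) \<bullet> b) = (u $ 1 - l $ 1) * (u $ 2 - l $ 2)"
  proof -
    have B: "(Basis :: (real \<times> real) set) = {(1,0), (0,1)}" by (auto simp: Basis_prod_def)
    show ?thesis unfolding B by (subst prod.insert) auto
  qed
  also have "\<dots> = (\<Prod>b\<in>Basis. (u - l) \<bullet> b)"
    using ne by (simp add: Basis_real_2 inner_axis)
  finally show "emeasure (distr lborel borel vec2) (box l u) = ennreal (\<Prod>b\<in>Basis. (u - l) \<bullet> b)" .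
qed simp

definition vcomplex :: "real ^ 2 \<Rightarrow> complex" where "vcomplex v = Complex (v $ 1) (v $ 2)"
definition complexv :: "complex \<Rightarrow> real ^ 2" where "complexv z = vec2 (Re z, Im z)"

lemma vcomplex_complexv [simp]: "vcomplex (complexv z) = z" "complexv (vcomplex v) = v"
  by (auto simp: vcomplex_def complexv_def vec_eq_iff forall_2)

lemma bounded_linear_vcomplex: "bounded_linear vcomplex"
proof -
  have "linear vcomplex" by (rule linearI) (auto simp: vcomplex_def complex_eq_iff)
  then show ?thesis by (rule linear_conv_bounded_linear[THEN iffD1])
qed

lemma open_vimage_vcomplex: "open T \<Longrightarrow> open (vcomplex -` T)"
  by (intro open_vimage linear_continuous_on bounded_linear_vcomplex)

lemma bounded_linear_complexv: "bounded_linear complexv"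
proof -
  have "linear complexv" by (rule linearI) (auto simp: complexv_def vec_eq_iff forall_2)
  then show ?thesis by (rule linear_conv_bounded_linear[THEN iffD1])
qed

lemma complexv_image: "complexv ` T = vcomplex -` T"
proof (intro set_eqI iffI)
  fix x assume "x \<in> vcomplex -` T"
  then have "complexv (vcomplex x) \<in> complexv ` T" by (intro imageI) simp
  then show "x \<in> complexv ` T" by simp
qed auto

lemma vcomplex_image_vimage: "vcomplex ` (vcomplex -` T) = T"
proof (intro set_eqI iffI)
  fix x assume "x \<in> T"
  then have "vcomplex (complexv x) \<in> vcomplex ` (vcomplex -` T)" by (intro imageI) simp
  then show "x \<in> vcomplex ` (vcomplex -` T)" by simp
qed auto

lemma nn_integral_vcomplex:
  assumes "f \<in> borel_measurable borel"
  shows "(\<integral>\<^sup>+ v. f (vcomplex v) \<partial>lborel) = (\<integral>\<^sup>+ x. \<integral>\<^sup>+ y. f (Complex x y) \<partial>lborel \<partial>lborel)"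
proof -
  have m: "vcomplex \<in> borel_measurable borel"
    by (intro borel_measurable_continuous_onI linear_continuous_on bounded_linear_vcomplex)
  have m2: "(\<lambda>z. Complex (fst z) (snd z)) \<in> borel_measurable (borel :: (real \<times> real) measure)"
    by (intro borel_measurable_continuous_onI) (auto simp: Complex_eq intro!: continuous_intros)
  have "(\<integral>\<^sup>+ v. f (vcomplex v) \<partial>lborel) = (\<integral>\<^sup>+ v. f (vcomplex v) \<partial>distr lborel borel vec2)"
    by (subst lborel_vec2) simp
  also have "\<dots> = (\<integral>\<^sup>+ z. f (vcomplex (vec2 z)) \<partial>lborel)"
    by (rule nn_integral_distr) (use vec2_measurable m assms in auto)
  also have "\<dots> = (\<integral>\<^sup>+ z. f (Complex (fst z) (snd z)) \<partial>(lborel \<Otimes>\<^sub>M lborel))"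
    by (simp add: vcomplex_def lborel_prod)
  also have "\<dots> = (\<integral>\<^sup>+ x. \<integral>\<^sup>+ y. f (Complex x y) \<partial>lborel \<partial>lborel)"
    by (subst lborel.nn_integral_fst[symmetric]) (use measurable_compose[OF m2 assms] in \<open>auto simp: lborel_prod\<close>)
  finally show ?thesis .
qed

lemma measurable_energy:
  assumes "open W" "G holomorphic_on W"
  shows "(\<lambda>z. ennreal ((norm (deriv G z))\<^sup>2) * indicator W z) \<in> borel_measurable borel"
proof -
  have "continuous_on W (\<lambda>z. (norm (deriv G z))\<^sup>2)"
    using holomorphic_on_imp_continuous_on[OF holomorphic_deriv[OF assms(2,1)]] by (intro continuous_intros)
  then have "(\<lambda>z. indicator W z *\<^sub>R (norm (deriv G z))\<^sup>2) \<in> borel_measurable borel"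
    by (intro borel_measurable_continuous_on_indicator) (use assms(1) in auto)
  then have "(\<lambda>z. ennreal (indicator W z *\<^sub>R (norm (deriv G z))\<^sup>2)) \<in> borel_measurable borel" by measurable
  moreover have "(\<lambda>z. ennreal (indicator W z *\<^sub>R (norm (deriv G z))\<^sup>2)) = (\<lambda>z. ennreal ((norm (deriv G z))\<^sup>2) * indicator W z)"
    by (auto simp: fun_eq_iff indicator_def)
  ultimately show ?thesis by (simp only:)
qed

text \<open>The integrand is the Jacobian determinant of \<open>G\<close>, so for injective
  \<open>G\<close> the integral is the area of the image, which lies in the disc.\<close>

lemma holomorphic_image_area:
  assumes "open W" "G holomorphic_on W" "inj_on G W" "G ` W \<subseteq> ball 0 R"
  shows "(\<integral>\<^sup>+ x. \<integral>\<^sup>+ y. ennreal ((norm (deriv G (Complex x y)))\<^sup>2) * indicator W (Complex x y) \<partial>lborel \<partial>lborel)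
     \<le> ennreal (measure lebesgue (complexv ` ball 0 R))"
proof -
  define S where "S = vcomplex -` W"
  define f where "f = complexv \<circ> G \<circ> vcomplex"
  define f' where "f' = (\<lambda>v w. complexv (deriv G (vcomplex v) * vcomplex w))"
  have opS: "open S" unfolding S_def
    by (rule open_vimage_vcomplex[OF assms(1)])
  have der: "(f has_derivative f' v) (at v within S)" if "v \<in> S" for v
  proof -
    have "(G has_field_derivative deriv G (vcomplex v)) (at (vcomplex v))"
      using that by (intro holomorphic_derivI[OF assms(2,1)]) (simp add: S_def)
    then have "(G has_derivative (\<lambda>h. deriv G (vcomplex v) * h)) (at (vcomplex v))"
      by (simp add: has_field_derivative_def)
    from has_derivative_compose[OF bounded_linear_imp_has_derivative[OF bounded_linear_vcomplex] this]
    have "((\<lambda>v. G (vcomplex v)) has_derivative (\<lambda>h. deriv G (vcomplex v) * vcomplex h)) (at v within S)"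
      by simp
    from bounded_linear.has_derivative[OF bounded_linear_complexv this]
    show ?thesis by (simp add: f_def f'_def o_def)
  qed
  have inj: "inj_on f S"
  proof (rule inj_onI)
    fix x y assume xy: "x \<in> S" "y \<in> S" "f x = f y"
    then have "G (vcomplex x) = G (vcomplex y)"
      unfolding f_def o_apply using vcomplex_complexv(1) by metis
    then have "vcomplex x = vcomplex y"
      using xy assms(3) by (auto simp: S_def dest: inj_onD)
    then show "x = y" using vcomplex_complexv(2) by metis
  qed
  \<comment> \<open>Multiplication by \<open>d\<close> has the real matrix with columns
    \<open>d\<close> and \<open>\<i> * d\<close>.\<close>
  have det: "\<bar>det (matrix (f' v))\<bar> = (norm (deriv G (vcomplex v)))\<^sup>2" for v
  proof -
    define d where "d = deriv G (vcomplex v)"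
    have a: "vcomplex (axis 1 1) = 1" "vcomplex (axis 2 1) = \<i>"
      by (auto simp: vcomplex_def axis_def complex_eq_iff)
    have "det (matrix (f' v)) = Re d * Re d + Im d * Im d"
      unfolding det_2 matrix_def f'_def a d_def[symmetric] by (simp add: complexv_def a)
    then have "det (matrix (f' v)) = (norm d)\<^sup>2" unfolding cmod_power2 by (simp add: power2_eq_square)
    then show ?thesis by (simp add: d_def)
  qed
  have "f ` S = vcomplex -` (G ` W)"
    unfolding f_def S_def by (simp only: image_comp[symmetric] vcomplex_image_vimage complexv_image)
  moreover have "open (G ` W)" using open_mapping_thm3[OF assms(2,1,3)] .
  ultimately have opf: "open (f ` S)"
    by (simp add: open_vimage_vcomplex)
  have opB: "open (complexv ` ball 0 R)" "bounded (complexv ` ball 0 R)"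
  proof -
    have "complexv ` ball 0 R = vcomplex -` ball 0 R"
      by (rule complexv_image)
    then show "open (complexv ` ball 0 R)"
      by (simp add: open_vimage_vcomplex)
    show "bounded (complexv ` ball 0 R)"
      by (intro bounded_linear_image bounded_linear_complexv bounded_ball)
  qed
  have sub: "f ` S \<subseteq> complexv ` ball 0 R"
    using assms(4) by (auto simp: f_def S_def)
  have mB: "complexv ` ball 0 R \<in> lmeasurable" using opB by (intro lmeasurable_open)
  have mf: "f ` S \<in> lmeasurable" using opf sub opB by (intro lmeasurable_open) (auto intro: bounded_subset)
  have hi: "((\<lambda>v. (norm (deriv G (vcomplex v)))\<^sup>2) has_integral measure lebesgue (f ` S)) S"
    using has_measure_differentiable_image[of S f f' "measure lebesgue (f ` S)"] opS der inj mf
    by (simp add: det lebesgue_openin)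
  have "(\<integral>\<^sup>+ x. \<integral>\<^sup>+ y. ennreal ((norm (deriv G (Complex x y)))\<^sup>2) * indicator W (Complex x y) \<partial>lborel \<partial>lborel)
     = (\<integral>\<^sup>+ v. ennreal ((norm (deriv G (vcomplex v)))\<^sup>2) * indicator W (vcomplex v) \<partial>lborel)"
    using nn_integral_vcomplex[OF measurable_energy[OF assms(1,2)]] by simp
  also have "\<dots> = (\<integral>\<^sup>+ v. ennreal ((norm (deriv G (vcomplex v)))\<^sup>2) * indicator S v \<partial>lborel)"
    by (intro nn_integral_cong) (auto simp: S_def indicator_def)
  also have "\<dots> = ennreal (measure lebesgue (f ` S))"
    by (rule nn_integral_has_integral_lebesgue'[OF _ hi]) simp
  also have "\<dots> \<le> ennreal (measure lebesgue (complexv ` ball 0 R))"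
    by (intro ennreal_leI measure_mono_fmeasurable sub) (use mf mB in auto)
  finally show ?thesis .
qed

text \<open>The increment of \<open>G\<close> is at most the integral of
  \<open>norm (deriv G)\<close> over a segment of length at most \<open>2 * pi\<close>. This is the
  resulting Cauchy-Schwarz bound, obtained from a weighted inequality between arithmetic and
  geometric mean.\<close>

lemma energy_lower_bound:
  fixes G :: "complex \<Rightarrow> complex"
  assumes "a \<le> b" "b - a \<le> 2 * pi" "0 < \<epsilon>" "open W" "G holomorphic_on W"
    and W: "\<And>t. t \<in> {a..b} \<Longrightarrow> Complex x t \<in> W"
    and big: "\<epsilon> \<le> norm (G (Complex x b) - G (Complex x a))"
  shows "ennreal (\<epsilon>\<^sup>2 / (2 * pi)) \<le>
     (\<integral>\<^sup>+ t. ennreal ((norm (deriv G (Complex x t)))\<^sup>2) * indicator {a..b} t \<partial>lborel)"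
proof -
  define g where "g = (\<lambda>t. deriv G (Complex x t))"
  have cC: "continuous_on {a..b} (\<lambda>t. Complex x t)"
    by (auto simp: Complex_eq intro!: continuous_intros)
  have cg: "continuous_on {a..b} g" unfolding g_def
    using holomorphic_on_imp_continuous_on[OF holomorphic_deriv[OF assms(5,4)]]
    by (rule continuous_on_compose2[OF _ cC]) (use W in auto)
  have vd: "((\<lambda>t. G (Complex x t)) has_vector_derivative \<i> * g t) (at t within {a..b})" if "t \<in> {a..b}" for t
  proof -
    have 1: "((\<lambda>t. Complex x t) has_vector_derivative \<i>) (at t within {a..b})"
      by (auto simp: Complex_eq has_vector_derivative_def intro!: derivative_eq_intros)
        (simp add: scaleR_conv_of_real mult.commute)
    have 2: "(G has_field_derivative g t) (at (Complex x t))"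
      unfolding g_def using W[OF that] by (intro holomorphic_derivI[OF assms(5,4)])
    from field_vector_diff_chain_within[OF 1 has_field_derivative_at_within[OF 2]]
    show ?thesis by (simp add: o_def mult.commute)
  qed
  have "((\<lambda>t. \<i> * g t) has_integral (G (Complex x b) - G (Complex x a))) {a..b}"
    by (rule fundamental_theorem_of_calculus[OF assms(1) vd])
  then have int: "integral {a..b} (\<lambda>t. \<i> * g t) = G (Complex x b) - G (Complex x a)"
    by (rule integral_unique)
  \<comment> \<open>The weight in
    \<open>2 * norm (g t) \<le> s * (norm (g t))\<^sup>2 + 1 / s\<close>, chosen so that the
    constant term contributes at most \<open>\<epsilon> / 2\<close> and can be absorbed.\<close>
  define s where "s = 2 * pi / \<epsilon>"
  have s: "s > 0" using assms(3) by (simp add: s_def)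
  have sq: "(\<lambda>t. (norm (g t))\<^sup>2) integrable_on {a..b}"
    by (intro integrable_continuous_interval continuous_intros cg)
  define I where "I = integral {a..b} (\<lambda>t. (norm (g t))\<^sup>2)"
  have hI: "((\<lambda>t. (norm (g t))\<^sup>2) has_integral I) {a..b}"
    unfolding I_def using sq by (rule integrable_integral)
  have "\<epsilon> \<le> integral {a..b} (\<lambda>t. (s * (norm (g t))\<^sup>2 + 1 / s) / 2)"
  proof -
    have "norm (integral {a..b} (\<lambda>t. \<i> * g t)) \<le> integral {a..b} (\<lambda>t. (s * (norm (g t))\<^sup>2 + 1 / s) / 2)"
    proof (rule integral_norm_bound_integral)
      show "(\<lambda>t. \<i> * g t) integrable_on {a..b}"
        by (intro integrable_continuous_interval continuous_intros cg)
      show "(\<lambda>t. (s * (norm (g t))\<^sup>2 + 1 / s) / 2) integrable_on {a..b}"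
        by (intro integrable_continuous_interval continuous_intros cg) (use s in auto)
      show "norm (\<i> * g t) \<le> (s * (norm (g t))\<^sup>2 + 1 / s) / 2" for t
      proof -
        have "0 \<le> (s * norm (g t) - 1)\<^sup>2" by simp
        then have "2 * (s * norm (g t)) \<le> s\<^sup>2 * (norm (g t))\<^sup>2 + 1"
          by (simp add: power2_diff power_mult_distrib)
        then have "2 * norm (g t) \<le> (s\<^sup>2 * (norm (g t))\<^sup>2 + 1) / s"
          using s by (simp add: field_simps)
        also have "\<dots> = s * (norm (g t))\<^sup>2 + 1 / s"
          using s by (simp add: field_simps power2_eq_square)
        finally show ?thesis by (simp add: norm_mult)
      qed
    qed
    then show ?thesis using big int by simp
  qed
  also have "\<dots> = (s * I + (b - a) * (1 / s)) / 2"
  proof (rule integral_unique)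
    have "((\<lambda>t. 1 / s) has_integral ((b - a) *\<^sub>R (1 / s))) {a..b}"
      using has_integral_const_real[of "1/s" a b] assms(1) by (simp add: content_real)
    then show "((\<lambda>t. (s * (norm (g t))\<^sup>2 + 1 / s) / 2) has_integral (s * I + (b - a) * (1 / s)) / 2) {a..b}"
      by (intro has_integral_divide has_integral_add has_integral_mult_right hI) simp
  qed
  also have "\<dots> \<le> (s * I + 2 * pi * (1 / s)) / 2"
    using assms(2) s by (intro divide_right_mono add_left_mono mult_right_mono) auto
  also have "\<dots> = pi / \<epsilon> * I + \<epsilon> / 2"
    using assms(3) by (simp add: s_def field_simps)
  finally have "\<epsilon> \<le> pi / \<epsilon> * I + \<epsilon> / 2" .
  then have "\<epsilon> / 2 \<le> pi / \<epsilon> * I" by linarith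
  then have "\<epsilon> * \<epsilon> \<le> 2 * pi * I" using assms(3) by (simp add: field_simps)
  then have "\<epsilon>\<^sup>2 / (2 * pi) \<le> I" by (simp add: field_simps power2_eq_square)
  then have "ennreal (\<epsilon>\<^sup>2 / (2 * pi)) \<le> ennreal I" by (rule ennreal_leI)
  also have "ennreal I = (\<integral>\<^sup>+ t. ennreal ((norm (g t))\<^sup>2) * indicator {a..b} t \<partial>lborel)"
    by (rule nn_integral_has_integral_lebesgue'[OF _ hI, symmetric]) simp
  finally show ?thesis by (simp add: g_def)
qed

section \<open>Arcs of circles in logarithmic coordinates\<close>

definition circ :: "complex \<Rightarrow> real \<Rightarrow> real \<Rightarrow> complex" where
  "circ Q r t = Q + of_real r * cis t"

lemma continuous_on_circ: "continuous_on A (circ Q r)"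
  unfolding circ_def cis_conv_exp by (intro continuous_intros)

lemma first_exit:
  fixes h :: "real \<Rightarrow> real"
  assumes "continuous_on {0..1} h" "h 0 < e" "e \<le> h 1"
  obtains s where "s \<in> {0..1}" "h s = e" "\<And>t. t \<in> {0..s} \<Longrightarrow> h t \<le> e"
proof -
  define S where "S = {0..1} \<inter> h -` {e..}"
  have "closed S" unfolding S_def by (intro continuous_closed_preimage assms(1)) auto
  then have "compact S" unfolding S_def by (metis bounded_closed_interval bounded_Int compact_eq_bounded_closed)
  moreover have "1 \<in> S" using assms(3) by (simp add: S_def)
  ultimately obtain s where s: "s \<in> S" "\<And>t. t \<in> S \<Longrightarrow> s \<le> t"
    using compact_attains_inf[of S] by (metis empty_iff)
  have below: "h t < e" if "t \<in> {0..1}" "t < s" for t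
    using s(2)[of t] that by (force simp: S_def)
  have s01: "s \<in> {0..1}" "e \<le> h s" using s(1) by (auto simp: S_def)
  have "h s \<le> e"
  proof (rule ccontr)
    assume "\<not> h s \<le> e"
    then have "\<exists>x\<ge>0. x \<le> s \<and> h x = e"
      using assms(1,2) s01 by (intro IVT') (auto intro: continuous_on_subset)
    then obtain x where "0 \<le> x" "x \<le> s" "h x = e" by blast
    then show False using below[of x] s01 \<open>\<not> h s \<le> e\<close> by (cases "x = s") auto
  qed
  show ?thesis
  proof (rule that)
    show "h t \<le> e" if "t \<in> {0..s}" for t
    proof (cases "t = s")
      case True then show ?thesis using \<open>h s \<le> e\<close> by simp
    next
      case False then show ?thesis using that below[of t] s01 by auto
    qed
  qed (use s01 \<open>h s \<le> e\<close> in auto)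
qed

text \<open>In logarithmic coordinates the circle of radius \<open>exp x\<close> is the vertical
  line over \<open>x\<close>. The arc is cut off where \<open>\<alpha>\<close> has first moved by
  \<open>\<epsilon>\<close>; up to there its values are bounded by \<open>M + \<epsilon>\<close>, so
  the shortened arc lies in \<open>W\<close> and still has the increment that the energy bound
  needs.\<close>

lemma circle_energy:
  assumes "open C" "\<alpha> holomorphic_on C" "0 < \<epsilon>"
    and len: "\<bar>\<theta> - \<theta>'\<bar> \<le> 2 * pi"
    and C: "\<And>t. t \<in> closed_segment \<theta> \<theta>' \<Longrightarrow> circ Q (exp x) t \<in> C"
    and M: "norm (\<alpha> (circ Q (exp x) \<theta>)) \<le> M"
    and big: "\<epsilon> \<le> norm (\<alpha> (circ Q (exp x) \<theta>) - \<alpha> (circ Q (exp x) \<theta>'))"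
    and G: "G = (\<lambda>z. \<alpha> (Q + exp z))"
    and W: "W = {z. Q + exp z \<in> C \<and> norm (G z) < M + 2 * \<epsilon>}"
    and k: "\<theta> \<in> {A..B}" "\<theta>' \<in> {A..B}"
  shows "ennreal (\<epsilon>\<^sup>2 / (2 * pi)) \<le>
     (\<integral>\<^sup>+ t. ennreal ((norm (deriv G (Complex x t)))\<^sup>2) * indicator W (Complex x t) * indicator {A..B} t \<partial>lborel)"
proof -
  have GC: "G (Complex x t) = \<alpha> (circ Q (exp x) t)" "Q + exp (Complex x t) = circ Q (exp x) t" for t
    by (auto simp: G circ_def exp_eq_polar exp_of_real)
  define l where "l = (\<lambda>s. \<theta> + s * (\<theta>' - \<theta>))"
  have lseg: "l s \<in> closed_segment \<theta> \<theta>'" if "s \<in> {0..1}" for s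
    using that unfolding l_def in_segment by (auto simp: algebra_simps intro!: exI[of _ s])
  define h where "h = (\<lambda>s. norm (\<alpha> (circ Q (exp x) \<theta>) - \<alpha> (circ Q (exp x) (l s))))"
  have "continuous_on {0..1} l" unfolding l_def by (intro continuous_intros)
  then have cl: "continuous_on {0..1} (\<lambda>s. circ Q (exp x) (l s))"
    by (rule continuous_on_compose2[OF continuous_on_circ]) auto
  have "continuous_on {0..1} (\<lambda>s. \<alpha> (circ Q (exp x) (l s)))"
    by (rule continuous_on_compose2[OF holomorphic_on_imp_continuous_on[OF assms(2)] cl])
       (use C lseg in blast)
  then have "continuous_on {0..1} h" unfolding h_def by (intro continuous_intros)
  then obtain s where s: "s \<in> {0..1}" "h s = \<epsilon>" "\<And>t. t \<in> {0..s} \<Longrightarrow> h t \<le> \<epsilon>"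
    by (rule first_exit[of h \<epsilon>]) (use assms(3) big in \<open>auto simp: h_def l_def\<close>)
  define a b where "a = min \<theta> (l s)" and "b = max \<theta> (l s)"
  have seg: "\<exists>u\<in>{0..s}. t = l u" if "t \<in> {a..b}" for t
  proof -
    have "t \<in> closed_segment \<theta> (l s)"
      using that by (auto simp: a_def b_def closed_segment_eq_real_ivl min_def max_def split: if_splits)
    then obtain v where v: "v \<in> {0..1}" "t = (1 - v) * \<theta> + v * l s" by (auto simp: in_segment)
    then have "t = l (v * s)" by (simp add: l_def algebra_simps)
    moreover have "v * s \<in> {0..s}" using v(1) s(1) by (auto intro: mult_left_le_one_le)
    ultimately show ?thesis by blast
  qed
  have inW: "Complex x t \<in> W" if tab: "t \<in> {a..b}" for t
  proof -
    obtain u where u: "u \<in> {0..s}" "t = l u" using seg[OF tab] by blast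
    then have "circ Q (exp x) t \<in> C" using C lseg s(1) by auto
    moreover have "norm (\<alpha> (circ Q (exp x) t)) < M + 2 * \<epsilon>"
      using s(3)[OF u(1)] M assms(3) norm_triangle_sub[of "\<alpha> (circ Q (exp x) t)" "\<alpha> (circ Q (exp x) \<theta>)"]
      unfolding h_def u(2) by (simp add: norm_minus_commute)
    ultimately show ?thesis by (simp add: W GC)
  qed
  have holG: "G holomorphic_on {z. Q + exp z \<in> C}" unfolding G
    by (rule holomorphic_on_compose_gen[of "\<lambda>z. Q + exp z" _ \<alpha> C, unfolded o_def])
       (auto intro!: holomorphic_intros assms(2))
  have opC: "open {z. Q + exp z \<in> C}"
  proof -
    have "open ((\<lambda>z. Q + exp z) -` C)"
      by (rule open_vimage[OF assms(1)]) (intro continuous_intros)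
    then show ?thesis by (simp add: vimage_def)
  qed
  have "ennreal (\<epsilon>\<^sup>2 / (2 * pi)) \<le>
     (\<integral>\<^sup>+ t. ennreal ((norm (deriv G (Complex x t)))\<^sup>2) * indicator {a..b} t \<partial>lborel)"
  proof (rule energy_lower_bound[OF _ _ assms(3) opC holG])
    show "a \<le> b" by (auto simp: a_def b_def)
    have "\<bar>l s - \<theta>\<bar> = s * \<bar>\<theta> - \<theta>'\<bar>" using s(1) by (simp add: l_def abs_mult abs_minus_commute)
    also have "\<dots> \<le> 1 * \<bar>\<theta> - \<theta>'\<bar>" using s(1) by (intro mult_right_mono) auto
    finally show "b - a \<le> 2 * pi" using len by (auto simp: a_def b_def min_def max_def)
    show "Complex x t \<in> {z. Q + exp z \<in> C}" if "t \<in> {a..b}" for t using inW[OF that] by (simp add: W)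
    show "\<epsilon> \<le> norm (G (Complex x b) - G (Complex x a))"
      using s(2) unfolding GC h_def a_def b_def by (auto simp: min_def max_def norm_minus_commute)
  qed
  also have "\<dots> \<le> (\<integral>\<^sup>+ t. ennreal ((norm (deriv G (Complex x t)))\<^sup>2) * indicator W (Complex x t) * indicator {A..B} t \<partial>lborel)"
  proof (rule nn_integral_mono)
    fix t
    have "l s \<in> {A..B}" using lseg[OF s(1)] k by (auto simp: closed_segment_eq_real_ivl split: if_splits)
    then have "{a..b} \<subseteq> {A..B}" using k by (auto simp: a_def b_def)
    then show "ennreal ((norm (deriv G (Complex x t)))\<^sup>2) * indicator {a..b} t
       \<le> ennreal ((norm (deriv G (Complex x t)))\<^sup>2) * indicator W (Complex x t) * indicator {A..B} t"
      using inW[of t] by (auto simp: indicator_def)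
  qed
  finally show ?thesis .
qed

lemma circ_periodic: "circ Q r (t + 2 * pi * of_int n) = circ Q r t"
  by (simp add: circ_def flip: cis_mult)

text \<open>Wolff's length-area argument in logarithmic coordinates around \<open>Q\<close>: the part of the image of a
  univalent function inside a disc has finite area, so the circles around \<open>Q\<close> cannot all have long images.\<close>

lemma length_area:
  assumes "open C" "\<alpha> holomorphic_on C" "inj_on \<alpha> C" "0 < \<epsilon>" "0 < r1" "countable Z"
  obtains r where "0 < r" "r < r1" "r \<notin> Z"
    "\<And>\<theta> \<theta>'. \<bar>\<theta> - \<theta>'\<bar> \<le> 2 * pi \<Longrightarrow> (\<And>t. t \<in> closed_segment \<theta> \<theta>' \<Longrightarrow> circ Q r t \<in> C) \<Longrightarrow>
       norm (\<alpha> (circ Q r \<theta>)) \<le> M \<Longrightarrow> norm (\<alpha> (circ Q r \<theta>) - \<alpha> (circ Q r \<theta>')) < \<epsilon>"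
proof (rule ccontr)
  \<comment> \<open>Otherwise every admissible radius carries a long image arc, and the energy
    accumulates over intervals of logarithms of radii of any length, against the area bound.\<close>
  assume neg: "\<not> thesis"
  note found = that
  have bad: "\<exists>\<theta> \<theta>'. \<bar>\<theta> - \<theta>'\<bar> \<le> 2 * pi \<and> (\<forall>t \<in> closed_segment \<theta> \<theta>'. circ Q r t \<in> C) \<and>
       norm (\<alpha> (circ Q r \<theta>)) \<le> M \<and> \<epsilon> \<le> norm (\<alpha> (circ Q r \<theta>) - \<alpha> (circ Q r \<theta>'))"
    if r: "0 < r" "r < r1" "r \<notin> Z" for r
    using neg found[OF r] by (meson not_le)
  define G where "G = (\<lambda>z. \<alpha> (Q + exp z))"
  define W where "W = {z. Q + exp z \<in> C \<and> norm (G z) < M + 2 * \<epsilon>}"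
  \<comment> \<open>Open horizontal strips of height \<open>2 * pi\<close>, on which
    \<open>exp\<close> and hence \<open>G\<close> is injective. The omitted boundary lines meet
    every vertical line in a null set.\<close>
  define Wk where "Wk = (\<lambda>k::int. W \<inter> {z. 2 * pi * of_int k < Im z} \<inter> {z. Im z < 2 * pi * of_int (k + 1)})"
  define e where "e = (\<lambda>x t. ennreal ((norm (deriv G (Complex x t)))\<^sup>2))"
  have holG: "G holomorphic_on {z. Q + exp z \<in> C}" unfolding G_def
    by (rule holomorphic_on_compose_gen[of "\<lambda>z. Q + exp z" _ \<alpha> C, unfolded o_def])
       (auto intro!: holomorphic_intros assms(2))
  have opC: "open {z. Q + exp z \<in> C}"
  proof -
    have "open ((\<lambda>z. Q + exp z) -` C)"
      by (rule open_vimage[OF assms(1)]) (intro continuous_intros)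
    then show ?thesis by (simp add: vimage_def)
  qed
  have opW: "open W"
  proof -
    have "open ({z. Q + exp z \<in> C} \<inter> G -` ball 0 (M + 2 * \<epsilon>))"
      by (intro continuous_open_preimage holomorphic_on_imp_continuous_on[OF holG] opC) auto
    moreover have "{z. Q + exp z \<in> C} \<inter> G -` ball 0 (M + 2 * \<epsilon>) = W" by (auto simp: W_def)
    ultimately show ?thesis by simp
  qed
  have opWk: "open (Wk k)" for k
    unfolding Wk_def by (intro open_Int opW open_halfspace_Im_gt open_halfspace_Im_lt)
  have holWk: "G holomorphic_on Wk k" for k
    by (rule holomorphic_on_subset[OF holG]) (auto simp: Wk_def W_def)
  have injWk: "inj_on G (Wk k)" for k
  proof (rule inj_onI)
    fix z w assume zw: "z \<in> Wk k" "w \<in> Wk k" "G z = G w"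
    then have "Q + exp z = Q + exp w"
      using assms(3) by (auto simp: G_def Wk_def W_def dest: inj_onD)
    then have "exp z = exp w" by simp
    moreover have "\<bar>Im z - Im w\<bar> < 2 * pi"
    proof -
      have "Im z < 2 * pi * of_int k + 2 * pi" "Im w < 2 * pi * of_int k + 2 * pi"
        using zw by (auto simp: Wk_def algebra_simps)
      moreover have "2 * pi * of_int k < Im z" "2 * pi * of_int k < Im w" using zw by (auto simp: Wk_def)
      ultimately show ?thesis by linarith
    qed
    ultimately show "z = w" using exp_complex_eqI by blast
  qed
  define K where "K = measure lebesgue (complexv ` ball 0 (M + 2 * \<epsilon>))"
  have area: "(\<integral>\<^sup>+ x. \<integral>\<^sup>+ t. e x t * indicator (Wk k) (Complex x t) \<partial>lborel \<partial>lborel) \<le> ennreal K" for k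
    unfolding K_def e_def
    by (rule holomorphic_image_area[OF opWk holWk injWk]) (auto simp: Wk_def W_def)
  have mC: "(\<lambda>z. Complex (fst z) (snd z)) \<in> borel_measurable (borel :: (real \<times> real) measure)"
    by (intro borel_measurable_continuous_onI) (auto simp: Complex_eq intro!: continuous_intros)
  have m2: "(\<lambda>z. e (fst z) (snd z) * indicator (Wk k) (Complex (fst z) (snd z))) \<in> borel_measurable (lborel \<Otimes>\<^sub>M lborel)" for k
    using measurable_compose[OF mC measurable_energy[OF opWk holWk]] by (simp add: e_def lborel_prod)
  have m1: "(\<lambda>x. \<integral>\<^sup>+ t. e x t * indicator (Wk k) (Complex x t) \<partial>lborel) \<in> borel_measurable lborel" for k
    using lborel.borel_measurable_nn_integral[of "\<lambda>x t. e x t * indicator (Wk k) (Complex x t)" lborel] m2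
    by (simp add: case_prod_beta)
  have m0: "(\<lambda>t. e x t * indicator (Wk k) (Complex x t)) \<in> borel_measurable lborel" for x k
  proof -
    have "(\<lambda>t. Complex x t) \<in> borel_measurable (borel :: real measure)"
      by (intro borel_measurable_continuous_onI) (auto simp: Complex_eq intro!: continuous_intros)
    from measurable_compose[OF this measurable_energy[OF opWk holWk]] show ?thesis by (simp add: e_def)
  qed
  \<comment> \<open>With \<open>\<theta>\<close> normalised to lie between \<open>0\<close> and
    \<open>2 * pi\<close>, the arc stays between \<open>- 2 * pi\<close> and \<open>4 * pi\<close>,
    so three strips suffice.\<close>
  define S where "S = {-1, 0, 1::int}"
  define E where "E = (\<lambda>x. \<Sum>k\<in>S. \<integral>\<^sup>+ t. e x t * indicator (Wk k) (Complex x t) \<partial>lborel)"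
  define \<eta> where "\<eta> = \<epsilon>\<^sup>2 / (2 * pi)"
  have \<eta>: "\<eta> > 0" using assms(4) by (simp add: \<eta>_def)
  have low: "ennreal \<eta> \<le> E x" if x: "exp x < r1" "exp x \<notin> Z" for x
  proof -
    obtain \<theta>0 \<theta>0' where b0: "\<bar>\<theta>0 - \<theta>0'\<bar> \<le> 2 * pi" "\<And>t. t \<in> closed_segment \<theta>0 \<theta>0' \<Longrightarrow> circ Q (exp x) t \<in> C"
       "norm (\<alpha> (circ Q (exp x) \<theta>0)) \<le> M" "\<epsilon> \<le> norm (\<alpha> (circ Q (exp x) \<theta>0) - \<alpha> (circ Q (exp x) \<theta>0'))"
      using bad[of "exp x"] x by auto
    define n where "n = - \<lfloor>\<theta>0 / (2 * pi)\<rfloor>"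
    define c where "c = 2 * pi * of_int n"
    define \<theta> \<theta>' where "\<theta> = \<theta>0 + c" and "\<theta>' = \<theta>0' + c"
    have per: "circ Q (exp x) (t + c) = circ Q (exp x) t" for t by (simp add: c_def circ_periodic)
    have "of_int (- n) \<le> \<theta>0 / (2 * pi)" "\<theta>0 / (2 * pi) < of_int (- n) + 1" unfolding n_def by linarith+
    then have \<theta>: "0 \<le> \<theta>" "\<theta> \<le> 2 * pi"
      unfolding \<theta>_def c_def by (auto simp: field_simps)
    have \<theta>': "- 2 * pi \<le> \<theta>'" "\<theta>' \<le> 4 * pi"
      using \<theta> b0(1) unfolding \<theta>_def \<theta>'_def by auto
    have segC: "circ Q (exp x) t \<in> C" if "t \<in> closed_segment \<theta> \<theta>'" for t
    proof -
      have "t - c \<in> closed_segment \<theta>0 \<theta>0'"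
        using that unfolding \<theta>_def \<theta>'_def by (auto simp: closed_segment_eq_real_ivl split: if_splits)
      from b0(2)[OF this] per[of "t - c"] show ?thesis by simp
    qed
    have "ennreal \<eta> \<le> (\<integral>\<^sup>+ t. ennreal ((norm (deriv G (Complex x t)))\<^sup>2) * indicator W (Complex x t) * indicator {-2*pi..4*pi} t \<partial>lborel)"
      unfolding \<eta>_def
    proof (rule circle_energy[OF assms(1,2,4), of \<theta> \<theta>'])
      show "norm (\<alpha> (circ Q (exp x) \<theta>)) \<le> M" using b0(3) per[of \<theta>0] by (simp add: \<theta>_def)
      show "\<epsilon> \<le> norm (\<alpha> (circ Q (exp x) \<theta>) - \<alpha> (circ Q (exp x) \<theta>'))"
        using b0(4) per[of \<theta>0] per[of \<theta>0'] by (simp add: \<theta>_def \<theta>'_def)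
    qed (use b0(1) segC \<theta> \<theta>' G_def W_def in \<open>auto simp: \<theta>_def \<theta>'_def\<close>)
    also have "\<dots> \<le> (\<integral>\<^sup>+ t. (\<Sum>k\<in>S. e x t * indicator (Wk k) (Complex x t)) \<partial>lborel)"
    proof (rule nn_integral_mono_AE)
      have "finite {-2*pi, 0, 2*pi, 4*pi}" by simp
      then have "AE t in lborel. t \<notin> {-2*pi, 0, 2*pi, 4*pi}"
        by (intro AE_not_in) (simp add: countable_imp_null_set_lborel countable_finite)
      then show "AE t in lborel. ennreal ((norm (deriv G (Complex x t)))\<^sup>2) * indicator W (Complex x t) * indicator {-2*pi..4*pi} t
          \<le> (\<Sum>k\<in>S. e x t * indicator (Wk k) (Complex x t))"
      proof (rule AE_mp, intro AE_I2 impI)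
        fix t :: real assume t: "t \<notin> {-2*pi, 0, 2*pi, 4*pi}"
        show "ennreal ((norm (deriv G (Complex x t)))\<^sup>2) * indicator W (Complex x t) * indicator {-2*pi..4*pi} t
          \<le> (\<Sum>k\<in>S. e x t * indicator (Wk k) (Complex x t))"
        proof (cases "Complex x t \<in> W \<and> t \<in> {-2*pi..4*pi}")
          case True
          then consider "-2*pi < t" "t < 0" | "0 < t" "t < 2*pi" | "2*pi < t" "t < 4*pi" using t by force
          then obtain k where "k \<in> S" "Complex x t \<in> Wk k"
          proof cases
            case 1 show ?thesis by (rule that[of "-1"]) (use 1 True in \<open>auto simp: S_def Wk_def\<close>)
          next
            case 2 show ?thesis by (rule that[of 0]) (use 2 True in \<open>auto simp: S_def Wk_def\<close>)
          next
            case 3 show ?thesis by (rule that[of 1]) (use 3 True in \<open>auto simp: S_def Wk_def\<close>)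
          qed
          then have "e x t \<le> (\<Sum>k\<in>S. e x t * indicator (Wk k) (Complex x t))"
            using member_le_sum[of k S "\<lambda>k. e x t * indicator (Wk k) (Complex x t)"] by (simp add: S_def)
          then show ?thesis using True by (simp add: e_def)
        qed auto
      qed
    qed
    also have "\<dots> = E x" unfolding E_def by (rule nn_integral_sum) (rule m0)
    finally show ?thesis .
  qed
  \<comment> \<open>The three strips have total energy at most \<open>3 * K\<close>, whereas an
    interval of length \<open>L\<close> forces at least
    \<open>\<eta> * L = 3 * K + 1\<close>.\<close>
  define L where "L = (3 * K + 1) / \<eta>"
  define b where "b = ln r1 - 1"
  have K0: "K \<ge> 0" by (simp add: K_def)
  have L: "L > 0" using \<eta> K0 by (auto simp: L_def intro!: divide_pos_pos)
  have "countable (exp -` Z :: real set)"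
  proof (rule countable_image_inj_on)
    show "countable (exp ` (exp -` Z :: real set))"
      by (rule countable_subset[OF _ assms(6)]) auto
  qed (auto simp: inj_on_def)
  then have AEZ: "AE x in lborel. (x::real) \<notin> exp -` Z"
    by (intro AE_not_in countable_imp_null_set_lborel)
  have "ennreal (\<eta> * L) = ennreal \<eta> * emeasure lborel {b - L..b}"
    using \<eta> L by (simp add: ennreal_mult)
  also have "\<dots> = (\<integral>\<^sup>+ x. ennreal \<eta> * indicator {b - L..b} x \<partial>lborel)"
    by (simp add: nn_integral_cmult_indicator)
  also have "\<dots> \<le> (\<integral>\<^sup>+ x. E x \<partial>lborel)"
  proof (rule nn_integral_mono_AE, rule AE_mp[OF AEZ], intro AE_I2 impI)
    fix x :: real assume x: "x \<notin> exp -` Z"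
    show "ennreal \<eta> * indicator {b - L..b} x \<le> E x"
    proof (cases "x \<in> {b - L..b}")
      case True
      then have "x < ln r1" by (simp add: b_def)
      then have "exp x < r1" using assms(5) by (metis exp_less_mono exp_ln)
      then show ?thesis using low[of x] x True by simp
    qed simp
  qed
  also have "\<dots> = (\<Sum>k\<in>S. \<integral>\<^sup>+ x. \<integral>\<^sup>+ t. e x t * indicator (Wk k) (Complex x t) \<partial>lborel \<partial>lborel)"
    unfolding E_def by (rule nn_integral_sum) (rule m1)
  also have "\<dots> \<le> (\<Sum>k\<in>S. ennreal K)" by (intro sum_mono area)
  also have "\<dots> = ennreal (3 * K)" using K0 by (simp add: S_def ennreal_mult)
  finally have "\<eta> * L \<le> 3 * K" using K0 by simp
  moreover have "\<eta> * L = 3 * K + 1" using \<eta> by (simp add: L_def)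
  ultimately show False by simp
qed

section \<open>Crosscuts between two arcs\<close>

lemma circ_inj:
  assumes "r > 0" "circ Q r s = circ Q r t" "\<bar>s - t\<bar> < 2 * pi"
  shows "s = t"
proof -
  have "cis s = cis t" using assms(1,2) by (simp add: circ_def)
  then have "exp (\<i> * of_real s) = exp (\<i> * of_real t)" by (simp add: cis_conv_exp)
  moreover have "\<bar>Im (\<i> * of_real s) - Im (\<i> * of_real t)\<bar> < 2 * pi" using assms(3) by simp
  ultimately have "\<i> * complex_of_real s = \<i> * of_real t" using exp_complex_eqI by blast
  then show ?thesis by simp
qed

lemma dist_circ: "r \<ge> 0 \<Longrightarrow> dist Q (circ Q r t) = r"
  by (simp add: circ_def dist_norm norm_mult)

lemma segment_real_image:
  fixes a b :: real
  shows "closed_segment a b = (\<lambda>v. a + v * (b - a)) ` {0..1}"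
    and "a \<noteq> b \<Longrightarrow> open_segment a b = (\<lambda>v. a + v * (b - a)) ` {0<..<1}"
proof -
  have *: "(\<lambda>u. (1 - u) *\<^sub>R a + u *\<^sub>R b) = (\<lambda>v. a + v * (b - a))"
    by (simp add: fun_eq_iff algebra_simps)
  show "closed_segment a b = (\<lambda>v. a + v * (b - a)) ` {0..1}"
    and "a \<noteq> b \<Longrightarrow> open_segment a b = (\<lambda>v. a + v * (b - a)) ` {0<..<1}"
    by (simp_all only: closed_segment_image_interval open_segment_image_interval * if_False)
qed

lemma Int_subset_singleton:
  assumes "A \<subseteq> A'" "B \<subseteq> B'" "A' \<inter> B' = {p, q}" "p \<notin> A" shows "A \<inter> B \<subseteq> {q}"
proof
  fix x assume x: "x \<in> A \<inter> B"
  then have "x \<in> A' \<inter> B'" using assms(1,2) by auto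
  then have "x = p \<or> x = q" unfolding assms(3) by simp
  then show "x \<in> {q}" using x assms(4) by auto
qed
lemma Int_eq_empty:
  assumes "A \<subseteq> A'" "B \<subseteq> B'" "A' \<inter> B' = {p, q}" "p \<notin> A" "q \<notin> B" shows "A \<inter> B = {}"
  using Int_subset_singleton[OF assms(1-4)] assms(5) by auto
lemma Un_Int_Un_eq_pair:
  assumes "A1 \<inter> A2 = {p}" "B1 \<inter> B2 = {q}" "A1 \<inter> B2 = {}" "A2 \<inter> B1 = {}" shows "(A1 \<union> B1) \<inter> (A2 \<union> B2) = {p, q}"
proof -
  have "(A1 \<union> B1) \<inter> (A2 \<union> B2) = (A1 \<inter> A2) \<union> (A1 \<inter> B2) \<union> (A2 \<inter> B1) \<union> (B1 \<inter> B2)" by auto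
  then show ?thesis unfolding assms by auto
qed
lemma Int_insert_pair:
  assumes "X \<inter> Y = {p, q}" "X \<union> Y = T" "V \<subseteq> U" "U \<inter> T = {}" shows "X \<inter> insert p (insert q V) = {p, q}"
proof -
  have "p \<in> X" "q \<in> X" using assms(1) by auto
  moreover have "X \<inter> V = {}" using assms(2-4) by auto
  ultimately show ?thesis by auto
qed

section \<open>A Jordan curve composed of two arcs\<close>

locale two_arcs =
  fixes g h :: "real \<Rightarrow> complex"
  assumes arc_g: "arc g" and arc_h: "arc h"
    and start_eq: "h 0 = g 0" and finish_eq: "h 1 = g 1"
    and meet: "path_image g \<inter> path_image h = {g 0, g 1}"
begin

definition "J = path_image g \<union> path_image h"
definition "C = inside J"
definition "loop = g +++ reversepath h"

lemma path_g: "path g" and path_h: "path h"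
  using arc_g arc_h arc_imp_path by auto

lemma continuous_g: "continuous_on {0..1} g" and continuous_h: "continuous_on {0..1} h"
  using path_g path_h by (auto simp: path_def)

lemma inj_g: "inj_on g {0..1}" and inj_h: "inj_on h {0..1}"
  using arc_g arc_h by (auto simp: arc_def)

lemma g_in: "t \<in> {0..1} \<Longrightarrow> g t \<in> path_image g" and h_in: "t \<in> {0..1} \<Longrightarrow> h t \<in> path_image h"
  by (auto simp: path_image_def)

lemma start_neq_finish: "g 0 \<noteq> g 1"
  using inj_g by (auto dest: inj_onD)

lemma simple_loop: "simple_path loop" and loop_closed: "pathfinish loop = pathstart loop"
  and path_image_loop: "path_image loop = J"
proof -
  have e': "pathfinish h = pathfinish g" "pathstart h = pathstart g"
    using start_eq finish_eq by (simp_all add: pathfinish_def pathstart_def)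
  have e: "pathfinish g = pathstart (reversepath h)" "pathstart g = pathfinish (reversepath h)"
    by (simp_all add: e')
  show "simple_path loop" unfolding loop_def
    by (rule simple_path_join_loop[OF arc_g arc_reversepath[OF arc_h] e(1) e(2)[symmetric]])
       (use meet in \<open>simp add: e', auto simp: pathstart_def pathfinish_def\<close>)
  show "pathfinish loop = pathstart loop" unfolding loop_def by (simp add: e')
  show "path_image loop = J" unfolding loop_def J_def by (simp add: path_image_join e')
qed

lemma path_loop: "path loop" using simple_loop simple_path_imp_path by blast

lemmas Jordan = Jordan_inside_outside[OF simple_loop loop_closed, unfolded path_image_loop]

lemma open_C: "open C" and connected_C: "connected C" and C_ne: "C \<noteq> {}" and bounded_C: "bounded C"
  and C_J: "C \<inter> J = {}" and frontier_C: "frontier C = J"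
  using Jordan by (auto simp: C_def)

lemma closure_C: "closure C = C \<union> J"
  using frontier_C open_C closure_Un_frontier[of C] by simp

lemma outside_iff: "z \<in> outside J \<longleftrightarrow> z \<notin> C \<and> z \<notin> J"
proof -
  have "inside J \<inter> outside J = {}" "inside J \<union> outside J = - J" using Jordan by blast+
  then show ?thesis unfolding C_def by blast
qed

lemma winding_number_loop:
  assumes "z \<notin> J"
  shows "winding_number loop z = winding_number g z - winding_number h z"
proof -
  have "winding_number loop z = winding_number g z + winding_number (reversepath h) z"
    unfolding loop_def
  proof (rule winding_number_join)
    show "pathfinish g = pathstart (reversepath h)" using finish_eq by (simp add: pathfinish_def)
  qed (use assms path_g path_h in \<open>auto simp: J_def\<close>)
  also have "winding_number (reversepath h) z = - winding_number h z"
    using assms path_h by (intro winding_number_reversepath) (auto simp: J_def)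
  finally show ?thesis by simp
qed

lemma winding_number_outside: "z \<notin> C \<Longrightarrow> z \<notin> J \<Longrightarrow> winding_number loop z = 0"
  using winding_number_zero_in_outside[OF path_loop loop_closed] outside_iff path_image_loop by simp

lemma winding_number_inside:
  obtains e where "e \<noteq> 0" "\<And>z. z \<in> C \<Longrightarrow> winding_number loop z = e"
  using simple_closed_path_winding_number_inside[OF simple_loop] unfolding path_image_loop C_def
  by (metis one_neq_zero zero_neq_neg_one)

text \<open>The winding numbers of \<open>g\<close> and \<open>h\<close> agree outside the Jordan
  curve. If no arc of the circle within the closed region joined \<open>g\<close> to
  \<open>h\<close>, they could be patched to one continuous function along the circle. Times 2 pi i,
  it is a logarithm of \<open>(g 1 - z) / (g 0 - z)\<close>, so the circle would have winding number
  0 about its own centre.\<close>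

lemma exists_arc_on_circle:
  assumes r: "0 < r" "r < dist (g 0) (g 1)"
  obtains \<theta> \<theta>' t s where "\<bar>\<theta> - \<theta>'\<bar> < 2 * pi" "t \<in> {0<..<1}" "s \<in> {0<..<1}"
    "circ (g 1) r \<theta> = g t" "circ (g 1) r \<theta>' = h s" "\<And>\<phi>. \<phi> \<in> open_segment \<theta> \<theta>' \<Longrightarrow> circ (g 1) r \<phi> \<in> C"
proof -
  define P Q where "P = g 0" and "Q = g 1"
  have PQJ: "P \<in> J" "Q \<in> J" by (auto simp: P_def Q_def J_def path_image_def)
  \<comment> \<open>The outside is connected, unbounded and accumulates at \<open>Q\<close>, hence
    it meets the circle. The parametrisation \<open>e\<close> starts at such a point, so neither end
    of the parameter interval belongs to \<open>K\<close>.\<close>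
  have "\<not> outside J \<subseteq> ball Q r"
    using Jordan bounded_subset bounded_ball by blast
  moreover have "outside J \<inter> ball Q r \<noteq> {}"
  proof -
    have "Q \<in> closure (outside J)"
      using Jordan PQJ(2) unfolding frontier_def by blast
    then show ?thesis using r(1) by (metis closure_approachable disjoint_iff mem_ball dist_commute)
  qed
  ultimately have "outside J \<inter> frontier (ball Q r) \<noteq> {}"
    using Jordan by (intro connected_Int_frontier) auto
  then obtain x0 where x0: "x0 \<in> outside J" "dist Q x0 = r"
    using r(1) unfolding frontier_ball[OF r(1)] by (metis disjoint_iff mem_sphere)
  define \<theta>0 where "\<theta>0 = Arg (x0 - Q)"
  have "x0 \<noteq> Q" using x0 r by auto
  then have "cis \<theta>0 = inverse (of_real r) * (x0 - Q)"
    using cis_Arg[of "x0 - Q"] x0(2)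
    by (simp add: \<theta>0_def sgn_div_norm dist_norm norm_minus_commute scaleR_conv_of_real)
  then have "of_real r * cis \<theta>0 = x0 - Q" using r(1) by (simp flip: mult.assoc)
  then have x0c: "circ Q r \<theta>0 = x0" by (simp add: circ_def)
  define e where "e = (\<lambda>u. circ Q r (\<theta>0 + 2 * pi * u))"
  have ce: "continuous_on A e" for A
    unfolding e_def by (rule continuous_on_compose2[OF continuous_on_circ[of UNIV]]) (auto intro!: continuous_intros)
  have e01: "e 1 = e 0" "e 0 = x0" using circ_periodic[of Q r \<theta>0 1] x0c by (auto simp: e_def)
  have eQ: "dist Q (e u) = r" for u unfolding e_def using r(1) by (simp add: dist_circ)
  have ePQ: "e u \<noteq> P" "e u \<noteq> Q" for u using eQ[of u] r by (auto simp: P_def Q_def dist_commute)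
  define K where "K = {u \<in> {0..1}. e u \<in> C \<union> J}"
  have clCJ: "closed (C \<union> J)" using closure_C by (metis closed_closure)
  have clK: "closed K"
  proof -
    have "closed ({0..1} \<inter> e -` (C \<union> J))" by (intro continuous_closed_preimage ce clCJ) auto
    moreover have "{0..1} \<inter> e -` (C \<union> J) = K" by (auto simp: K_def)
    ultimately show ?thesis by simp
  qed
  have x0n: "e 0 \<notin> C" "e 0 \<notin> J" using x0(1) unfolding e01(2) outside_iff by simp_all
  then have K01: "K \<subseteq> {0..1}" "0 \<notin> K" "1 \<notin> K" unfolding K_def e01(1)[symmetric] by (auto simp: e01(1))
  have Jout: "e u \<notin> C" "e u \<notin> J" if "u \<in> {0..1}" "u \<notin> K" for u
    using that by (auto simp: K_def)
  have main: "\<exists>t1\<in>{0..1}. \<exists>t2\<in>{0..1}. e t1 \<in> path_image g \<and> e t2 \<in> path_image h \<and> closed_segment t1 t2 \<subseteq> K"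
  proof (rule ccontr)
    assume neg: "\<not> ?thesis"
    \<comment> \<open>\<open>T p\<close> collects the times connected within \<open>K\<close> to a
      time on \<open>p\<close>; writing it as a projection of a compact set shows that it is closed.
      \<open>T g\<close> and \<open>T h\<close> cover \<open>K\<close>, and under \<open>neg\<close>
      they are disjoint.\<close>
    define T where "T = (\<lambda>p. fst ` ({0..1} \<times> {0..1} \<inter> (\<lambda>z. e (snd z)) -` path_image p \<inter>
        (\<Inter>v\<in>{0..1}. (\<lambda>z. fst z + v * (snd z - fst z)) -` K)))"
    have Tiff: "t \<in> T p \<longleftrightarrow> t \<in> {0..1} \<and> (\<exists>t'\<in>{0..1}. e t' \<in> path_image p \<and> closed_segment t t' \<subseteq> K)" for t p
    proof -
      have seg: "closed_segment t t' \<subseteq> K \<longleftrightarrow> (\<forall>v\<in>{0..1}. t + v * (t' - t) \<in> K)" for t'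
        unfolding segment_real_image(1) by blast
      have "t \<in> T p \<longleftrightarrow> (\<exists>t'. t \<in> {0..1} \<and> t' \<in> {0..1} \<and> e t' \<in> path_image p \<and> (\<forall>v\<in>{0..1}. t + v * (t' - t) \<in> K))"
      proof
        assume "t \<in> T p"
        then obtain z where z: "z \<in> {0..1} \<times> {0..1}" "e (snd z) \<in> path_image p"
            "\<And>v. v \<in> {0..1} \<Longrightarrow> fst z + v * (snd z - fst z) \<in> K" "t = fst z"
          unfolding T_def by (auto simp del: atLeastAtMost_iff)
        show "\<exists>t'. t \<in> {0..1} \<and> t' \<in> {0..1} \<and> e t' \<in> path_image p \<and> (\<forall>v\<in>{0..1}. t + v * (t' - t) \<in> K)"
          by (rule exI[of _ "snd z"]) (use z in \<open>simp add: mem_Times_iff del: atLeastAtMost_iff\<close>)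
      next
        assume "\<exists>t'. t \<in> {0..1} \<and> t' \<in> {0..1} \<and> e t' \<in> path_image p \<and> (\<forall>v\<in>{0..1}. t + v * (t' - t) \<in> K)"
        then obtain t' where t': "t \<in> {0..1}" "t' \<in> {0..1}" "e t' \<in> path_image p"
           "\<forall>v\<in>{0..1}. t + v * (t' - t) \<in> K" by blast
        show "t \<in> T p" unfolding T_def
          by (rule image_eqI[of _ _ "(t, t')"]) (use t' in auto)
      qed
      then show ?thesis unfolding seg by blast
    qed
    have clT: "closed (T p)" if "path p" for p
    proof -
      have "closed ((\<lambda>z::real\<times>real. fst z + v * (snd z - fst z)) -` K)" for v
        by (intro closed_vimage clK continuous_intros)
      then have c1: "closed (\<Inter>v\<in>{0..1}. (\<lambda>z::real\<times>real. fst z + v * (snd z - fst z)) -` K)" by auto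
      have "closed ((\<lambda>z::real\<times>real. e (snd z)) -` path_image p)"
      proof (rule closed_vimage)
        show "closed (path_image p)" using that by (rule closed_path_image)
        show "continuous_on UNIV (\<lambda>z::real\<times>real. e (snd z))"
          by (rule continuous_on_compose2[OF ce[of UNIV]]) (auto intro!: continuous_intros)
      qed
      then have "compact ({0..1::real} \<times> {0..1::real} \<inter> (\<lambda>z. e (snd z)) -` path_image p \<inter>
        (\<Inter>v\<in>{0..1}. (\<lambda>z. fst z + v * (snd z - fst z)) -` K))"
        by (intro compact_Int_closed compact_Times c1) auto
      then have "compact (T p)" unfolding T_def
        by (intro compact_continuous_image continuous_on_fst continuous_on_id)
      then show ?thesis by (rule compact_imp_closed)
    qed
    have TI: "t \<in> T p" if "t \<in> {0..1}" "e t \<in> path_image p" "path_image p \<subseteq> J" for t p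
      using that unfolding Tiff by (auto intro!: bexI[of _ t] simp: K_def)
    have Tun: "t \<in> T g \<or> t \<in> T h" if t: "t \<in> K" for t
    proof -
      have "\<exists>s\<in>{0..1}. e s \<in> J \<and> closed_segment t s \<subseteq> K"
      proof (cases "e t \<in> C")
        case False
        then show ?thesis using t by (intro bexI[of _ t]) (auto simp: K_def)
      next
        case True
        define S where "S = {t..1} \<inter> e -` (- C)"
        have "compact S"
        proof -
          have "closed S" unfolding S_def by (intro continuous_closed_preimage ce) (use open_C in auto)
          moreover have "bounded S" unfolding S_def by (meson bounded_closed_interval bounded_subset inf_le1)
          ultimately show ?thesis using compact_eq_bounded_closed by blast
        qed
        moreover have "1 \<in> S" using t K01(1) e01(1) x0n by (auto simp: S_def)
        ultimately obtain s where s: "s \<in> S" "\<And>x. x \<in> S \<Longrightarrow> s \<le> x"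
          using compact_attains_inf[of S] by (metis empty_iff)
        have ts: "t < s" using s(1) True by (auto simp: S_def order_le_less)
        have inC: "e x \<in> C" if "x \<in> {t..<s}" for x
          using s(2)[of x] that s(1) by (force simp: S_def)
        have "e s \<in> closure (e ` {t..<s})"
        proof -
          have "e ` closure {t..<s} \<subseteq> closure (e ` {t..<s})"
            by (rule image_closure_subset[OF ce]) (auto intro: closure_subset[THEN subsetD])
          moreover have "s \<in> closure {t..<s}" using ts by simp
          ultimately show ?thesis by blast
        qed
        moreover have "closure (e ` {t..<s}) \<subseteq> closure C"
          by (rule closure_mono) (use inC in auto)
        ultimately have "e s \<in> closure C" by blast
        then have esJ: "e s \<in> J" using s(1) closure_C by (auto simp: S_def)
        have "closed_segment t s \<subseteq> K"
        proof
          fix x assume "x \<in> closed_segment t s"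
          then have "x \<in> {t..s}" using ts by (simp add: closed_segment_eq_real_ivl)
          then show "x \<in> K" using inC[of x] esJ s(1) t K01(1) by (cases "x = s") (auto simp: K_def S_def)
        qed
        moreover have "s \<in> {0..1}" using s(1) t K01(1) by (auto simp: S_def)
        ultimately show ?thesis using esJ by blast
      qed
      then show ?thesis using t K01(1) unfolding Tiff J_def by blast
    qed
    have Tdisj: "\<not> (t \<in> T g \<and> t \<in> T h)" for t
    proof
      assume "t \<in> T g \<and> t \<in> T h"
      then obtain t1 t2 where t12: "t1 \<in> {0..1}" "e t1 \<in> path_image g" "closed_segment t t1 \<subseteq> K"
         "t2 \<in> {0..1}" "e t2 \<in> path_image h" "closed_segment t t2 \<subseteq> K" unfolding Tiff by blast
      have "closed_segment t1 t2 \<subseteq> closed_segment t t1 \<union> closed_segment t t2"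
        by (auto simp: closed_segment_eq_real_ivl split: if_splits)
      then show False using neg t12 by blast
    qed
    have TK: "T p \<subseteq> K" for p
    proof
      fix t assume "t \<in> T p"
      then obtain t' where "closed_segment t t' \<subseteq> K" unfolding Tiff by blast
      then show "t \<in> K" by auto
    qed
    \<comment> \<open>On \<open>T g\<close> the circle may run into \<open>g\<close> but stays off
      \<open>h\<close>, so the winding number of \<open>h\<close> is used there, and that of
      \<open>g\<close> elsewhere. Off \<open>K\<close> the two coincide.\<close>
    define f where "f = (\<lambda>t. if t \<in> T g then winding_number h (e t) else winding_number g (e t))"
    have out_eq: "winding_number g (e t) = winding_number h (e t)" if "t \<in> {0..1}" "t \<notin> K" for t
    proof -
      have "e t \<notin> J" "e t \<notin> C" using Jout[OF that] by auto
      then show ?thesis using winding_number_loop[of "e t"] winding_number_outside[of "e t"] by simp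
    qed
    have fh: "f t = winding_number h (e t)" "e t \<notin> path_image h" if "t \<in> {0..1} - T h" for t
    proof -
      show "f t = winding_number h (e t)"
        using that Tun[of t] out_eq[of t] by (auto simp: f_def)
      show "e t \<notin> path_image h" using that TI[of t h] by (auto simp: J_def)
    qed
    have fg: "f t = winding_number g (e t)" "e t \<notin> path_image g" if "t \<in> {0..1} - T g" for t
    proof -
      show "f t = winding_number g (e t)" using that by (auto simp: f_def)
      show "e t \<notin> path_image g" using that TI[of t g] by (auto simp: J_def)
    qed
    have un: "{0..1} = ({0..1} - T h) \<union> ({0..1} - T g)" using Tdisj by blast
    have "continuous_on (({0..1} - T h) \<union> ({0..1} - T g)) f"
    proof (rule continuous_on_Un_local_open)
      have o: "openin (top_of_set {0..1}) ({0..1} - T p)" if "path p" for p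
        using openin_open_Int[of "- T p" "{0..1}"] clT[OF that] by (simp add: Diff_eq open_Compl)
      show "openin (top_of_set (({0..1} - T h) \<union> ({0..1} - T g))) ({0..1} - T h)"
        using o[OF path_h] un by simp
      show "openin (top_of_set (({0..1} - T h) \<union> ({0..1} - T g))) ({0..1} - T g)"
        using o[OF path_g] un by simp
      have "continuous_on ({0..1} - T h) (\<lambda>t. winding_number h (e t))"
        by (rule continuous_on_compose2[OF continuous_on_winding_number[OF path_h] ce]) (use fh in auto)
      then show "continuous_on ({0..1} - T h) f" by (rule continuous_on_eq) (simp add: fh(1))
      have "continuous_on ({0..1} - T g) (\<lambda>t. winding_number g (e t))"
        by (rule continuous_on_compose2[OF continuous_on_winding_number[OF path_g] ce]) (use fg in auto)
      then show "continuous_on ({0..1} - T g) f" by (rule continuous_on_eq) (simp add: fg(1))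
    qed
    then have cf: "continuous_on {0..1} f" using un by simp
    have expf: "Q - e t = exp (2 * pi * \<i> * f t) * (P - e t)" if "t \<in> {0..1}" for t
    proof (cases "t \<in> T h")
      case True
      then have "t \<in> {0..1} - T g" using Tdisj that by blast
      then show ?thesis using winding_number_exp_2pi[OF path_g, of "e t"] fg
        by (simp add: P_def Q_def pathstart_def pathfinish_def)
    next
      case False
      then show ?thesis using winding_number_exp_2pi[OF path_h, of "e t"] fh that
        by (simp add: P_def Q_def pathstart_def pathfinish_def start_eq finish_eq)
    qed
    have pe: "path e" using ce by (simp add: path_def)
    have Pe: "P \<notin> path_image e" using ePQ(1) by (auto simp: path_image_def)
    \<comment> \<open>\<open>P\<close> lies outside the circle, so \<open>e - P\<close> has a
      logarithm \<open>q\<close> with equal end values. Adding \<open>2 * pi * \<i> * f\<close>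
      gives a logarithm of \<open>e - Q\<close> that returns to its initial value too.\<close>
    have "winding_number e P = 0"
    proof (rule winding_number_zero_outside[OF pe convex_cball])
      show "P \<notin> cball Q r" using r by (simp add: P_def Q_def dist_commute)
      show "path_image e \<subseteq> cball Q r" using eQ by (auto simp: path_image_def)
    qed (use e01 in \<open>auto simp: pathfinish_def pathstart_def\<close>)
    then obtain q where q: "path q" "pathfinish q = pathstart q" "\<And>t. t \<in> {0..1} \<Longrightarrow> e t = P + exp (q t)"
      using winding_number_as_continuous_log[OF pe Pe] by (metis eq_iff_diff_eq_0 mult_zero_right)
    have "winding_number e Q = ((2 * pi * \<i> * f 1 + q 1) - (2 * pi * \<i> * f 0 + q 0)) / (2 * of_real pi * \<i>)"
    proof (rule winding_number_eq_log[OF pe, of "\<lambda>t. 2 * pi * \<i> * f t + q t"])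
      show "continuous_on {0..1} (\<lambda>t. 2 * pi * \<i> * f t + q t)"
        using cf q(1) by (intro continuous_intros) (auto simp: path_def)
      show "e t - Q = exp (2 * pi * \<i> * f t + q t)" if "t \<in> {0..1}" for t
      proof -
        have "e t - Q = exp (2 * pi * \<i> * f t) * (e t - P)"
          using expf[OF that] by (metis minus_diff_eq mult_minus_right)
        also have "e t - P = exp (q t)" using q(3)[OF that] by simp
        finally show ?thesis by (simp add: exp_add)
      qed
    qed
    moreover have "q 1 = q 0" using q(2) by (simp add: pathfinish_def pathstart_def)
    moreover have "f 1 = f 0" using fg(1)[of 0] fg(1)[of 1] TK[of g] K01 e01(1) by (metis DiffI atLeastAtMost_iff order_refl subsetD zero_le_one)
    ultimately have "winding_number e Q = 0" by simp
    moreover have "winding_number e Q =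
       ((of_real (ln r) + \<i> * of_real (\<theta>0 + 2 * pi * 1)) - (of_real (ln r) + \<i> * of_real (\<theta>0 + 2 * pi * 0))) / (2 * of_real pi * \<i>)"
    proof (rule winding_number_eq_log[OF pe, of "\<lambda>t. of_real (ln r) + \<i> * of_real (\<theta>0 + 2 * pi * t)"])
      show "continuous_on {0..1} (\<lambda>t. of_real (ln r) + \<i> * of_real (\<theta>0 + 2 * pi * t))"
        by (intro continuous_intros)
      show "e t - Q = exp (of_real (ln r) + \<i> * of_real (\<theta>0 + 2 * pi * t))" for t
        using r(1) by (simp add: e_def circ_def exp_add cis_conv_exp exp_of_real)
    qed
    then have "winding_number e Q = 1" by (simp add: algebra_simps)
    ultimately show False by simp
  qed
  then obtain t1 t2 where t12: "t1 \<in> {0..1}" "t2 \<in> {0..1}" "e t1 \<in> path_image g" "e t2 \<in> path_image h"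
    "closed_segment t1 t2 \<subseteq> K" by blast
  define l where "l = (\<lambda>v. t1 + v * (t2 - t1))"
  have lK: "l v \<in> K" if "v \<in> {0..1}" for v
    using t12(5) that unfolding l_def segment_real_image(1) by blast
  have cel: "continuous_on A (\<lambda>v. e (l v))" for A
    unfolding l_def by (rule continuous_on_compose2[OF ce[of UNIV]]) (auto intro!: continuous_intros)
  have cpt: "compact ({a..b} \<inter> (\<lambda>v. e (l v)) -` path_image p)" if "path p" for a b p
  proof -
    have "closed ({a..b} \<inter> (\<lambda>v. e (l v)) -` path_image p)"
      by (intro continuous_closed_preimage cel closed_path_image that) auto
    moreover have "bounded ({a..b} \<inter> (\<lambda>v. e (l v)) -` path_image p)"
      by (meson bounded_closed_interval bounded_subset inf_le1)
    ultimately show ?thesis using compact_eq_bounded_closed by blast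
  qed
  \<comment> \<open>The last time on \<open>g\<close>, then the first later time on
    \<open>h\<close>: in between, the arc stays in \<open>K\<close> and off \<open>J\<close>, hence
    in \<open>C\<close>.\<close>
  have "0 \<in> {0..1} \<inter> (\<lambda>v. e (l v)) -` path_image g" using t12 by (simp add: l_def)
  then obtain v1 where v1: "v1 \<in> {0..1} \<inter> (\<lambda>v. e (l v)) -` path_image g"
     "\<And>v. v \<in> {0..1} \<inter> (\<lambda>v. e (l v)) -` path_image g \<Longrightarrow> v \<le> v1"
    using compact_attains_sup[OF cpt[OF path_g, of 0 1]] by (metis empty_iff)
  have "1 \<in> {v1..1} \<inter> (\<lambda>v. e (l v)) -` path_image h" using t12 v1 by (simp add: l_def)
  then obtain v2 where v2: "v2 \<in> {v1..1} \<inter> (\<lambda>v. e (l v)) -` path_image h"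
     "\<And>v. v \<in> {v1..1} \<inter> (\<lambda>v. e (l v)) -` path_image h \<Longrightarrow> v2 \<le> v"
    using compact_attains_inf[OF cpt[OF path_h, of v1 1]] by (metis empty_iff)
  have "v1 \<noteq> v2"
    using v1(1) v2(1) meet ePQ by (force simp: P_def Q_def)
  then have v12: "v1 < v2" using v2(1) by auto
  have inC: "e (l v) \<in> C" if "v \<in> {v1<..<v2}" for v
  proof -
    have "v \<in> {0..1}" using that v1(1) v2(1) by auto
    then have "e (l v) \<in> C \<union> J" using lK by (auto simp: K_def)
    moreover have "e (l v) \<notin> path_image g" using v1(2)[of v] that \<open>v \<in> {0..1}\<close> by force
    moreover have "e (l v) \<notin> path_image h" using v2(2)[of v] that \<open>v \<in> {0..1}\<close> by force
    ultimately show ?thesis by (auto simp: J_def)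
  qed
  define \<theta> \<theta>' where "\<theta> = \<theta>0 + 2 * pi * l v1" and "\<theta>' = \<theta>0 + 2 * pi * l v2"
  obtain t where t: "t \<in> {0..1}" "e (l v1) = g t" using v1(1) by (auto simp: path_image_def)
  obtain s where s: "s \<in> {0..1}" "e (l v2) = h s" using v2(1) by (auto simp: path_image_def)
  show ?thesis
  proof (rule that)
    have "v1 \<in> {0..1}" "v2 \<in> {0..1}" using v1(1) v2(1) by auto
    moreover have "x \<in> {0<..<1}" if "x \<in> K" for x
    proof -
      have "x \<in> {0..1}" "x \<noteq> 0" "x \<noteq> 1" using that K01 by auto
      then show ?thesis by auto
    qed
    ultimately have "l v1 \<in> {0<..<1}" "l v2 \<in> {0<..<1}" using lK by blast+
    then have "\<bar>l v1 - l v2\<bar> < 1" by auto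
    then have "2 * pi * \<bar>l v1 - l v2\<bar> < 2 * pi * 1" by (intro mult_strict_left_mono) auto
    then show "\<bar>\<theta> - \<theta>'\<bar> < 2 * pi"
      by (simp add: \<theta>_def \<theta>'_def abs_mult flip: right_diff_distrib)
    have "t \<noteq> 0" "t \<noteq> 1" using t(2) ePQ[of "l v1"] by (auto simp: P_def Q_def)
    then show "t \<in> {0<..<1}" using t(1) by auto
    have "s \<noteq> 0" "s \<noteq> 1" using s(2) ePQ[of "l v2"] by (auto simp: P_def Q_def start_eq finish_eq)
    then show "s \<in> {0<..<1}" using s(1) by auto
    show "circ (g 1) r \<theta> = g t" "circ (g 1) r \<theta>' = h s" using t s by (auto simp: e_def \<theta>_def \<theta>'_def Q_def)
    fix \<phi> assume "\<phi> \<in> open_segment \<theta> \<theta>'"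
    then obtain u where u: "0 < u" "u < 1" "\<phi> = (1 - u) * \<theta> + u * \<theta>'" unfolding in_segment by auto
    have "\<phi> = \<theta>0 + 2 * pi * l (v1 + u * (v2 - v1))"
      unfolding u(3) \<theta>_def \<theta>'_def l_def by (simp add: algebra_simps)
    moreover have "v1 + u * (v2 - v1) \<in> {v1<..<v2}"
    proof -
      have "u * (v2 - v1) < 1 * (v2 - v1)" using u v12 by (intro mult_strict_right_mono) auto
      moreover have "0 < u * (v2 - v1)" using u v12 by simp
      moreover have "v1 + w \<in> {v1<..<v2}" if "w < 1 * (v2 - v1)" "0 < w" for w using that by auto
      ultimately show ?thesis by blast
    qed
    ultimately show "circ (g 1) r \<phi> \<in> C" using inC[of "v1 + u * (v2 - v1)"] by (simp add: e_def Q_def)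
  qed
qed

text \<open>The circle arc from \<open>g t\<close> to \<open>h s\<close> separates \<open>C\<close>; \<open>C1\<close> is the side of the common end point \<open>g 1\<close>.\<close>

definition crosscut :: "real \<Rightarrow> real \<Rightarrow> real \<Rightarrow> real \<Rightarrow> real \<Rightarrow> complex set \<Rightarrow> complex set \<Rightarrow> bool" where
  "crosscut r \<theta> \<theta>' t s C0 C1 \<longleftrightarrow> 0 < r \<and> \<bar>\<theta> - \<theta>'\<bar> < 2 * pi \<and> t \<in> {0<..<1} \<and> s \<in> {0<..<1} \<and>
     circ (g 1) r \<theta> = g t \<and> circ (g 1) r \<theta>' = h s \<and>
     (\<forall>\<phi> \<in> open_segment \<theta> \<theta>'. circ (g 1) r \<phi> \<in> C) \<and>
     open C0 \<and> open C1 \<and> C0 \<inter> C1 = {} \<and> C = C0 \<union> C1 \<union> circ (g 1) r ` open_segment \<theta> \<theta>' \<and>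
     C0 \<inter> circ (g 1) r ` open_segment \<theta> \<theta>' = {} \<and> g 1 \<notin> closure C0"

definition cut :: "real \<Rightarrow> real \<Rightarrow> real \<Rightarrow> real \<Rightarrow> complex" where
  "cut r \<theta> \<theta>' u = circ (g 1) r (\<theta> + u * (\<theta>' - \<theta>))"

lemma cut_segment: "cut r \<theta> \<theta>' ` {0<..<1} = circ (g 1) r ` open_segment \<theta> \<theta>'" if "\<theta> \<noteq> \<theta>'"
proof -
  show ?thesis unfolding segment_real_image(2)[OF that] by (simp add: cut_def image_image)
qed

lemma path_cut: "path (cut r \<theta> \<theta>')"
  unfolding path_def cut_def
  by (rule continuous_on_compose2[OF continuous_on_circ[of UNIV]]) (auto intro!: continuous_intros)

lemma arc_cut:
  assumes "r > 0" "\<bar>\<theta> - \<theta>'\<bar> < 2 * pi" "\<theta> \<noteq> \<theta>'"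
  shows "arc (cut r \<theta> \<theta>')"
  unfolding arc_def
proof (intro conjI path_cut inj_onI)
  fix u v :: real assume uv: "u \<in> {0..1}" "v \<in> {0..1}" "cut r \<theta> \<theta>' u = cut r \<theta> \<theta>' v"
  have "\<bar>(\<theta> + u * (\<theta>' - \<theta>)) - (\<theta> + v * (\<theta>' - \<theta>))\<bar> = \<bar>u - v\<bar> * \<bar>\<theta>' - \<theta>\<bar>"
    by (simp add: abs_mult flip: left_diff_distrib)
  also have "\<dots> \<le> 1 * \<bar>\<theta>' - \<theta>\<bar>" using uv by (intro mult_right_mono) auto
  also have "\<dots> < 2 * pi" using assms(2) by (simp add: abs_minus_commute)
  finally have "\<theta> + u * (\<theta>' - \<theta>) = \<theta> + v * (\<theta>' - \<theta>)"
    using circ_inj[OF assms(1)] uv(3) unfolding cut_def by blast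
  then show "u = v" using assms(3) by simp
qed

text \<open>The circle arc and the two parts into which its ends divide \<open>J\<close> form a
  theta curve, whose two smaller loops split \<open>C\<close>. The loop through \<open>g 1\<close>
  lies in a disc, and so does its inside; the other loop together with its inside is closed and
  omits \<open>g 1\<close>.\<close>

lemma exists_crosscut_small:
  assumes "0 < \<rho>"
  obtains r0 where "r0 > 0"
    "\<And>r. 0 < r \<Longrightarrow> r < r0 \<Longrightarrow> \<exists>\<theta> \<theta>' t s C0 C1. crosscut r \<theta> \<theta>' t s C0 C1 \<and>
       g ` {t..1} \<subseteq> ball (g 1) \<rho> \<and> h ` {s..1} \<subseteq> ball (g 1) \<rho> \<and> C1 \<subseteq> ball (g 1) \<rho>"
proof -
  define Q where "Q = g 1"
  \<comment> \<open>By injectivity the part of the arc with parameters away from 1 keeps a positive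
    distance from \<open>Q\<close>, so from a point close to \<open>Q\<close> on the arc remains
    close to \<open>Q\<close>.\<close>
  have near: "\<exists>m>0. \<forall>t\<in>{0..1}. dist Q (p t) < m \<longrightarrow> p ` {t..1} \<subseteq> ball Q \<rho>"
    if p: "continuous_on {0..1} p" "inj_on p {0..1}" "p 1 = Q" for p :: "real \<Rightarrow> complex"
  proof -
    obtain d where d: "d > 0" "\<And>t. t \<in> {0..1} \<Longrightarrow> dist t 1 < d \<Longrightarrow> dist (p t) (p 1) < \<rho>"
      using p(1) assms unfolding continuous_on_iff by (metis atLeastAtMost_iff order_refl zero_le_one)
    have cp: "compact (p ` {0..1 - d})"
      using d(1) by (intro compact_continuous_image continuous_on_subset[OF p(1)]) auto
    have "Q \<notin> p ` {0..1 - d}"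
    proof
      assume "Q \<in> p ` {0..1 - d}"
      then obtain x where x: "x \<in> {0..1-d}" "p x = p 1" using p(3) by auto
      then have "x = 1" using d(1) by (intro inj_onD[OF p(2)]) auto
      then show False using x d(1) by simp
    qed
    then obtain m where m: "m > 0" "ball Q m \<subseteq> - p ` {0..1 - d}"
      using cp openE[of "- p ` {0..1 - d}" Q] by (auto simp: compact_imp_closed open_Compl)
    have "p ` {t..1} \<subseteq> ball Q \<rho>" if t: "t \<in> {0..1}" "dist Q (p t) < m" for t
    proof -
      have "\<not> t \<le> 1 - d" using m(2) t by auto
      then show ?thesis using d(2) p(3) t by (auto simp: dist_real_def dist_commute)
    qed
    then show ?thesis using m(1) by blast
  qed
  obtain m1 where m1: "m1 > 0" "\<And>t. t \<in> {0..1} \<Longrightarrow> dist Q (g t) < m1 \<Longrightarrow> g ` {t..1} \<subseteq> ball Q \<rho>"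
    using near[OF continuous_g inj_g] Q_def by blast
  obtain m2 where m2: "m2 > 0" "\<And>t. t \<in> {0..1} \<Longrightarrow> dist Q (h t) < m2 \<Longrightarrow> h ` {t..1} \<subseteq> ball Q \<rho>"
    using near[OF continuous_h inj_h] Q_def finish_eq by blast
  define r0 where "r0 = min (min m1 m2) (min \<rho> (dist (g 0) (g 1)))"
  have r0: "r0 > 0" using m1 m2 assms start_neq_finish by (auto simp: r0_def)
  have "\<exists>\<theta> \<theta>' t s C0 C1. crosscut r \<theta> \<theta>' t s C0 C1 \<and>
       g ` {t..1} \<subseteq> ball (g 1) \<rho> \<and> h ` {s..1} \<subseteq> ball (g 1) \<rho> \<and> C1 \<subseteq> ball (g 1) \<rho>"
    if r: "0 < r" "r < r0" for r
  proof -
    have rd: "r < dist (g 0) (g 1)" "r < m1" "r < m2" "r < \<rho>" using r by (auto simp: r0_def)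
    obtain \<theta> \<theta>' t s where a: "\<bar>\<theta> - \<theta>'\<bar> < 2 * pi" "t \<in> {0<..<1}" "s \<in> {0<..<1}"
      "circ (g 1) r \<theta> = g t" "circ (g 1) r \<theta>' = h s" "\<And>\<phi>. \<phi> \<in> open_segment \<theta> \<theta>' \<Longrightarrow> circ (g 1) r \<phi> \<in> C"
      using exists_arc_on_circle[OF r(1) rd(1)] by metis
    have gJ: "g t \<notin> path_image h" and hJ: "h s \<notin> path_image g"
    proof -
      show "g t \<notin> path_image h"
      proof
        assume "g t \<in> path_image h"
        then have "g t \<in> {g 0, g 1}" using meet g_in[of t] a(2) by auto
        then have "t = 0 \<or> t = 1" using a(2) inj_onD[OF inj_g, of t 0] inj_onD[OF inj_g, of t 1] by auto
        then show False using a(2) by auto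
      qed
      show "h s \<notin> path_image g"
      proof
        assume "h s \<in> path_image g"
        then have "h s \<in> {h 0, h 1}" using meet h_in[of s] a(3) start_eq finish_eq by auto
        then have "s = 0 \<or> s = 1" using a(3) inj_onD[OF inj_h, of s 0] inj_onD[OF inj_h, of s 1] by auto
        then show False using a(3) by auto
      qed
    qed
    have ne: "\<theta> \<noteq> \<theta>'" using a(4,5) gJ h_in[of s] a(3) by auto
    define c where "c = cut r \<theta> \<theta>'"
    have arcc: "arc c" unfolding c_def by (rule arc_cut[OF r(1) a(1) ne])
    have c01: "pathstart c = g t" "pathfinish c = h s"
      using a(4,5) by (auto simp: c_def cut_def pathstart_def pathfinish_def)
    have cim: "path_image c = insert (g t) (insert (h s) (circ (g 1) r ` open_segment \<theta> \<theta>'))"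
    proof -
      have "{0..1::real} = insert 0 (insert 1 {0<..<1})" by auto
      then show ?thesis unfolding path_image_def c_def
        using cut_segment[OF ne, of r] a(4,5) by (simp add: cut_def)
    qed
    have oc: "circ (g 1) r ` open_segment \<theta> \<theta>' \<subseteq> C" using a(6) by auto
    \<comment> \<open>Both run from \<open>g t\<close> to \<open>h s\<close>, \<open>c1\<close>
      through \<open>g 1\<close> and \<open>c2\<close> through \<open>g 0\<close>.\<close>
    define c1 where "c1 = subpath t 1 g +++ subpath 1 s h"
    define c2 where "c2 = subpath t 0 g +++ subpath 0 s h"
    have im: "path_image c1 = g ` {t..1} \<union> h ` {s..1}" "path_image c2 = g ` {0..t} \<union> h ` {0..s}"
      unfolding c1_def c2_def using a(2,3) start_eq finish_eq
      by (auto simp: path_image_join path_image_subpath_gen closed_segment_eq_real_ivl)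
    have gh: "g ` {0..1} \<inter> h ` {0..1} = {g 0, g 1}" using meet by (simp add: path_image_def)
    have arcs: "arc (subpath u v g)" "arc (subpath u v h)" if "u \<in> {0..1}" "v \<in> {0..1}" "u \<noteq> v" for u v
      using arc_subpath_arc[OF arc_g that] arc_subpath_arc[OF arc_h that] by auto
    have g1t: "g 1 \<notin> g ` {0..t}" "g 0 \<notin> g ` {t..1}"
      using a(2) by (auto dest!: inj_onD[OF inj_g])
    have h1t: "h 1 \<notin> h ` {0..s}" "h 0 \<notin> h ` {s..1}"
      using a(3) by (auto dest!: inj_onD[OF inj_h])
    have sub: "g ` {t..1} \<subseteq> g ` {0..1}" "h ` {s..1} \<subseteq> h ` {0..1}" "g ` {0..t} \<subseteq> g ` {0..1}" "h ` {0..s} \<subseteq> h ` {0..1}"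
      using a(2,3) by auto
    have arc1: "arc c1" unfolding c1_def
    proof (rule arc_join)
      have "g ` {t..1} \<inter> h ` {s..1} \<subseteq> {g 1}" by (rule Int_subset_singleton[OF sub(1,2) gh g1t(2)])
      then show "path_image (subpath t 1 g) \<inter> path_image (subpath 1 s h) \<subseteq> {pathstart (subpath 1 s h)}"
        using a(2,3) finish_eq by (simp add: path_image_subpath_gen closed_segment_eq_real_ivl)
    qed (use a(2,3) finish_eq arcs in auto)
    have arc2: "arc c2" unfolding c2_def
    proof (rule arc_join)
      have "g ` {0..t} \<inter> h ` {0..s} \<subseteq> {g 0}"
        by (rule Int_subset_singleton[OF sub(3,4) gh[unfolded insert_commute[of "g 0"]] g1t(1)])
      then show "path_image (subpath t 0 g) \<inter> path_image (subpath 0 s h) \<subseteq> {pathstart (subpath 0 s h)}"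
        using a(2,3) start_eq by (simp add: path_image_subpath_gen closed_segment_eq_real_ivl)
    qed (use a(2,3) start_eq arcs in auto)
    have gg: "g ` {t..1} \<inter> g ` {0..t} = {g t}" and hh: "h ` {s..1} \<inter> h ` {0..s} = {h s}"
      using a(2,3) by (auto dest!: inj_onD[OF inj_g] inj_onD[OF inj_h])
    have un: "path_image c1 \<union> path_image c2 = J"
    proof -
      have e: "g ` {t..1} \<union> g ` {0..t} = g ` {0..1}" "h ` {s..1} \<union> h ` {0..s} = h ` {0..1}"
        using a(2,3) by (auto simp flip: image_Un)
      have "path_image c1 \<union> path_image c2 = (g ` {t..1} \<union> g ` {0..t}) \<union> (h ` {s..1} \<union> h ` {0..s})"
        unfolding im by (simp only: Un_ac)
      then show ?thesis unfolding e by (simp add: J_def path_image_def)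
    qed
    have i12: "path_image c1 \<inter> path_image c2 = {g t, h s}"
    proof -
      have 1: "g ` {t..1} \<inter> h ` {0..s} = {}"
        by (rule Int_eq_empty[OF sub(1,4) gh g1t(2)]) (use h1t finish_eq in simp)
      have 2: "g ` {0..t} \<inter> h ` {s..1} = {}"
        by (rule Int_eq_empty[OF sub(3,2) gh[unfolded insert_commute[of "g 0"]] g1t(1)]) (use h1t start_eq in simp)
      show ?thesis unfolding im by (rule Un_Int_Un_eq_pair[OF gg hh 1 2])
    qed
    have i1c: "path_image c1 \<inter> path_image c = {g t, h s}" "path_image c2 \<inter> path_image c = {g t, h s}"
      unfolding cim by (rule Int_insert_pair[OF i12 un oc C_J], rule Int_insert_pair[OF i12[unfolded Int_commute[of "path_image c1"]] un[unfolded Un_commute[of "path_image c1"]] oc C_J])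
    have ne12: "path_image c \<inter> inside (path_image c1 \<union> path_image c2) \<noteq> {}"
    proof -
      have "open_segment \<theta> \<theta>' \<noteq> {}" using ne by (simp add: open_segment_eq_empty)
      then show ?thesis unfolding un C_def[symmetric] cim using oc by blast
    qed
    have gtne: "g t \<noteq> h s" using gJ h_in[of s] a(3) by auto
    define C0 C1 where "C0 = inside (path_image c2 \<union> path_image c)" and "C1 = inside (path_image c1 \<union> path_image c)"
    have spl: "C1 \<inter> C0 = {}" "C1 \<union> C0 \<union> (path_image c - {g t, h s}) = C"
      using split_inside_simple_closed_curve[OF arc_imp_simple_path[OF arc1] _ _ arc_imp_simple_path[OF arc2] _ _
          arc_imp_simple_path[OF arcc] c01 gtne i12 i1c ne12]
      unfolding C0_def C1_def un C_def[symmetric]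
      by (auto simp: c1_def c2_def)
    have cim': "path_image c - {g t, h s} = circ (g 1) r ` open_segment \<theta> \<theta>'"
    proof -
      have "g t \<in> J" "h s \<in> J" using a(2,3) g_in h_in by (auto simp: J_def)
      then show ?thesis unfolding cim using oc C_J by blast
    qed
    have cl: "closed (path_image c2 \<union> path_image c)" "closed (path_image c1 \<union> path_image c)"
      using arc1 arc2 arcc by (auto intro!: closed_Un closed_path_image arc_imp_path)
    have op: "open C0" "open C1"
      unfolding C0_def C1_def by (rule open_inside[OF cl(1)], rule open_inside[OF cl(2)])
    have clo: "closure C0 \<subseteq> path_image c2 \<union> path_image c \<union> C0"
      unfolding C0_def by (rule closure_inside_subset[OF cl(1)])
    have "g 1 \<notin> closure C0"
    proof
      assume "g 1 \<in> closure C0"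
      moreover have "g 1 \<in> J" by (simp add: J_def g_in)
      then have "g 1 \<notin> C0" using spl C_J by blast
      moreover have "g 1 \<notin> path_image c"
      proof
        assume "g 1 \<in> path_image c"
        then obtain u where "g 1 = circ (g 1) r (\<theta> + u * (\<theta>' - \<theta>))" by (auto simp: path_image_def c_def cut_def)
        then show False using dist_circ[of r "g 1"] r(1) by (metis dist_self less_imp_le less_irrefl)
      qed
      moreover have "g 1 \<notin> path_image c2" unfolding im using g1t h1t finish_eq by auto
      ultimately show False using clo by blast
    qed
    moreover have "C0 \<inter> circ (g 1) r ` open_segment \<theta> \<theta>' = {}"
      using inside_no_overlap[of "path_image c2 \<union> path_image c"] unfolding C0_def cim by blast
    ultimately have cc: "crosscut r \<theta> \<theta>' t s C0 C1"
      unfolding crosscut_def using r(1) a op spl unfolding cim' by blast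
    have "dist Q (g t) = r" "dist Q (h s) = r"
      using dist_circ[of r Q] r(1) a(4,5) unfolding Q_def by (metis less_imp_le)+
    then have b1: "g ` {t..1} \<subseteq> ball (g 1) \<rho>" "h ` {s..1} \<subseteq> ball (g 1) \<rho>"
      using m1(2)[of t] m2(2)[of s] a(2,3) rd by (auto simp: Q_def)
    have "path_image c \<subseteq> ball (g 1) \<rho>"
      using dist_circ[of r "g 1"] r(1) rd(4) by (auto simp: path_image_def c_def cut_def)
    then have "path_image c1 \<union> path_image c \<subseteq> ball (g 1) \<rho>" using b1 unfolding im by blast
    from outside_subset_convex[OF convex_ball this]
    have "C1 \<subseteq> ball (g 1) \<rho>" unfolding C1_def
      using inside_Int_outside[of "path_image c1 \<union> path_image c"] by blast
    then show ?thesis using cc b1 by blast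
  qed
  then show ?thesis using that r0 by blast
qed

end

section \<open>Injective Abel functions\<close>

lemma crossing_cong:
  assumes "\<And>t. t \<in> {0..1} \<Longrightarrow> q t = q' t"
  shows "crossing p q = crossing p q'"
proof -
  have "winding_number q z = winding_number q' z" for z
    by (rule winding_number_cong) (use assms in auto)
  then show ?thesis using assms[of 0] assms[of 1] by (simp add: crossing_def)
qed

lemma open_imp_fsigma:
  fixes S :: "complex set"
  assumes "open S"
  shows "fsigma S"
proof -
  obtain K :: "nat \<Rightarrow> complex set" where K: "\<And>n. compact (K n)" "\<Union>(range K) = S"
    using open_Union_compact_subsets[OF assms] by metis
  then have "range K \<subseteq> Collect compact" by auto
  then show ?thesis using K(2) fsigma_Union_compact by blast
qed

text \<open>The arcs \<open>g\<close> and \<open>h\<close> are an initial curve and its image under \<open>F\<close>, parametrised over the closed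
  unit interval and including the two fixed points as end points.\<close>

locale tile = two_arcs +
  fixes \<alpha> F :: "complex \<Rightarrow> complex"
  assumes F_analytic: "F analytic_on g ` {0<..<1}"
    and F_g: "\<And>u. u \<in> {0<..<1} \<Longrightarrow> F (g u) = h u"
    and \<alpha>_analytic: "\<alpha> analytic_on g ` {0<..<1} \<union> C \<union> h ` {0<..<1}"
    and \<alpha>_inj: "inj_on \<alpha> (g ` {0<..<1} \<union> C \<union> h ` {0<..<1})"
    and \<alpha>_h: "\<And>u. u \<in> {0<..<1} \<Longrightarrow> \<alpha> (h u) = \<alpha> (g u) + 1"
begin

definition "H = g ` {0<..<1} \<union> C \<union> h ` {0<..<1}"

lemma \<alpha>_injD: "x \<in> H \<Longrightarrow> y \<in> H \<Longrightarrow> \<alpha> x = \<alpha> y \<Longrightarrow> x = y"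
  using inj_onD[OF \<alpha>_inj] unfolding H_def by blast

lemma in_H: "u \<in> {0<..<1} \<Longrightarrow> g u \<in> H" "u \<in> {0<..<1} \<Longrightarrow> h u \<in> H" "x \<in> C \<Longrightarrow> x \<in> H"
  by (auto simp: H_def)

lemma in_J: "u \<in> {0..1} \<Longrightarrow> g u \<in> J" "u \<in> {0..1} \<Longrightarrow> h u \<in> J"
  by (auto simp: J_def path_image_def)

lemma not_in_C: "u \<in> {0..1} \<Longrightarrow> g u \<notin> C" "u \<in> {0..1} \<Longrightarrow> h u \<notin> C"
  using in_J C_J by blast+

lemma g_neq_h: "u \<in> {0<..<1} \<Longrightarrow> g u \<notin> path_image h"
proof
  assume u: "u \<in> {0<..<1}" "g u \<in> path_image h"
  then have "g u \<in> {g 0, g 1}" using meet g_in[of u] by auto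
  then show False using u(1) inj_onD[OF inj_g, of u 0] inj_onD[OF inj_g, of u 1] by auto
qed

lemma h_neq_g: "u \<in> {0<..<1} \<Longrightarrow> h u \<notin> path_image g"
proof
  assume u: "u \<in> {0<..<1}" "h u \<in> path_image g"
  then have "h u \<in> {h 0, h 1}" using meet h_in[of u] start_eq finish_eq by auto
  then show False using u(1) inj_onD[OF inj_h, of u 0] inj_onD[OF inj_h, of u 1] by auto
qed

lemma gh_neq: "u \<in> {0<..<1} \<Longrightarrow> v \<in> {0<..<1} \<Longrightarrow> g u \<noteq> h v"
  using g_neq_h[of u] h_in[of v] by auto

lemma \<alpha>_C_neq:
  assumes "x \<in> C" "u \<in> {0<..<1}"
  shows "\<alpha> x \<noteq> \<alpha> (g u)" "\<alpha> x \<noteq> \<alpha> (g u) + 1"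
proof -
  have u: "u \<in> {0..1}" using assms(2) by auto
  show "\<alpha> x \<noteq> \<alpha> (g u)" using \<alpha>_injD[OF in_H(3)[OF assms(1)] in_H(1)[OF assms(2)]] not_in_C(1)[OF u] assms(1) by auto
  show "\<alpha> x \<noteq> \<alpha> (g u) + 1"
    using \<alpha>_injD[OF in_H(3)[OF assms(1)] in_H(2)[OF assms(2)]] not_in_C(2)[OF u] assms(1) \<alpha>_h[OF assms(2)] by auto
qed

lemma \<alpha>_g_no_chord: "u \<in> {0<..<1} \<Longrightarrow> v \<in> {0<..<1} \<Longrightarrow> \<alpha> (g v) \<noteq> \<alpha> (g u) + 1"
  using \<alpha>_injD[OF in_H(1)[of v] in_H(2)[of u]] gh_neq[of v u] \<alpha>_h[of u] by auto

lemma \<alpha>_g_inj: "u \<in> {0<..<1} \<Longrightarrow> v \<in> {0<..<1} \<Longrightarrow> \<alpha> (g v) = \<alpha> (g u) \<Longrightarrow> v = u"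
  using \<alpha>_injD[OF in_H(1)[of v] in_H(1)[of u]] inj_onD[OF inj_g, of v u] by auto

section \<open>Local properties of \<open>\<alpha>\<close> and \<open>F\<close> along the
  curve\<close>

lemma \<alpha>_holomorphic:
  obtains S where "open S" "H \<subseteq> S" "\<alpha> holomorphic_on S"
  using \<alpha>_analytic unfolding analytic_on_holomorphic H_def by blast

lemma \<alpha>_holomorphic_C: "\<alpha> holomorphic_on C"
proof -
  obtain S where "open S" "H \<subseteq> S" "\<alpha> holomorphic_on S" by (rule \<alpha>_holomorphic)
  then show ?thesis using holomorphic_on_subset in_H(3) by blast
qed

lemma \<alpha>_inj_C: "inj_on \<alpha> C"
  using \<alpha>_inj by (rule inj_on_subset) auto

lemma \<alpha>_continuous: "continuous_on H \<alpha>"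
proof -
  obtain S where "open S" "H \<subseteq> S" "\<alpha> holomorphic_on S" by (rule \<alpha>_holomorphic)
  then show ?thesis using holomorphic_on_imp_continuous_on continuous_on_subset by blast
qed

lemma open_\<alpha>_image: "open X \<Longrightarrow> X \<subseteq> C \<Longrightarrow> open (\<alpha> ` X)"
  using open_mapping_thm3 \<alpha>_holomorphic_C \<alpha>_inj_C holomorphic_on_subset inj_on_subset by metis

lemma continuous_\<alpha>_g: "continuous_on {0<..<1} (\<lambda>u. \<alpha> (g u))"
  by (rule continuous_on_compose2[OF \<alpha>_continuous continuous_on_subset[OF continuous_g]]) (auto simp: in_H)

lemma islimpt_g:
  assumes "u \<in> {0<..<1}" "e > 0"
  shows "g u islimpt g ` ({0<..<1} \<inter> {v. dist v u < e})"
  unfolding islimpt_approachable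
proof (intro allI impI)
  fix d :: real assume "d > 0"
  obtain d' where d': "d' > 0" "\<And>v. v \<in> {0..1} \<Longrightarrow> dist v u < d' \<Longrightarrow> dist (g v) (g u) < d"
    using continuous_g assms(1) \<open>d > 0\<close> unfolding continuous_on_iff
    by (metis greaterThanLessThan_subseteq_atLeastAtMost_iff order_refl subsetD)
  define v where "v = u + min (min (d' / 2) (e / 2)) ((1 - u) / 2)"
  have v: "v \<in> {0<..<1}" "dist v u < d'" "dist v u < e" "v \<noteq> u"
    using assms d'(1) by (auto simp: v_def dist_real_def min_def field_simps)
  have "g v \<noteq> g u" using inj_onD[OF inj_g, of v u] v assms(1) by auto
  moreover have "dist (g v) (g u) < d" using d'(2)[of v] v by auto
  ultimately show "\<exists>x'\<in>g ` ({0<..<1} \<inter> {v. dist v u < e}). x' \<noteq> g u \<and> dist x' (g u) < d"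
    using v by blast
qed

text \<open>The Abel equation is given along \<open>g\<close> only and spreads to a disc by the
  identity theorem, since \<open>g u\<close> is a limit of points of \<open>g\<close>. In particular
  it reaches the outer side, where \<open>\<alpha>\<close> is just a holomorphic extension.\<close>

lemma \<alpha>_F:
  assumes u: "u \<in> {0<..<1}" and "\<epsilon> > 0"
  obtains e where "e > 0" "e \<le> \<epsilon>" "\<alpha> holomorphic_on ball (g u) e" "F holomorphic_on ball (g u) e"
    "F ` ball (g u) e \<subseteq> ball (h u) \<epsilon>" "\<alpha> holomorphic_on F ` ball (g u) e"
    "\<And>x. x \<in> ball (g u) e \<Longrightarrow> \<alpha> (F x) = \<alpha> x + 1"
proof -
  obtain S where S: "open S" "H \<subseteq> S" "\<alpha> holomorphic_on S" by (rule \<alpha>_holomorphic)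
  obtain T where T: "open T" "g ` {0<..<1} \<subseteq> T" "F holomorphic_on T"
    using F_analytic unfolding analytic_on_holomorphic by blast
  have "open (T \<inter> F -` (S \<inter> ball (h u) \<epsilon>))"
    by (intro continuous_open_preimage holomorphic_on_imp_continuous_on T open_Int S open_ball)
  then have "open (S \<inter> (T \<inter> F -` (S \<inter> ball (h u) \<epsilon>)))" using S(1) by blast
  moreover have "g u \<in> S \<inter> (T \<inter> F -` (S \<inter> ball (h u) \<epsilon>))"
    using u S(2) T(2) in_H F_g[OF u] assms(2) by auto
  ultimately obtain e' where e': "e' > 0" "ball (g u) e' \<subseteq> S \<inter> (T \<inter> F -` (S \<inter> ball (h u) \<epsilon>))"
    using openE by metis
  define e where "e = min e' \<epsilon>"
  have e: "e > 0" "e \<le> \<epsilon>" "ball (g u) e \<subseteq> S \<inter> (T \<inter> F -` (S \<inter> ball (h u) \<epsilon>))"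
    using e' assms(2) subset_ball[of e e' "g u"] by (auto simp: e_def)
  have hol: "\<alpha> holomorphic_on ball (g u) e" "F holomorphic_on ball (g u) e" "\<alpha> holomorphic_on F ` ball (g u) e"
    using e(3) S(3) T(3) by (auto intro: holomorphic_on_subset)
  have "\<alpha> (F x) = \<alpha> x + 1" if x: "x \<in> ball (g u) e" for x
  proof -
    obtain d where d: "d > 0" "\<And>v. v \<in> {0..1} \<Longrightarrow> dist v u < d \<Longrightarrow> dist (g v) (g u) < e"
      using continuous_g u e(1) unfolding continuous_on_iff
      by (metis greaterThanLessThan_subseteq_atLeastAtMost_iff order_refl subsetD)
    have "(\<lambda>x. \<alpha> (F x) - (\<alpha> x + 1)) holomorphic_on ball (g u) e"
      using holomorphic_on_compose[OF hol(2,3)] hol(1) by (intro holomorphic_intros) (simp_all add: o_def)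
    then have "\<alpha> (F x) - (\<alpha> x + 1) = 0"
    proof (rule analytic_continuation[OF _ open_ball connected_ball _ _ islimpt_g[OF u d(1)] _ x])
      show "g ` ({0<..<1} \<inter> {v. dist v u < d}) \<subseteq> ball (g u) e"
        using d(2) by (auto simp: dist_commute)
      show "\<alpha> (F z) - (\<alpha> z + 1) = 0" if "z \<in> g ` ({0<..<1} \<inter> {v. dist v u < d})" for z
        using that F_g \<alpha>_h by auto
    qed (use e(1) in auto)
    then show ?thesis by simp
  qed
  with that e hol show ?thesis by blast
qed

lemma connected_H: "connected H"
proof (rule connected_intermediate_closure[OF connected_C])
  show "C \<subseteq> H" by (auto simp: H_def)
  show "H \<subseteq> closure C" unfolding closure_C H_def using in_J by force
qed

lemma \<alpha>_holomorphic_connected: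
  obtains S where "open S" "connected S" "H \<subseteq> S" "\<alpha> holomorphic_on S"
proof -
  obtain S where S: "open S" "H \<subseteq> S" "\<alpha> holomorphic_on S" by (rule \<alpha>_holomorphic)
  obtain x0 where x0: "x0 \<in> C" using C_ne by blast
  show ?thesis
  proof (rule that)
    show "open (connected_component_set S x0)" by (rule open_connected_component[OF S(1)])
    show "connected (connected_component_set S x0)" by (rule connected_connected_component)
    show "H \<subseteq> connected_component_set S x0"
      by (rule connected_component_maximal[OF in_H(3)[OF x0] connected_H S(2)])
    show "\<alpha> holomorphic_on connected_component_set S x0"
      by (rule holomorphic_on_subset[OF S(3) connected_component_subset])
  qed
qed

text \<open>Injectivity on \<open>H\<close> gives no information on the outer side of
  \<open>g\<close>, so \<open>deriv \<alpha>\<close> may vanish on \<open>g\<close>, for instance at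
  a corner. Its zeros are countable because it does not vanish identically on a connected
  neighbourhood of \<open>H\<close>.\<close>

lemma countable_bad: "countable {u \<in> {0<..<1}. deriv \<alpha> (g u) = 0}"
proof -
  obtain S' where S': "open S'" "connected S'" "H \<subseteq> S'" and hol: "\<alpha> holomorphic_on S'"
    by (rule \<alpha>_holomorphic_connected)
  have hol': "deriv \<alpha> holomorphic_on S'" using holomorphic_deriv[OF hol S'(1)] .
  have nz: "\<not> (\<forall>z\<in>S'. deriv \<alpha> z = 0)"
  proof
    assume z: "\<forall>z\<in>S'. deriv \<alpha> z = 0"
    have dz: "(\<alpha> has_field_derivative 0) (at x)" if "x \<in> S'" for x
      using holomorphic_derivI[OF hol S'(1) that] z that by simp
    obtain c where "\<And>x. x \<in> S' \<Longrightarrow> \<alpha> x = c"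
      by (rule DERIV_zero_connected_constant[of S' "{}" \<alpha>])
        (use S' dz holomorphic_on_imp_continuous_on[OF hol] in auto)
    then obtain c where "\<And>x. x \<in> H \<Longrightarrow> \<alpha> x = c" using S'(3) by blast
    then have "g (1/2) = g (1/3)" using \<alpha>_injD[of "g (1/2)" "g (1/3)"] in_H(1)[of "1/2"] in_H(1)[of "1/3"] by simp
    then show False using inj_onD[OF inj_g, of "1/2" "1/3"] by simp
  qed
  have "countable {z \<in> S'. deriv \<alpha> z = 0}"
  proof (cases "deriv \<alpha> constant_on S'")
    case True
    then have "{z \<in> S'. deriv \<alpha> z = 0} = {}" using nz unfolding constant_on_def by force
    then show ?thesis by (metis countable_empty)
  next
    case False
    then show ?thesis
      by (intro holomorphic_countable_zeros hol' S' open_imp_fsigma)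
  qed
  moreover have "g ` {u \<in> {0<..<1}. deriv \<alpha> (g u) = 0} \<subseteq> {z \<in> S'. deriv \<alpha> z = 0}"
    using S'(3) in_H by auto
  ultimately have "countable (g ` {u \<in> {0<..<1}. deriv \<alpha> (g u) = 0})" by (rule countable_subset[rotated])
  then show ?thesis by (rule countable_image_inj_on) (use inj_g in \<open>auto simp: inj_on_def\<close>)
qed

lemma exists_good: "\<exists>u \<in> {0<..<1}. deriv \<alpha> (g u) \<noteq> 0"
proof (rule ccontr)
  assume "\<not> ?thesis"
  then have "{u \<in> {0<..<1}. deriv \<alpha> (g u) = 0} = {0<..<1::real}" by auto
  then show False using countable_bad uncountable_open_interval[of 0 1] by simp
qed

text \<open>Across \<open>g\<close> and across \<open>h\<close>, traversed from \<open>g 0\<close> to \<open>g 1\<close>, the index of the Jordan curve jumps in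
  opposite directions. As \<open>F\<close> preserves crossings, it maps the inner side of \<open>g\<close> to the outer side of \<open>h\<close>.\<close>

lemma good_point:
  assumes u: "u \<in> {0<..<1}" and good: "deriv \<alpha> (g u) \<noteq> 0"
  obtains u1 u2 e where "0 < u1" "u1 < u" "u < u2" "u2 < 1" "e > 0"
    "\<alpha> holomorphic_on ball (g u) e" "inj_on \<alpha> (ball (g u) e)" "F holomorphic_on ball (g u) e"
    "\<And>x. x \<in> ball (g u) e \<Longrightarrow> \<alpha> (F x) = \<alpha> x + 1"
    "\<And>x. x \<in> ball (g u) e \<Longrightarrow> x \<in> J \<Longrightarrow> x \<in> g ` {u1<..<u2}"
    "\<And>x. x \<in> ball (g u) e \<Longrightarrow> x \<in> C \<Longrightarrow> F x \<notin> C"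
    "\<And>x. x \<in> ball (g u) e \<Longrightarrow> x \<notin> C \<Longrightarrow> x \<notin> J \<Longrightarrow> F x \<in> C"
    "\<And>x y. x \<in> ball (g u) e \<Longrightarrow> y \<in> ball (g u) e \<Longrightarrow> x \<notin> C \<Longrightarrow> x \<notin> J \<Longrightarrow> y \<in> C \<Longrightarrow>
        crossing (\<alpha> \<circ> linepath x y) (\<alpha> \<circ> subpath u1 u2 g) \<noteq> 0"
proof -
  obtain e0 where e0: "e0 > 0" "\<alpha> holomorphic_on ball (g u) e0" "F holomorphic_on ball (g u) e0"
     "\<alpha> holomorphic_on F ` ball (g u) e0" "\<And>x. x \<in> ball (g u) e0 \<Longrightarrow> \<alpha> (F x) = \<alpha> x + 1"
    using \<alpha>_F[OF u, of 1] by (metis zero_less_one)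
  have gb: "g u \<in> ball (g u) e0" using e0(1) by simp
  \<comment> \<open>By differentiating the Abel equation: a zero of \<open>deriv F\<close> at
    \<open>g u\<close> would be a zero of \<open>deriv \<alpha>\<close>.\<close>
  have F': "deriv F (g u) \<noteq> 0"
  proof
    assume z: "deriv F (g u) = 0"
    obtain S where S: "open S" "H \<subseteq> S" "\<alpha> holomorphic_on S" by (rule \<alpha>_holomorphic)
    have d1: "(F has_field_derivative 0) (at (g u))"
      using holomorphic_derivI[OF e0(3) open_ball gb] z by simp
    have d2: "(\<alpha> has_field_derivative deriv \<alpha> (F (g u))) (at (F (g u)))"
      by (rule holomorphic_derivI[OF S(3,1)]) (use S(2) in_H(2)[OF u] F_g[OF u] in auto)
    have "((\<lambda>x. \<alpha> (F x)) has_field_derivative 0) (at (g u))"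
      using DERIV_chain2[OF d2 d1] by simp
    moreover have "((\<lambda>x. \<alpha> x + 1) has_field_derivative deriv \<alpha> (g u) + 0) (at (g u))"
      by (intro DERIV_add DERIV_const holomorphic_derivI[OF e0(2) open_ball gb])
    then have "((\<lambda>x. \<alpha> x + 1) has_field_derivative deriv \<alpha> (g u)) (at (g u))" by simp
    then have "((\<lambda>x. \<alpha> (F x)) has_field_derivative deriv \<alpha> (g u)) (at (g u))"
      by (rule has_field_derivative_transform_within_open[OF _ open_ball gb]) (simp add: e0(5))
    ultimately show False using good DERIV_unique by blast
  qed
  obtain e1 where e1: "e1 > 0" "ball (g u) e1 \<subseteq> ball (g u) e0"
    "\<And>x y. x \<in> ball (g u) e1 \<Longrightarrow> y \<in> ball (g u) e1 \<Longrightarrow> x \<noteq> y \<Longrightarrow> 0 < Re ((F x - F y) / (deriv F (g u) * (x - y)))"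
    using holomorphic_quotient_pos[OF e0(3) open_ball gb F'] by metis
  obtain e2 where e2: "e2 > 0" "ball (g u) e2 \<subseteq> ball (g u) e0"
    "\<And>x y. x \<in> ball (g u) e2 \<Longrightarrow> y \<in> ball (g u) e2 \<Longrightarrow> x \<noteq> y \<Longrightarrow> 0 < Re ((\<alpha> x - \<alpha> y) / (deriv \<alpha> (g u) * (x - y)))"
    using holomorphic_quotient_pos[OF e0(2) open_ball gb good] by metis
  define N where "N = ball (g u) (min e1 e2)"
  have Nsub: "N \<subseteq> ball (g u) e1" "N \<subseteq> ball (g u) e2" "N \<subseteq> ball (g u) e0"
    using e1(2) by (auto simp: N_def)
  have injF: "x = y" if "x \<in> N" "y \<in> N" "F x = F y" for x y
    using e1(3)[of x y] that Nsub by force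
  have injA: "x = y" if "x \<in> N" "y \<in> N" "\<alpha> x = \<alpha> y" for x y
    using e2(3)[of x y] that Nsub by force
  have cF: "continuous_on N F" and cA: "continuous_on N \<alpha>"
    using e0(2,3) Nsub(3) by (meson holomorphic_on_imp_continuous_on continuous_on_subset)+
  obtain d where d: "d > 0" "\<And>v. v \<in> {0..1} \<Longrightarrow> dist v u < d \<Longrightarrow> dist (g v) (g u) < min e1 e2"
    using continuous_g u e1(1) e2(1) unfolding continuous_on_iff
    by (metis greaterThanLessThan_subseteq_atLeastAtMost_iff min_less_iff_conj order_refl subsetD)
  define m where "m = min (d / 2) (min (u / 2) ((1 - u) / 2))"
  define u1 u2 where "u1 = u - m" and "u2 = u + m"
  have m: "0 < m" "m < d" "m < u" "m < 1 - u" using d(1) u by (auto simp: m_def min_def field_simps)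
  have u12: "0 < u1" "u1 < u" "u < u2" "u2 < 1" using m by (auto simp: u1_def u2_def)
  have gN: "g v \<in> N" if "v \<in> {u1..u2}" for v
  proof -
    have "dist v u < d" "v \<in> {0..1}" using that m u12 by (auto simp: u1_def u2_def dist_real_def)
    then show ?thesis using d(2)[of v] by (simp add: N_def dist_commute)
  qed
  \<comment> \<open>The Jordan curve without a piece of \<open>g\<close>, respectively of
    \<open>h\<close>, near the parameter \<open>u\<close>. Keeping the disc off \<open>J1\<close>
    and its image off \<open>J2\<close> leaves a single arc that can be crossed.\<close>
  define J1 where "J1 = g ` {0..u1} \<union> g ` {u2..1} \<union> path_image h"
  define J2 where "J2 = h ` {0..u1} \<union> h ` {u2..1} \<union> path_image g"
  have cl: "closed (p ` {v..w})" if "path p" "0 \<le> v" "w \<le> 1" for p :: "real \<Rightarrow> complex" and v w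
    using that by (intro compact_imp_closed compact_continuous_image) (auto simp: path_def intro: continuous_on_subset)
  have clJ: "closed J1" "closed J2" unfolding J1_def J2_def
    using cl[OF path_g] cl[OF path_h] u12 path_g path_h by (auto intro!: closed_Un closed_path_image)
  have nJ1: "g u \<notin> J1"
    using g_neq_h[OF u] u12 inj_onD[OF inj_g, of u] by (force simp: J1_def)
  have nJ2: "h u \<notin> J2"
    using h_neq_g[OF u] u12 inj_onD[OF inj_h, of u] by (force simp: J2_def)
  have J1: "x \<in> g ` {u1<..<u2}" if "x \<in> J" "x \<notin> J1" for x
    using that u12 unfolding J_def J1_def path_image_def by force
  have J2: "x \<in> h ` {u1<..<u2}" if "x \<in> J" "x \<notin> J2" for x
    using that u12 unfolding J_def J2_def path_image_def by force
  have "open (N \<inter> F -` (- J2))"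
    by (rule continuous_open_preimage[OF cF]) (use clJ in \<open>auto simp: N_def\<close>)
  then have "open ((N \<inter> F -` (- J2)) \<inter> - J1)" using clJ by blast
  moreover have "g u \<in> (N \<inter> F -` (- J2)) \<inter> - J1"
    using nJ1 nJ2 F_g[OF u] e1(1) e2(1) by (simp add: N_def)
  ultimately obtain e where e: "e > 0" "ball (g u) e \<subseteq> (N \<inter> F -` (- J2)) \<inter> - J1"
    using openE by metis
  have B: "x \<in> N" "F x \<notin> J2" "x \<notin> J1" if "x \<in> ball (g u) e" for x using e(2) that by auto
  have FJ: "F x \<notin> J" if x: "x \<in> ball (g u) e" "x \<notin> J" for x
  proof
    assume "F x \<in> J"
    then have "F x \<in> h ` {u1<..<u2}" using J2[OF _ B(2)[OF x(1)]] by blast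
    then obtain v where v: "v \<in> {u1<..<u2}" "F x = h v" by blast
    then have "F x = F (g v)" using F_g[of v] u12 by auto
    then have "x = g v" using injF[OF B(1)[OF x(1)] gN[of v]] v by auto
    then show False using x(2) in_J(1)[of v] v u12 by auto
  qed
  obtain w where w: "w \<noteq> 0" "\<And>z. z \<in> C \<Longrightarrow> winding_number loop z = w"
    by (rule winding_number_inside) blast
  \<comment> \<open>From the outer point \<open>x\<close> to the inner point \<open>y\<close> the
    index of \<open>loop\<close> rises from 0 to \<open>w\<close>. Only \<open>g\<close> is crossed,
    which enters the index with a plus sign. Under \<open>F\<close> the same crossing number occurs
    with \<open>h\<close>, which enters with a minus sign.\<close>
  have crs: "crossing (linepath x y) (subpath u1 u2 g) = - w \<and> F y \<notin> C \<and> F x \<in> C \<and>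
       crossing (\<alpha> \<circ> linepath x y) (\<alpha> \<circ> subpath u1 u2 g) = - w"
    if xy: "x \<in> ball (g u) e" "y \<in> ball (g u) e" "x \<notin> C" "x \<notin> J" "y \<in> C" for x y
  proof -
    define k where "k = linepath x y"
    define s where "s = subpath u1 u2 g"
    have yJ: "y \<notin> J" using xy(5) C_J by blast
    have kim: "path_image k \<subseteq> ball (g u) e"
      unfolding k_def path_image_linepath using xy(1,2) by (intro closed_segment_subset) auto
    have pk: "path k" by (simp add: k_def)
    have k01: "k 0 = x" "k 1 = y" by (simp_all add: k_def linepath_def)
    have ps: "path s" unfolding s_def using path_g u12 by auto
    have sim: "path_image s = g ` {u1..u2}"
      unfolding s_def using u12 by (simp add: path_image_subpath_gen closed_segment_eq_real_ivl)
    have kN: "path_image k \<subseteq> N" and kJ1: "path_image k \<inter> J1 = {}" using kim B by auto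
    have sN: "path_image s \<subseteq> N" unfolding sim using gN by auto
    have s01: "s 0 = g u1" "s 1 = g u2" by (auto simp: s_def subpath_def)
    have sk: "s 0 \<notin> path_image k" "s 1 \<notin> path_image k"
      using kJ1 u12 unfolding s01 J1_def by auto
    have ks: "k 0 \<notin> path_image s" "k 1 \<notin> path_image s"
    proof -
      have "path_image s \<subseteq> J" unfolding sim using in_J(1) u12 by auto
      then show "k 0 \<notin> path_image s" "k 1 \<notin> path_image s" using xy(4) yJ unfolding k01 by auto
    qed
    have xyg: "x \<notin> path_image g" "y \<notin> path_image g" "x \<notin> path_image h" "y \<notin> path_image h"
      using xy(4) yJ by (auto simp: J_def)
    have 1: "winding_number g y - winding_number g x =
        winding_number k (g 1) - winding_number k (g 0) - crossing k s"
      using winding_number_jump[OF path_g pk, of u1 u2] u12 xyg kJ1 unfolding k01 s_def J1_def by auto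
    have 2: "winding_number h y - winding_number h x = winding_number k (g 1) - winding_number k (g 0)"
      using winding_number_exchange[OF path_h pk] kJ1 unfolding k01 J1_def start_eq finish_eq by auto
    have lx: "winding_number loop x = 0" using winding_number_outside[OF xy(3,4)] .
    have cr: "crossing k s = - w"
      using 1 2 lx w(2)[OF xy(5)] winding_number_loop[OF xy(4)] winding_number_loop[OF yJ] by algebra
    define Fk where "Fk = F \<circ> k"
    have pFk: "path Fk" unfolding Fk_def by (rule path_continuous_image[OF pk continuous_on_subset[OF cF kN]])
    have Fk01: "Fk 0 = F x" "Fk 1 = F y" by (auto simp: Fk_def k01)
    have FkJ2: "path_image Fk \<inter> J2 = {}" unfolding Fk_def path_image_compose using kim B by auto
    have cF1: "crossing Fk (F \<circ> s) = crossing k s"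
      unfolding Fk_def by (rule crossing_comp_local[OF pk ps kN sN sk ks cF]) (use e1(3) Nsub in blast)
    have cF2: "crossing Fk (F \<circ> s) = crossing Fk (subpath u1 u2 h)"
    proof (rule crossing_cong)
      fix t :: real assume t: "t \<in> {0..1}"
      have "(u2 - u1) * t + u1 \<in> {0<..<1}"
      proof -
        have "(u2 - u1) * t \<le> (u2 - u1) * 1" using t u12 by (intro mult_left_mono) auto
        moreover have "0 \<le> (u2 - u1) * t" using t u12 by auto
        moreover have "x + u1 \<in> {0<..<1}" if "x \<le> (u2 - u1) * 1" "0 \<le> x" for x using that u12 by auto
        ultimately show ?thesis by blast
      qed
      then show "(F \<circ> s) t = subpath u1 u2 h t" using F_g by (simp add: s_def subpath_def)
    qed
    have FxJ: "F x \<notin> J" "F y \<notin> J" using FJ xy yJ by auto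
    then have xyF: "F x \<notin> path_image g" "F y \<notin> path_image g" "F x \<notin> path_image h" "F y \<notin> path_image h"
      by (auto simp: J_def)
    have 3: "winding_number h (F y) - winding_number h (F x) =
        winding_number Fk (g 1) - winding_number Fk (g 0) - crossing Fk (subpath u1 u2 h)"
      using winding_number_jump[OF path_h pFk, of u1 u2] u12 xyF FkJ2 unfolding Fk01 J2_def start_eq finish_eq by auto
    have 4: "winding_number g (F y) - winding_number g (F x) = winding_number Fk (g 1) - winding_number Fk (g 0)"
      using winding_number_exchange[OF path_g pFk] FkJ2 unfolding Fk01 J2_def by auto
    have df: "winding_number loop (F y) - winding_number loop (F x) = - w"
      using 3 4 cr cF1 cF2 winding_number_loop[OF FxJ(1)] winding_number_loop[OF FxJ(2)] by algebra
    have vals: "winding_number loop z = w \<or> winding_number loop z = 0" if "z \<notin> J" for z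
      using w(2) winding_number_outside that by blast
    \<comment> \<open>The index takes only the values 0 and \<open>w\<close> and changes by
      \<open>- w\<close> from \<open>F x\<close> to \<open>F y\<close>, so it is \<open>w\<close> at
      \<open>F x\<close> and 0 at \<open>F y\<close>.\<close>
    have "F y \<notin> C"
    proof
      assume "F y \<in> C"
      then have "winding_number loop (F x) = 2 * w" using df w(2) by (simp add: algebra_simps)
      then show False using vals[OF FxJ(1)] w(1) by auto
    qed
    moreover from this have "winding_number loop (F y) = 0" using winding_number_outside FxJ by blast
    then have "winding_number loop (F x) = w" using df by simp
    then have "F x \<in> C" using winding_number_outside[OF _ FxJ(1)] w(1) by auto
    moreover have "crossing (\<alpha> \<circ> k) (\<alpha> \<circ> s) = crossing k s"
      by (rule crossing_comp_local[OF pk ps kN sN sk ks cA]) (use e2(3) Nsub in blast)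
    ultimately show ?thesis using cr unfolding k_def s_def by simp
  qed
  have guJ: "g u \<in> J" using in_J u by auto
  obtain i0 where i0: "i0 \<in> ball (g u) e" "i0 \<in> C"
    using guJ closure_C e(1) closure_approachable[of "g u" C] by (metis UnI2 dist_commute mem_ball)
  obtain o0 where o0: "o0 \<in> ball (g u) e" "o0 \<notin> C" "o0 \<notin> J"
  proof -
    have "g u \<in> closure (outside J)"
      using Jordan guJ unfolding frontier_def by blast
    then show ?thesis using that e(1) outside_iff by (metis closure_approachable dist_commute mem_ball)
  qed
  show ?thesis
  proof (rule that[OF u12 e(1)])
    have eb: "ball (g u) e \<subseteq> ball (g u) e0" using B(1) Nsub(3) by blast
    show "\<alpha> holomorphic_on ball (g u) e" "F holomorphic_on ball (g u) e"
      using e0(2,3) eb holomorphic_on_subset by blast+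
    show "inj_on \<alpha> (ball (g u) e)" using injA B(1) by (auto simp: inj_on_def)
    show "\<alpha> (F x) = \<alpha> x + 1" if "x \<in> ball (g u) e" for x using e0(5) eb that by blast
    show "x \<in> g ` {u1<..<u2}" if "x \<in> ball (g u) e" "x \<in> J" for x using J1 B that by blast
    show "F x \<notin> C" if "x \<in> ball (g u) e" "x \<in> C" for x using crs[OF o0(1) that(1) o0(2,3) that(2)] by blast
    show "F x \<in> C" if "x \<in> ball (g u) e" "x \<notin> C" "x \<notin> J" for x using crs[OF that(1) i0(1) that(2,3) i0(2)] by blast
    show "crossing (\<alpha> \<circ> linepath x y) (\<alpha> \<circ> subpath u1 u2 g) \<noteq> 0"
      if "x \<in> ball (g u) e" "y \<in> ball (g u) e" "x \<notin> C" "x \<notin> J" "y \<in> C" for x y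
      using crs[OF that] w(1) by simp
  qed
qed

section \<open>A loop that distinguishes the two ends of the curve\<close>

lemma path_connected_C: "path_connected C"
  using connected_C open_C connected_open_path_connected by blast

text \<open>If \<open>\<alpha>\<close> identifies \<open>z\<^sub>2\<close> with the translate of \<open>z\<^sub>1\<close> although both lie inside, then the two sides of the
  curve \<open>\<alpha> \<circ> g\<close> can be joined off this curve. The resulting loop crosses the curve once, so one of the
  two ends of the curve has a nonzero winding number.\<close>

lemma exists_winding_loop:
  assumes z: "z1 \<in> C" "z2 \<in> C" "\<alpha> z2 = \<alpha> z1 + 1"
  obtains p v1 v2 E1 E2 where "path p" "pathfinish p = pathstart p" "0 < v1" "v1 < v2" "v2 < 1"
    "compact E1" "E1 \<subseteq> C \<union> g ` {0<..<1}" "compact E2" "E2 \<subseteq> C \<union> h ` {0<..<1}"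
    "path_image p \<subseteq> \<alpha> ` E1 \<union> (\<lambda>x. \<alpha> x - 1) ` E2"
    "\<And>u. 0 < u \<Longrightarrow> u \<le> v1 \<Longrightarrow> \<alpha> (g u) \<notin> path_image p" "\<And>u. v2 \<le> u \<Longrightarrow> u < 1 \<Longrightarrow> \<alpha> (g u) \<notin> path_image p"
    "winding_number p (\<alpha> (g v2)) \<noteq> winding_number p (\<alpha> (g v1))"
proof -
  obtain u where u: "u \<in> {0<..<1}" and good: "deriv \<alpha> (g u) \<noteq> 0" using exists_good by blast
  obtain u1 u2 e where u12: "0 < u1" "u1 < u" "u < u2" "u2 < 1" and e: "e > 0"
    and hol: "\<alpha> holomorphic_on ball (g u) e" and inj: "inj_on \<alpha> (ball (g u) e)" and holF: "F holomorphic_on ball (g u) e"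
    and \<alpha>F: "\<And>x. x \<in> ball (g u) e \<Longrightarrow> \<alpha> (F x) = \<alpha> x + 1"
    and bJ: "\<And>x. x \<in> ball (g u) e \<Longrightarrow> x \<in> J \<Longrightarrow> x \<in> g ` {u1<..<u2}"
    and FC: "\<And>x. x \<in> ball (g u) e \<Longrightarrow> x \<in> C \<Longrightarrow> F x \<notin> C"
    and Fout: "\<And>x. x \<in> ball (g u) e \<Longrightarrow> x \<notin> C \<Longrightarrow> x \<notin> J \<Longrightarrow> F x \<in> C"
    and crs: "\<And>x y. x \<in> ball (g u) e \<Longrightarrow> y \<in> ball (g u) e \<Longrightarrow> x \<notin> C \<Longrightarrow> x \<notin> J \<Longrightarrow> y \<in> C \<Longrightarrow>
        crossing (\<alpha> \<circ> linepath x y) (\<alpha> \<circ> subpath u1 u2 g) \<noteq> 0"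
    using good_point[OF u good] by blast
  have guJ: "g u \<in> J" using in_J u by auto
  have "g u \<in> closure C" using guJ closure_C by blast
  then obtain i where i: "i \<in> C" "dist i (g u) < e" using e closure_approachable by blast
  have "g u \<in> closure (outside J)" using Jordan guJ unfolding frontier_def by blast
  then obtain x where x: "x \<in> outside J" "dist x (g u) < e" using e closure_approachable by blast
  have xC: "x \<notin> C" "x \<notin> J" using x(1) outside_iff by auto
  have xi: "x \<in> ball (g u) e" "i \<in> ball (g u) e" using x(2) i(2) by (auto simp: dist_commute)
  have FxC: "F x \<in> C" by (rule Fout[OF xi(1) xC])
  obtain \<eta>1 where \<eta>1: "path \<eta>1" "path_image \<eta>1 \<subseteq> C" "pathstart \<eta>1 = i" "pathfinish \<eta>1 = z1"
    using path_connected_C i(1) z(1) unfolding path_connected_def by blast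
  obtain \<eta>2 where \<eta>2: "path \<eta>2" "path_image \<eta>2 \<subseteq> C" "pathstart \<eta>2 = z2" "pathfinish \<eta>2 = F x"
    using path_connected_C FxC z(2) unfolding path_connected_def by blast
  define k where "k = linepath x i"
  have pk: "path k" and kse: "pathstart k = x" "pathfinish k = i" by (simp_all add: k_def)
  have kim: "path_image k \<subseteq> ball (g u) e"
    unfolding k_def path_image_linepath using xi by (intro closed_segment_subset) auto
  have cC: "continuous_on C \<alpha>" using \<alpha>_continuous continuous_on_subset in_H(3) by blast
  \<comment> \<open>The way back from \<open>\<alpha> i\<close> to \<open>\<alpha> x\<close>: inside
    to \<open>z1\<close>, then from \<open>z2\<close> to \<open>F x\<close>, shifted by -1. The
    pieces fit because \<open>\<alpha> z2 - 1 = \<alpha> z1\<close> and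
    \<open>\<alpha> (F x) - 1 = \<alpha> x\<close>.\<close>
  define q1 q2 where "q1 = \<alpha> \<circ> \<eta>1" and "q2 = (\<lambda>x. \<alpha> x - 1) \<circ> \<eta>2"
  define r where "r = \<alpha> \<circ> k"
  have pr: "path r" unfolding r_def
    by (intro path_continuous_image[OF pk] continuous_on_subset[OF holomorphic_on_imp_continuous_on[OF hol] kim])
  have pq: "path q1" "path q2" unfolding q1_def q2_def
    by (intro path_continuous_image \<eta>1 \<eta>2 continuous_on_diff continuous_on_const continuous_on_subset[OF cC])+
  have se: "pathstart r = \<alpha> x" "pathfinish r = \<alpha> i" "pathstart q1 = \<alpha> i" "pathfinish q1 = \<alpha> z1"
     "pathstart q2 = \<alpha> z1" "pathfinish q2 = \<alpha> x"
    using kse \<eta>1 \<eta>2 z(3) \<alpha>F[OF xi(1)]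
    by (simp_all add: r_def q1_def q2_def pathstart_compose pathfinish_compose)
  define q where "q = q1 +++ q2"
  have pqq: "path q" "pathstart q = \<alpha> i" "pathfinish q = \<alpha> x" unfolding q_def using pq se by auto
  define p where "p = r +++ q"
  have pp: "path p" "pathfinish p = pathstart p" unfolding p_def using pr pqq se by auto
  have imq: "path_image q = \<alpha> ` path_image \<eta>1 \<union> (\<lambda>x. \<alpha> x - 1) ` path_image \<eta>2"
    unfolding q_def using pq se by (simp add: path_image_join q1_def q2_def path_image_compose)
  have imp: "path_image p = \<alpha> ` path_image k \<union> path_image q"
    unfolding p_def using se pqq by (simp add: path_image_join r_def path_image_compose)
  \<comment> \<open>The loop is expressed through values of \<open>\<alpha>\<close> on compact
    subsets of the tile, which therefore stay away from the fixed points. The part of the segment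
    outside \<open>C\<close> is carried to \<open>C\<close> or \<open>h\<close> by \<open>F\<close>,
    at the cost of the shift by -1.\<close>
  define E1 where "E1 = (path_image k \<inter> (C \<union> J)) \<union> path_image \<eta>1"
  define E2 where "E2 = F ` (path_image k - C) \<union> path_image \<eta>2"
  have clCJ: "closed (C \<union> J)" using closure_C by (metis closed_closure)
  have cE1: "compact E1" unfolding E1_def
    by (intro compact_Un compact_Int_closed compact_path_image pk \<eta>1 clCJ)
  have cE2: "compact E2" unfolding E2_def
  proof (intro compact_Un compact_continuous_image)
    show "continuous_on (path_image k - C) F"
      by (rule continuous_on_subset[OF holomorphic_on_imp_continuous_on[OF holF]]) (use kim in auto)
    show "compact (path_image k - C)" by (intro compact_diff compact_path_image pk open_C)
    show "compact (path_image \<eta>2)" by (intro compact_path_image \<eta>2)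
  qed
  have kJ: "y \<in> g ` {u1<..<u2}" if "y \<in> path_image k" "y \<in> J" for y using bJ kim that by blast
  have sub01: "{u1<..<u2} \<subseteq> {0<..<1}" using u12 by auto
  have E1s: "E1 \<subseteq> C \<union> g ` {u1<..<u2}" unfolding E1_def using kJ \<eta>1(2) by blast
  have E2s: "E2 \<subseteq> C \<union> h ` {u1<..<u2}"
  proof
    fix y assume "y \<in> E2"
    then consider "y \<in> path_image \<eta>2" | w where "w \<in> path_image k" "w \<notin> C" "y = F w" unfolding E2_def by blast
    then show "y \<in> C \<union> h ` {u1<..<u2}"
    proof cases
      case 1 then show ?thesis using \<eta>2(2) by blast
    next
      case 2
      show ?thesis
      proof (cases "w \<in> J")
        case True
        then obtain v where "v \<in> {u1<..<u2}" "w = g v" using kJ[OF 2(1)] by blast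
        then have "y = h v" "v \<in> {u1<..<u2}" using 2(3) F_g[of v] sub01 by auto
        then show ?thesis by blast
      next
        case False
        then show ?thesis using Fout[of w] 2 kim by blast
      qed
    qed
  qed
  have imE: "path_image p \<subseteq> \<alpha> ` E1 \<union> (\<lambda>x. \<alpha> x - 1) ` E2"
  proof
    fix y assume "y \<in> path_image p"
    then consider w where "w \<in> path_image k" "y = \<alpha> w" | "y \<in> path_image q" unfolding imp by blast
    then show "y \<in> \<alpha> ` E1 \<union> (\<lambda>x. \<alpha> x - 1) ` E2"
    proof cases
      case 1
      show ?thesis
      proof (cases "w \<in> C")
        case True then show ?thesis using 1 unfolding E1_def by blast
      next
        case False
        have "\<alpha> w = \<alpha> (F w) - 1" using \<alpha>F[of w] kim 1(1) by auto
        then show ?thesis using 1 False unfolding E2_def by blast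
      qed
    next
      case 2 then show ?thesis unfolding imq E1_def E2_def by blast
    qed
  qed
  have notin: "\<alpha> (g v) \<notin> path_image p" if v: "v \<in> {0<..<1}" "v \<notin> {u1<..<u2}" for v
  proof
    assume "\<alpha> (g v) \<in> path_image p"
    then consider y where "y \<in> E1" "\<alpha> (g v) = \<alpha> y" | y where "y \<in> E2" "\<alpha> (g v) = \<alpha> y - 1" using imE by blast
    then show False
    proof cases
      case 1
      then consider "y \<in> C" | w where "w \<in> {u1<..<u2}" "y = g w" using E1s by blast
      then show False
      proof cases
        case 1 then show False using \<alpha>_C_neq(1)[OF _ v(1)] \<open>\<alpha> (g v) = \<alpha> y\<close> by auto
      next
        case 2
        then have "v = w" using \<alpha>_g_inj[of w v] v(1) sub01 \<open>\<alpha> (g v) = \<alpha> y\<close> by auto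
        then show False using 2 v(2) by simp
      qed
    next
      case 2
      then have eq: "\<alpha> y = \<alpha> (g v) + 1" by simp
      consider "y \<in> C" | w where "w \<in> {u1<..<u2}" "y = h w" using E2s 2(1) by blast
      then show False
      proof cases
        case 1 then show False using \<alpha>_C_neq(2)[OF _ v(1)] eq by auto
      next
        case 2
        then have "v = w" using \<alpha>_g_inj[of w v] v(1) sub01 eq \<alpha>_h[of w] by auto
        then show False using 2 v(2) by simp
      qed
    qed
  qed
  define s where "s = \<alpha> \<circ> subpath u1 u2 g"
  have sim: "path_image s = (\<lambda>v. \<alpha> (g v)) ` {u1..u2}"
    unfolding s_def path_image_compose using u12
    by (simp add: path_image_subpath_gen closed_segment_eq_real_ivl image_image)
  have s01: "s 0 = \<alpha> (g u1)" "s 1 = \<alpha> (g u2)" by (simp_all add: s_def subpath_def)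
  have ps: "path s" unfolding s_def
  proof (rule path_continuous_image)
    show "path (subpath u1 u2 g)" using path_g u12 by auto
    have "path_image (subpath u1 u2 g) \<subseteq> H"
      using u12 in_H(1) by (auto simp: path_image_subpath_gen closed_segment_eq_real_ivl)
    then show "continuous_on (path_image (subpath u1 u2 g)) \<alpha>" by (rule continuous_on_subset[OF \<alpha>_continuous])
  qed
  have qs: "path_image q \<inter> path_image s = {}"
  proof -
    have "\<alpha> y \<noteq> \<alpha> (g v)" "\<alpha> y - 1 \<noteq> \<alpha> (g v)" if "y \<in> C" "v \<in> {u1..u2}" for y v
      using \<alpha>_C_neq[OF that(1), of v] that(2) u12 by (auto simp: algebra_simps)
    then show ?thesis unfolding imq sim using \<eta>1(2) \<eta>2(2) by blast
  qed
  \<comment> \<open>The return path \<open>q\<close> avoids the piece \<open>s\<close> of the curve,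
    so the short segment alone accounts for the jump of the winding number.\<close>
  have ex: "winding_number q (s 1) - winding_number q (s 0) = winding_number s (\<alpha> x) - winding_number s (\<alpha> i)"
    using winding_number_exchange[OF pqq(1) ps qs] pqq(2,3) by (simp add: pathstart_def pathfinish_def)
  have dec: "winding_number p y = winding_number r y + winding_number q y" if "y \<notin> path_image p" for y
    unfolding p_def
  proof (rule winding_number_join[OF pr _ pqq(1)])
    have "path_image p = path_image r \<union> path_image q" unfolding p_def using se pqq by (simp add: path_image_join)
    then show "y \<notin> path_image r" "y \<notin> path_image q" using that by auto
  qed (use se pqq in simp)
  have nz: "crossing r s \<noteq> 0" unfolding r_def s_def k_def by (rule crs[OF xi xC i(1)])
  have cr: "crossing r s = (winding_number r (s 1) - winding_number r (s 0)) - (winding_number s (\<alpha> i) - winding_number s (\<alpha> x))"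
    using se(1,2) by (simp add: crossing_def pathstart_def pathfinish_def)
  have np: "s 0 \<notin> path_image p" "s 1 \<notin> path_image p" unfolding s01 using notin[of u1] notin[of u2] u12 by auto
  have "winding_number p (s 1) - winding_number p (s 0) = crossing r s"
    using ex dec[OF np(1)] dec[OF np(2)] cr by algebra
  then have ne: "winding_number p (\<alpha> (g u2)) \<noteq> winding_number p (\<alpha> (g u1))"
    using nz unfolding s01 by auto
  show ?thesis
  proof (rule that[OF pp u12(1) _ u12(4) cE1 _ cE2 _ imE _ _ ne])
    show "u1 < u2" using u12 by simp
    show "E1 \<subseteq> C \<union> g ` {0<..<1}" using E1s sub01 by blast
    show "E2 \<subseteq> C \<union> h ` {0<..<1}" using E2s sub01 by blast
    show "\<alpha> (g v) \<notin> path_image p" if "0 < v" "v \<le> u1" for v using notin[of v] that u12 by auto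
    show "\<alpha> (g v) \<notin> path_image p" if "u2 \<le> v" "v < 1" for v using notin[of v] that u12 by auto
  qed
qed

text \<open>The chain rule applied to the Abel equation. It provides local injectivity of
  \<open>\<alpha>\<close> at \<open>h u\<close>.\<close>

lemma deriv_h_nonzero:
  assumes u: "u \<in> {0<..<1}" and good: "deriv \<alpha> (g u) \<noteq> 0"
  shows "deriv \<alpha> (h u) \<noteq> 0"
proof
  assume z: "deriv \<alpha> (h u) = 0"
  obtain e where e: "e > 0" "e \<le> 1" "\<alpha> holomorphic_on ball (g u) e" "F holomorphic_on ball (g u) e"
    "F ` ball (g u) e \<subseteq> ball (h u) 1" "\<alpha> holomorphic_on F ` ball (g u) e"
    "\<And>x. x \<in> ball (g u) e \<Longrightarrow> \<alpha> (F x) = \<alpha> x + 1" by (rule \<alpha>_F[OF u zero_less_one]) blast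
  have gb: "g u \<in> ball (g u) e" using e(1) by simp
  obtain S where S: "open S" "H \<subseteq> S" "\<alpha> holomorphic_on S" by (rule \<alpha>_holomorphic)
  have d1: "(F has_field_derivative deriv F (g u)) (at (g u))"
    using holomorphic_derivI[OF e(4) open_ball gb] .
  have "(\<alpha> has_field_derivative deriv \<alpha> (h u)) (at (h u))"
    by (rule holomorphic_derivI[OF S(3,1)]) (use S(2) in_H(2)[OF u] in auto)
  then have d2: "(\<alpha> has_field_derivative 0) (at (F (g u)))" using z F_g[OF u] by simp
  have "((\<lambda>x. \<alpha> (F x)) has_field_derivative 0) (at (g u))"
    using DERIV_chain2[OF d2 d1] by simp
  moreover have "((\<lambda>x. \<alpha> x + 1) has_field_derivative deriv \<alpha> (g u) + 0) (at (g u))"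
    by (intro DERIV_add DERIV_const holomorphic_derivI[OF e(3) open_ball gb])
  then have "((\<lambda>x. \<alpha> x + 1) has_field_derivative deriv \<alpha> (g u)) (at (g u))" by simp
  then have "((\<lambda>x. \<alpha> (F x)) has_field_derivative deriv \<alpha> (g u)) (at (g u))"
    by (rule has_field_derivative_transform_within_open[OF _ open_ball gb]) (simp add: e(7))
  ultimately show False using good DERIV_unique by blast
qed

section \<open>Images of small crosscuts\<close>

definition smallcut :: "real \<Rightarrow> real \<Rightarrow> real \<Rightarrow> real \<Rightarrow> real \<Rightarrow> real \<Rightarrow> complex set \<Rightarrow> complex set \<Rightarrow> bool" where
  "smallcut \<rho> r \<theta> \<theta>' t s C0 C1 \<longleftrightarrow> crosscut r \<theta> \<theta>' t s C0 C1 \<and> r < \<rho> \<and>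
     g ` {t..1} \<subseteq> ball (g 1) \<rho> \<and> h ` {s..1} \<subseteq> ball (g 1) \<rho> \<and> C1 \<subseteq> ball (g 1) \<rho>"

definition cutval :: "real \<Rightarrow> real \<Rightarrow> real \<Rightarrow> real \<Rightarrow> complex" where
  "cutval r \<theta> \<theta>' u = \<alpha> (cut r \<theta> \<theta>' u)"

lemma exists_smallcut:
  assumes "\<rho> > 0"
  obtains r0 where "r0 > 0" "\<And>r. 0 < r \<Longrightarrow> r < r0 \<Longrightarrow> \<exists>\<theta> \<theta>' t s C0 C1. smallcut \<rho> r \<theta> \<theta>' t s C0 C1"
proof -
  obtain r0 where r0: "r0 > 0" "\<And>r. 0 < r \<Longrightarrow> r < r0 \<Longrightarrow> \<exists>\<theta> \<theta>' t s C0 C1. crosscut r \<theta> \<theta>' t s C0 C1 \<and>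
       g ` {t..1} \<subseteq> ball (g 1) \<rho> \<and> h ` {s..1} \<subseteq> ball (g 1) \<rho> \<and> C1 \<subseteq> ball (g 1) \<rho>"
    using exists_crosscut_small[OF assms] by metis
  show ?thesis
  proof (rule that[of "min r0 \<rho>"])
    show "\<exists>\<theta> \<theta>' t s C0 C1. smallcut \<rho> r \<theta> \<theta>' t s C0 C1" if "0 < r" "r < min r0 \<rho>" for r
      using r0(2)[of r] that unfolding smallcut_def by auto
  qed (use r0 assms in auto)
qed

section \<open>Values of \<open>\<alpha>\<close> along one crosscut\<close>

context
  fixes r \<theta> \<theta>' t s :: real and C0 C1 :: "complex set"
  assumes cc: "crosscut r \<theta> \<theta>' t s C0 C1"
begin

lemma crosscut_ts: "t \<in> {0<..<1}" "s \<in> {0<..<1}" "0 < r" "\<bar>\<theta> - \<theta>'\<bar> < 2 * pi"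
  using cc by (auto simp: crosscut_def)

lemma crosscut_sets: "open C0" "open C1" "C0 \<inter> C1 = {}" "C = C0 \<union> C1 \<union> circ (g 1) r ` open_segment \<theta> \<theta>'"
   "C0 \<inter> circ (g 1) r ` open_segment \<theta> \<theta>' = {}" "g 1 \<notin> closure C0"
  using cc by (auto simp: crosscut_def)

lemma cut_ends: "cut r \<theta> \<theta>' 0 = g t" "cut r \<theta> \<theta>' 1 = h s"
  using cc by (auto simp: crosscut_def cut_def)

lemma cut_neq: "\<theta> \<noteq> \<theta>'"
proof
  assume "\<theta> = \<theta>'"
  then have "g t = h s" using cc by (auto simp: crosscut_def)
  then show False using gh_neq crosscut_ts by auto
qed

lemma cut_image: "cut r \<theta> \<theta>' ` {0<..<1} = circ (g 1) r ` open_segment \<theta> \<theta>'"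
  by (rule cut_segment[OF cut_neq])

lemma cut_in_C: "u \<in> {0<..<1} \<Longrightarrow> cut r \<theta> \<theta>' u \<in> C"
  using cut_image crosscut_sets(4) by blast

lemma cut_in_H: "u \<in> {0..1} \<Longrightarrow> cut r \<theta> \<theta>' u \<in> H"
proof -
  assume u: "u \<in> {0..1}"
  then consider "u = 0" | "u = 1" | "u \<in> {0<..<1}" by force
  then show ?thesis
    by cases (use cut_ends in_H crosscut_ts cut_in_C in auto)
qed

lemma dist_cut: "dist (g 1) (cut r \<theta> \<theta>' u) = r"
  using crosscut_ts(3) by (simp add: cut_def dist_circ)

lemma cut_cases:
  assumes "u \<in> {0..1}"
  shows "u = 0 \<and> cut r \<theta> \<theta>' u = g t \<or> u = 1 \<and> cut r \<theta> \<theta>' u = h s \<or> u \<in> {0<..<1} \<and> cut r \<theta> \<theta>' u \<in> C"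
proof -
  from assms consider "u = 0" | "u = 1" | "u \<in> {0<..<1}" by force
  then show ?thesis by cases (use cut_ends cut_in_C in auto)
qed

lemma path_cutval: "path (cutval r \<theta> \<theta>')"
proof -
  have "path (\<alpha> \<circ> cut r \<theta> \<theta>')"
    by (intro path_continuous_image path_cut continuous_on_subset[OF \<alpha>_continuous])
       (auto simp: path_image_def cut_in_H)
  then show ?thesis by (simp add: cutval_def[abs_def] o_def)
qed

lemma cutval_ends: "cutval r \<theta> \<theta>' 0 = \<alpha> (g t)" "cutval r \<theta> \<theta>' 1 = \<alpha> (g s) + 1"
  using cut_ends \<alpha>_h crosscut_ts by (auto simp: cutval_def)

lemma cutval_g:
  assumes "u \<in> {0..1}" "w \<in> {0<..<1}"
  shows "cutval r \<theta> \<theta>' u = \<alpha> (g w) \<longleftrightarrow> u = 0 \<and> w = t" "cutval r \<theta> \<theta>' u = \<alpha> (g w) + 1 \<longleftrightarrow> u = 1 \<and> w = s"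
proof -
  have hs: "\<alpha> (h s) = \<alpha> (g s) + 1" by (rule \<alpha>_h[OF crosscut_ts(2)])
  show "cutval r \<theta> \<theta>' u = \<alpha> (g w) \<longleftrightarrow> u = 0 \<and> w = t"
    using cut_cases[OF assms(1)]
  proof (elim disjE conjE)
    assume "u = 0" "cut r \<theta> \<theta>' u = g t"
    then show ?thesis using \<alpha>_g_inj[OF assms(2) crosscut_ts(1)] by (auto simp: cutval_def)
  next
    assume "u = 1" "cut r \<theta> \<theta>' u = h s"
    then show ?thesis using \<alpha>_g_no_chord[OF crosscut_ts(2) assms(2)] hs by (auto simp: cutval_def)
  next
    assume "u \<in> {0<..<1}" "cut r \<theta> \<theta>' u \<in> C"
    then show ?thesis using \<alpha>_C_neq(1)[OF _ assms(2)] by (auto simp: cutval_def)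
  qed
  show "cutval r \<theta> \<theta>' u = \<alpha> (g w) + 1 \<longleftrightarrow> u = 1 \<and> w = s"
    using cut_cases[OF assms(1)]
  proof (elim disjE conjE)
    assume "u = 0" "cut r \<theta> \<theta>' u = g t"
    then show ?thesis using \<alpha>_g_no_chord[OF assms(2) crosscut_ts(1)] by (auto simp: cutval_def)
  next
    assume "u = 1" "cut r \<theta> \<theta>' u = h s"
    then show ?thesis using \<alpha>_g_inj[OF assms(2) crosscut_ts(2)] hs by (auto simp: cutval_def)
  next
    assume "u \<in> {0<..<1}" "cut r \<theta> \<theta>' u \<in> C"
    then show ?thesis using \<alpha>_C_neq(2)[OF _ assms(2)] by (auto simp: cutval_def)
  qed
qed

text \<open>Values in a disc of radius 1/4 cannot differ by one, so \<open>gap_no_chord\<close>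
  applies: the image of the cut meets no translates of the curve other than the two on which it
  ends.\<close>

lemma cutval_gap:
  assumes "\<And>u. u \<in> {0..1} \<Longrightarrow> norm (cutval r \<theta> \<theta>' u - w0) < 1/4"
    and "u \<in> {0..1}" "w \<in> {0<..<1}" "cutval r \<theta> \<theta>' u = \<alpha> (g w) + of_int k"
  shows "k = 0 \<or> k = 1"
proof (rule gap_no_chord[OF continuous_\<alpha>_g _ path_cutval _ _ _ _ assms(2,3,4)])
  show "\<alpha> (g v) \<noteq> \<alpha> (g u) + 1" if "u \<in> {0<..<1}" "v \<in> {0<..<1}" for u v using \<alpha>_g_no_chord that by blast
  show "cutval r \<theta> \<theta>' 0 \<in> (\<lambda>u. \<alpha> (g u)) ` {0<..<1}" "cutval r \<theta> \<theta>' 1 - 1 \<in> (\<lambda>u. \<alpha> (g u)) ` {0<..<1}"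
    using cutval_ends crosscut_ts by auto
  show "cutval r \<theta> \<theta>' x \<noteq> \<alpha> (g u) \<and> cutval r \<theta> \<theta>' x \<noteq> \<alpha> (g u) + 1" if "x \<in> {0<..<1}" "u \<in> {0<..<1}" for x u
    using cutval_g[of x u] that by auto
  show "cutval r \<theta> \<theta>' x' \<noteq> cutval r \<theta> \<theta>' x + 1" if "x \<in> {0..1}" "x' \<in> {0..1}" for x x'
  proof
    assume "cutval r \<theta> \<theta>' x' = cutval r \<theta> \<theta>' x + 1"
    then have "1 = (cutval r \<theta> \<theta>' x' - w0) - (cutval r \<theta> \<theta>' x - w0)" by simp
    then have "(1::real) = norm ((cutval r \<theta> \<theta>' x' - w0) - (cutval r \<theta> \<theta>' x - w0))" by (metis norm_one)
    also have "\<dots> \<le> norm (cutval r \<theta> \<theta>' x' - w0) + norm (cutval r \<theta> \<theta>' x - w0)" by (rule norm_triangle_ineq4)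
    also have "\<dots> < 1/4 + 1/4" by (intro add_strict_mono assms(1) that)
    finally show False by simp
  qed
qed

end

lemma \<alpha>_g_translate:
  assumes "u \<in> {0<..<1}" "v \<in> {0<..<1}" "\<alpha> (g u) + of_int k = \<alpha> (g v)"
  shows "k = 0"
proof (rule path_connected_no_chord_int[of "(\<lambda>u. \<alpha> (g u)) ` {0<..<1}" "\<alpha> (g u)"])
  show "path_connected ((\<lambda>u. \<alpha> (g u)) ` {0<..<1})"
    by (intro path_connected_continuous_image continuous_\<alpha>_g convex_imp_path_connected) auto
  show "x + 1 \<notin> (\<lambda>u. \<alpha> (g u)) ` {0<..<1}" if "x \<in> (\<lambda>u. \<alpha> (g u)) ` {0<..<1}" for x
    using that \<alpha>_g_no_chord by fastforce
qed (use assms in auto)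

text \<open>Either the images of arbitrarily small crosscuts run off to infinity, or, by \<open>length_area\<close>, images of
  arbitrarily small crosscuts lie in tiny discs.\<close>

definition far :: bool where
  "far \<longleftrightarrow> (\<forall>M. \<forall>\<rho>>0. \<exists>r \<theta> \<theta>' t s C0 C1. smallcut \<rho> r \<theta> \<theta>' t s C0 C1 \<and> (\<forall>u\<in>{0..1}. M < norm (cutval r \<theta> \<theta>' u)))"

text \<open>Without \<open>far\<close>, every sufficiently small crosscut has a point with value of
  norm at most some fixed \<open>M\<close>; starting there, \<open>length_area\<close> controls the
  whole image. A countable set of radii can be avoided at the same time.\<close>

lemma not_far:
  assumes "\<not> far"
  obtains M where "\<And>\<epsilon> \<rho> Z. 0 < \<epsilon> \<Longrightarrow> 0 < \<rho> \<Longrightarrow> countable Z \<Longrightarrow> \<exists>r \<theta> \<theta>' t s C0 C1 w. smallcut \<rho> r \<theta> \<theta>' t s C0 C1 \<and> r \<notin> Z \<and>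
      norm w \<le> M \<and> (\<forall>u\<in>{0..1}. norm (cutval r \<theta> \<theta>' u - w) < \<epsilon>)"
proof -
  obtain M \<rho>0 where M: "\<rho>0 > 0" "\<And>r \<theta> \<theta>' t s C0 C1. smallcut \<rho>0 r \<theta> \<theta>' t s C0 C1 \<Longrightarrow> \<exists>u\<in>{0..1}. norm (cutval r \<theta> \<theta>' u) \<le> M"
    using assms unfolding far_def by (metis not_le)
  show ?thesis
  proof (rule that)
    fix \<epsilon> \<rho> :: real and Z :: "real set" assume as: "0 < \<epsilon>" "0 < \<rho>" "countable Z"
    obtain r0 where r0: "r0 > 0" "\<And>r. 0 < r \<Longrightarrow> r < r0 \<Longrightarrow> \<exists>\<theta> \<theta>' t s C0 C1. smallcut (min \<rho> \<rho>0) r \<theta> \<theta>' t s C0 C1"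
    proof -
      have "0 < min \<rho> \<rho>0" using as(2) M(1) by simp
      from exists_smallcut[OF this] that show ?thesis by blast
    qed
    obtain r where r: "0 < r" "r < r0" "r \<notin> Z"
      and la: "\<And>\<theta> \<theta>'. \<bar>\<theta> - \<theta>'\<bar> \<le> 2 * pi \<Longrightarrow> (\<And>t. t \<in> closed_segment \<theta> \<theta>' \<Longrightarrow> circ (g 1) r t \<in> C) \<Longrightarrow>
       norm (\<alpha> (circ (g 1) r \<theta>)) \<le> M + 1 \<Longrightarrow> norm (\<alpha> (circ (g 1) r \<theta>) - \<alpha> (circ (g 1) r \<theta>')) < \<epsilon> / 2"
      using length_area[OF open_C \<alpha>_holomorphic_C \<alpha>_inj_C _ r0(1) as(3), of "\<epsilon> / 2" "g 1" "M + 1"] as(1) by auto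
    obtain \<theta> \<theta>' t s C0 C1 where sc: "smallcut (min \<rho> \<rho>0) r \<theta> \<theta>' t s C0 C1" using r0(2)[OF r(1,2)] by blast
    then have sc': "smallcut \<rho> r \<theta> \<theta>' t s C0 C1" "smallcut \<rho>0 r \<theta> \<theta>' t s C0 C1"
      unfolding smallcut_def by (auto dest: subsetD)
    have cc: "crosscut r \<theta> \<theta>' t s C0 C1" using sc by (simp add: smallcut_def)
    define y where "y = cutval r \<theta> \<theta>'"
    have cy: "continuous_on {0..1} y" using path_cutval[OF cc] by (simp add: y_def path_def)
    obtain u0 where u0: "u0 \<in> {0..1}" "norm (y u0) \<le> M" using M(2)[OF sc'(2)] unfolding y_def by blast
    \<comment> \<open>\<open>length_area\<close> needs arcs in the open set \<open>C\<close>, but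
      the ends of the cut lie on \<open>J\<close>. Passing to an interior parameter costs 1 in the
      bound; the ends are recovered by continuity, which is why \<open>\<epsilon> / 2\<close> is
      used before.\<close>
    have "\<exists>u'\<in>{0<..<1}. norm (y u') \<le> M + 1"
    proof -
      obtain d where d: "d > 0" "\<And>x. x \<in> {0..1} \<Longrightarrow> dist x u0 < d \<Longrightarrow> dist (y x) (y u0) < 1"
        using cy u0(1) unfolding continuous_on_iff by (metis zero_less_one)
      have "u0 \<in> closure {0<..<1}" using u0(1) by simp
      then obtain x where x: "x \<in> {0<..<1}" "dist x u0 < d" using d(1) closure_approachable by blast
      then have "dist (y x) (y u0) < 1" using d(2)[of x] by auto
      then have "norm (y x) \<le> M + 1" using u0(2) norm_triangle_sub[of "y x" "y u0"] by (simp add: dist_norm)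
      then show ?thesis using x(1) by blast
    qed
    then obtain u' where u': "u' \<in> {0<..<1}" "norm (y u') \<le> M + 1" by blast
    define l where "l = (\<lambda>u. \<theta> + u * (\<theta>' - \<theta>))"
    have yl: "y u = \<alpha> (circ (g 1) r (l u))" for u by (simp add: y_def cutval_def cut_def l_def)
    have inner: "norm (y u' - y u) < \<epsilon> / 2" if u: "u \<in> {0<..<1}" for u
      unfolding yl
    proof (rule la)
      have "\<bar>l u' - l u\<bar> = \<bar>u' - u\<bar> * \<bar>\<theta>' - \<theta>\<bar>" by (simp add: l_def abs_mult flip: left_diff_distrib)
      also have "\<dots> \<le> 1 * \<bar>\<theta>' - \<theta>\<bar>" using u u' by (intro mult_right_mono) auto
      finally show "\<bar>l u' - l u\<bar> \<le> 2 * pi" using crosscut_ts(4)[OF cc] by simp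
      show "norm (\<alpha> (circ (g 1) r (l u'))) \<le> M + 1" using u'(2) yl by simp
      have op: "l u \<in> open_segment \<theta> \<theta>'" if "u \<in> {0<..<1}" for u
        unfolding segment_real_image(2)[OF cut_neq[OF cc]] l_def using that by blast
      have cv: "convex (open_segment \<theta> \<theta>')" by (rule convex_open_segment)
      show "circ (g 1) r x \<in> C" if "x \<in> closed_segment (l u') (l u)" for x
      proof -
        have "x \<in> open_segment \<theta> \<theta>'"
          using closed_segment_subset[OF op[OF u'(1)] op[OF u] cv] that by blast
        then show ?thesis using crosscut_sets(4)[OF cc] by blast
      qed
    qed
    have all: "norm (y u' - y u) \<le> \<epsilon> / 2" if u: "u \<in> {0..1}" for u
    proof -
      have "continuous_on (closure {0<..<1::real}) (\<lambda>u. norm (y u' - y u))"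
        using cy by (intro continuous_intros) simp
      then show ?thesis
        by (rule continuous_le_on_closure) (use u inner in \<open>auto intro: less_imp_le\<close>)
    qed
    show "\<exists>r \<theta> \<theta>' t s C0 C1 w. smallcut \<rho> r \<theta> \<theta>' t s C0 C1 \<and> r \<notin> Z \<and>
      norm w \<le> M + 1 \<and> (\<forall>u\<in>{0..1}. norm (cutval r \<theta> \<theta>' u - w) < \<epsilon>)"
    proof -
      have "norm (cutval r \<theta> \<theta>' u - y u') < \<epsilon>" if "u \<in> {0..1}" for u
        using all[OF that] as(1) by (simp add: y_def norm_minus_commute)
      then show ?thesis using sc'(1) r(3) u'(2) by blast
    qed
  qed
qed

definition limit_value :: "complex \<Rightarrow> bool" where
  "limit_value w \<longleftrightarrow> (\<forall>\<epsilon>>0. \<forall>\<rho>>0. \<exists>r \<theta> \<theta>' t s C0 C1. smallcut \<rho> r \<theta> \<theta>' t s C0 C1 \<and>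
     (\<forall>u\<in>{0..1}. norm (cutval r \<theta> \<theta>' u - w) < \<epsilon>))"

text \<open>The centres of the tiny discs stay bounded as the crosscuts shrink, and any accumulation
  point serves. Unlike the varying centres, one such value can be kept off in advance by the choice
  of a radius at the other end.\<close>

lemma not_far_limit_value:
  assumes "\<not> far"
  obtains w where "limit_value w"
proof -
  obtain M where M: "\<And>\<epsilon> \<rho> Z. 0 < \<epsilon> \<Longrightarrow> 0 < \<rho> \<Longrightarrow> countable Z \<Longrightarrow> \<exists>r \<theta> \<theta>' t s C0 C1 w. smallcut \<rho> r \<theta> \<theta>' t s C0 C1 \<and> r \<notin> Z \<and>
      norm w \<le> M \<and> (\<forall>u\<in>{0..1}. norm (cutval r \<theta> \<theta>' u - w) < \<epsilon>)"
    using not_far[OF assms] by metis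
  have "\<exists>w. norm w \<le> M \<and> (\<exists>r \<theta> \<theta>' t s C0 C1. smallcut (1 / real (Suc n)) r \<theta> \<theta>' t s C0 C1 \<and>
      (\<forall>u\<in>{0..1}. norm (cutval r \<theta> \<theta>' u - w) < 1 / real (Suc n)))" for n
  proof -
    have "0 < 1 / real (Suc n)" by simp
    from M[OF this this countable_empty] show ?thesis by blast
  qed
  then obtain f where f: "\<And>n. norm (f n) \<le> M" "\<And>n. \<exists>r \<theta> \<theta>' t s C0 C1. smallcut (1 / real (Suc n)) r \<theta> \<theta>' t s C0 C1 \<and>
      (\<forall>u\<in>{0..1}. norm (cutval r \<theta> \<theta>' u - f n) < 1 / real (Suc n))" by metis
  have "\<forall>n. f n \<in> cball 0 M" using f(1) by simp
  then obtain w \<sigma> where w: "strict_mono \<sigma>" "(f \<circ> \<sigma>) \<longlonglongrightarrow> w"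
    using compact_cball[of 0 M] unfolding compact_def by metis
  have "limit_value w" unfolding limit_value_def
  proof (intro allI impI)
    fix \<epsilon> \<rho> :: real assume e: "\<epsilon> > 0" "\<rho> > 0"
    have "\<forall>\<^sub>F n in sequentially. dist ((f \<circ> \<sigma>) n) w < \<epsilon> / 2" by (rule tendstoD[OF w(2)]) (use e(1) in simp)
    moreover have lim0: "(\<lambda>n. 1 / real (Suc (\<sigma> n))) \<longlonglongrightarrow> 0"
      using LIMSEQ_subseq_LIMSEQ[OF LIMSEQ_inverse_real_of_nat w(1)] by (simp add: o_def inverse_eq_divide)
    then have "\<forall>\<^sub>F n in sequentially. 1 / real (Suc (\<sigma> n)) < min \<rho> (\<epsilon> / 2)"
      by (rule order_tendstoD) (use e in auto)
    ultimately have "\<forall>\<^sub>F n in sequentially. dist ((f \<circ> \<sigma>) n) w < \<epsilon> / 2 \<and> 1 / real (Suc (\<sigma> n)) < min \<rho> (\<epsilon> / 2)"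
      by (rule eventually_conj)
    then obtain n where n: "dist (f (\<sigma> n)) w < \<epsilon> / 2" "1 / real (Suc (\<sigma> n)) < min \<rho> (\<epsilon> / 2)"
      by (auto dest: eventually_happens)
    obtain r \<theta> \<theta>' t s C0 C1 where sc: "smallcut (1 / real (Suc (\<sigma> n))) r \<theta> \<theta>' t s C0 C1"
      and cl: "\<And>u. u \<in> {0..1} \<Longrightarrow> norm (cutval r \<theta> \<theta>' u - f (\<sigma> n)) < 1 / real (Suc (\<sigma> n))"
      using f(2)[of "\<sigma> n"] by blast
    have "ball (g 1) (1 / real (Suc (\<sigma> n))) \<subseteq> ball (g 1) \<rho>" using n(2) by (intro subset_ball) auto
    then have "smallcut \<rho> r \<theta> \<theta>' t s C0 C1" using sc n(2) unfolding smallcut_def by auto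
    moreover have "norm (cutval r \<theta> \<theta>' u - w) < \<epsilon>" if "u \<in> {0..1}" for u
    proof -
      have "norm (cutval r \<theta> \<theta>' u - w) \<le> norm (cutval r \<theta> \<theta>' u - f (\<sigma> n)) + norm (f (\<sigma> n) - w)"
        using norm_triangle_ineq[of "cutval r \<theta> \<theta>' u - f (\<sigma> n)" "f (\<sigma> n) - w"] by simp
      then show ?thesis using cl[OF that] n by (simp add: dist_norm)
    qed
    ultimately show "\<exists>r \<theta> \<theta>' t s C0 C1. smallcut \<rho> r \<theta> \<theta>' t s C0 C1 \<and>
     (\<forall>u\<in>{0..1}. norm (cutval r \<theta> \<theta>' u - w) < \<epsilon>)" by blast
  qed
  then show ?thesis by (rule that)
qed

text \<open>\<open>X\<close> will be a translate of an arc \<open>tau\<close> built at the other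
  end: \<open>Y\<close> is the part that comes from the crosscut there, and the rest lies on
  translates of the curve that \<open>cutval_gap\<close> excludes.\<close>

lemma exists_cut_avoiding:
  assumes "far \<or> (\<exists>w. limit_value w \<and> w \<notin> Y)" "bounded X" "closed Y" "0 < \<rho>"
    and X: "\<And>x. x \<in> X \<Longrightarrow> x \<in> Y \<or> (\<exists>w\<in>{0<..<1}. \<exists>k::int. k \<noteq> 0 \<and> k \<noteq> 1 \<and> x = \<alpha> (g w) + of_int k)"
  obtains r \<theta> \<theta>' t s C0 C1 where "smallcut \<rho> r \<theta> \<theta>' t s C0 C1" "\<And>u. u \<in> {0..1} \<Longrightarrow> cutval r \<theta> \<theta>' u \<notin> X"
  using assms(1)
proof
  assume far
  obtain M where M: "\<And>x. x \<in> X \<Longrightarrow> norm x \<le> M" using assms(2) unfolding bounded_iff by blast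
  obtain r \<theta> \<theta>' t s C0 C1 where sc: "smallcut \<rho> r \<theta> \<theta>' t s C0 C1" "\<And>u. u \<in> {0..1} \<Longrightarrow> M < norm (cutval r \<theta> \<theta>' u)"
    using \<open>far\<close> assms(4) unfolding far_def by metis
  then show thesis using that M by (metis not_le)
next
  assume "\<exists>w. limit_value w \<and> w \<notin> Y"
  then obtain w0 where w0: "limit_value w0" "w0 \<notin> Y" by blast
  obtain d where d: "d > 0" "ball w0 d \<subseteq> - Y" using openE[of "- Y" w0] assms(3) w0(2) by auto
  obtain r \<theta> \<theta>' t s C0 C1 where sc: "smallcut \<rho> r \<theta> \<theta>' t s C0 C1"
    and cl: "\<And>u. u \<in> {0..1} \<Longrightarrow> norm (cutval r \<theta> \<theta>' u - w0) < min d (1/4)"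
    using w0(1) d(1) assms(4) unfolding limit_value_def by (metis min_less_iff_conj zero_less_divide_1_iff zero_less_numeral)
  have cc: "crosscut r \<theta> \<theta>' t s C0 C1" using sc by (simp add: smallcut_def)
  show thesis
  proof (rule that[OF sc])
    fix u :: real assume u: "u \<in> {0..1}"
    show "cutval r \<theta> \<theta>' u \<notin> X"
    proof
      assume "cutval r \<theta> \<theta>' u \<in> X"
      from X[OF this] consider "cutval r \<theta> \<theta>' u \<in> Y"
        | w k where "w \<in> {0<..<1}" "k \<noteq> 0" "k \<noteq> (1::int)" "cutval r \<theta> \<theta>' u = \<alpha> (g w) + of_int k"
        by (elim disjE bexE exE conjE)
      then show False
      proof cases
        case 1
        have "cutval r \<theta> \<theta>' u \<in> ball w0 d" using cl[OF u] by (simp add: dist_norm norm_minus_commute)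
        then show False using d(2) 1 by blast
      next
        case 2
        have "k = 0 \<or> k = 1"
          by (rule cutval_gap[OF cc _ u 2(1,4), of w0]) (use cl in auto)
        then show False using 2 by simp
      qed
    qed
  qed
qed

text \<open>Running back along \<open>q\<close> from a point in the image of \<open>C0\<close>, one
  leaves this image for the first time at \<open>\<xi>0\<close>. The part of \<open>q\<close> in
  between lifts to a connected subset of \<open>C0\<close>. The lift may fail to converge, so only a
  sequence converging to a point of the closure is extracted.\<close>

lemma exit_point:
  assumes "open C0" "C0 \<subseteq> C" "path q" "\<xi> \<in> {0..1}" "q \<xi> \<in> \<alpha> ` C0" "q 0 \<notin> \<alpha> ` C0"
  obtains \<xi>0 x xs \<xi>s L where "\<xi>0 \<in> {0..1}" "q \<xi>0 \<notin> \<alpha> ` C0" "x \<in> closure C0"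
    "\<And>n::nat. \<xi>s n \<in> {\<xi>0<..1}" "\<And>n. xs n \<in> L" "\<And>n. \<alpha> (xs n) = q (\<xi>s n)" "\<xi>s \<longlonglongrightarrow> \<xi>0" "xs \<longlonglongrightarrow> x"
    "connected L" "L \<subseteq> C0" "\<alpha> ` L \<subseteq> path_image q"
proof -
  obtain \<phi> where \<phi>: "\<phi> holomorphic_on \<alpha> ` C" "\<And>z. z \<in> C \<Longrightarrow> \<phi> (\<alpha> z) = z"
    using holomorphic_has_inverse[OF \<alpha>_holomorphic_C open_C \<alpha>_inj_C] by metis
  have cq: "continuous_on {0..1} q" using assms(3) by (simp add: path_def)
  have opA: "open (\<alpha> ` C0)" by (rule open_\<alpha>_image[OF assms(1,2)])
  define S where "S = {0..\<xi>} \<inter> q -` (- \<alpha> ` C0)"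
  have "compact S"
  proof -
    have "closed S" unfolding S_def
      by (intro continuous_closed_preimage continuous_on_subset[OF cq]) (use assms(4) opA in auto)
    moreover have "bounded S" unfolding S_def by (meson bounded_closed_interval bounded_subset inf_le1)
    ultimately show ?thesis using compact_eq_bounded_closed by blast
  qed
  moreover have "0 \<in> S" using assms(4,6) by (simp add: S_def)
  ultimately obtain \<xi>0 where x0: "\<xi>0 \<in> S" "\<And>y. y \<in> S \<Longrightarrow> y \<le> \<xi>0"
    using compact_attains_sup[of S] by (metis empty_iff)
  have lt: "\<xi>0 < \<xi>" using x0(1) assms(5) by (auto simp: S_def order_le_less)
  have inA: "q y \<in> \<alpha> ` C0" if y: "y \<in> {\<xi>0<..\<xi>}" for y
  proof (rule ccontr)
    assume "q y \<notin> \<alpha> ` C0"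
    then have "y \<in> S" using y x0(1) by (auto simp: S_def)
    then show False using x0(2)[of y] y by simp
  qed
  define X where "X = (\<lambda>y. \<phi> (q y))"
  have X: "X y \<in> C0" "\<alpha> (X y) = q y" if y: "y \<in> {\<xi>0<..\<xi>}" for y
  proof -
    obtain z where "z \<in> C0" "q y = \<alpha> z" using inA[OF y] by blast
    then show "X y \<in> C0" "\<alpha> (X y) = q y" using \<phi>(2)[of z] assms(2) by (auto simp: X_def)
  qed
  have sub: "{\<xi>0<..\<xi>} \<subseteq> {0..1}" using x0(1) assms(4) by (auto simp: S_def)
  have cX: "continuous_on {\<xi>0<..\<xi>} X" unfolding X_def
    by (rule continuous_on_compose2[OF holomorphic_on_imp_continuous_on[OF \<phi>(1)] continuous_on_subset[OF cq sub]])
       (use inA assms(2) in blast)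
  define \<xi>s where "\<xi>s = (\<lambda>n. \<xi>0 + (\<xi> - \<xi>0) / real (Suc n))"
  have \<xi>s: "\<xi>s n \<in> {\<xi>0<..\<xi>}" for n
  proof -
    have "(\<xi> - \<xi>0) / real (Suc n) \<le> (\<xi> - \<xi>0) / 1" using lt by (intro divide_left_mono) auto
    moreover have "0 < (\<xi> - \<xi>0) / real (Suc n)" using lt by simp
    ultimately show ?thesis by (auto simp: \<xi>s_def)
  qed
  have lim: "\<xi>s \<longlonglongrightarrow> \<xi>0"
  proof -
    have "(\<lambda>n. (\<xi> - \<xi>0) / real (Suc n)) \<longlonglongrightarrow> 0"
      using tendsto_mult[OF tendsto_const[of "\<xi> - \<xi>0"] LIMSEQ_inverse_real_of_nat] by (simp add: divide_inverse)
    from tendsto_add[OF tendsto_const[of \<xi>0] this] show ?thesis by (simp add: \<xi>s_def)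
  qed
  have "compact (closure C0)"
    using bounded_C assms(2) bounded_subset by (simp add: compact_closure) blast
  moreover have "\<forall>n. X (\<xi>s n) \<in> closure C0" using X(1)[OF \<xi>s] closure_subset by blast
  ultimately obtain x \<sigma> where x: "x \<in> closure C0" "strict_mono \<sigma>" "((\<lambda>n. X (\<xi>s n)) \<circ> \<sigma>) \<longlonglongrightarrow> x"
    unfolding compact_def by metis
  show ?thesis
  proof (rule that[of \<xi>0 x "\<xi>s \<circ> \<sigma>" "(\<lambda>n. X (\<xi>s n)) \<circ> \<sigma>" "X ` {\<xi>0<..\<xi>}"])
    show "\<xi>0 \<in> {0..1}" "q \<xi>0 \<notin> \<alpha> ` C0" using x0(1) assms(4) by (auto simp: S_def)
    show "(\<xi>s \<circ> \<sigma>) n \<in> {\<xi>0<..1}" for n using \<xi>s[of "\<sigma> n"] assms(4) by auto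
    show "((\<lambda>n. X (\<xi>s n)) \<circ> \<sigma>) n \<in> X ` {\<xi>0<..\<xi>}" for n using \<xi>s[of "\<sigma> n"] by auto
    show "\<alpha> (((\<lambda>n. X (\<xi>s n)) \<circ> \<sigma>) n) = q ((\<xi>s \<circ> \<sigma>) n)" for n using X(2)[OF \<xi>s] by simp
    show "(\<xi>s \<circ> \<sigma>) \<longlonglongrightarrow> \<xi>0" by (rule LIMSEQ_subseq_LIMSEQ[OF lim x(2)])
    show "connected (X ` {\<xi>0<..\<xi>})" by (intro connected_continuous_image cX) auto
    show "X ` {\<xi>0<..\<xi>} \<subseteq> C0" using X(1) by blast
    show "\<alpha> ` X ` {\<xi>0<..\<xi>} \<subseteq> path_image q"
      using X(2) sub by (auto simp: path_image_def)
  qed (use x in auto)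
qed

text \<open>A crosscut smaller than the distance of \<open>g 1\<close> from a point of
  \<open>L\<close> has this point on its far side \<open>C0\<close>. If \<open>L\<close> misses the
  cut, it stays in \<open>C0\<close>, whose closure omits \<open>g 1\<close>.\<close>

lemma not_tendsto_end:
  assumes "connected L" "L \<subseteq> C" "\<And>n::nat. xs n \<in> L" "xs \<longlonglongrightarrow> g 1"
    and cuts: "\<And>\<rho>. 0 < \<rho> \<Longrightarrow> \<exists>r \<theta> \<theta>' t s C0 C1. smallcut \<rho> r \<theta> \<theta>' t s C0 C1 \<and> (\<forall>u\<in>{0..1}. cutval r \<theta> \<theta>' u \<notin> \<alpha> ` L)"
  shows False
proof -
  define z where "z = xs 0"
  have z: "z \<in> L" "z \<in> C" using assms(2,3) by (auto simp: z_def)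
  have "z \<noteq> g 1" using z(2) not_in_C(1)[of 1] by auto
  then have "0 < dist (g 1) z" by simp
  then obtain r \<theta> \<theta>' t s C0 C1 where sc: "smallcut (dist (g 1) z) r \<theta> \<theta>' t s C0 C1"
    and av: "\<And>u. u \<in> {0..1} \<Longrightarrow> cutval r \<theta> \<theta>' u \<notin> \<alpha> ` L" using cuts by metis
  have cc: "crosscut r \<theta> \<theta>' t s C0 C1" using sc by (simp add: smallcut_def)
  note cs = crosscut_sets[OF cc]
  have sep: "L \<inter> circ (g 1) r ` open_segment \<theta> \<theta>' = {}"
  proof (rule ccontr)
    assume "\<not> ?thesis"
    then obtain u where u: "u \<in> {0<..<1}" "cut r \<theta> \<theta>' u \<in> L"
      unfolding cut_image[OF cc, symmetric] by blast
    then have "cutval r \<theta> \<theta>' u \<in> \<alpha> ` L" by (auto simp: cutval_def)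
    then show False using av[of u] u(1) by auto
  qed
  then have L01: "L \<subseteq> C0 \<union> C1" using assms(2) cs(4) by blast
  have "z \<notin> C1" using sc unfolding smallcut_def by auto
  then have "z \<in> C0" using L01 z(1) by blast
  then have "L \<inter> C1 = {}"
    using connectedD[OF assms(1) cs(1,2) _ L01] cs(3) z(1) by blast
  then have "xs n \<in> C0" for n using L01 assms(3) by blast
  then have "g 1 \<in> closure C0" using assms(4) closure_sequential by blast
  then show False using cs(6) by blast
qed

text \<open>The image of the cut ends at \<open>\<alpha> (h s)\<close>, where \<open>s\<close> may
  differ from \<open>t\<close>; following \<open>h\<close> from \<open>s\<close> to \<open>t\<close>
  corrects the end to the start plus one.\<close>

definition tau :: "real \<Rightarrow> real \<Rightarrow> real \<Rightarrow> real \<Rightarrow> real \<Rightarrow> real \<Rightarrow> complex" where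
  "tau r \<theta> \<theta>' t s = cutval r \<theta> \<theta>' +++ (\<alpha> \<circ> subpath s t h)"

context
  fixes r \<theta> \<theta>' t s :: real and C0 C1 :: "complex set"
  assumes cc: "crosscut r \<theta> \<theta>' t s C0 C1"
begin

private lemma closed_segment_ts: "closed_segment s t \<subseteq> {0<..<1}"
  using crosscut_ts[OF cc] by (auto simp: closed_segment_eq_real_ivl)

lemma path_tau: "path (tau r \<theta> \<theta>' t s)"
proof -
  have "path (\<alpha> \<circ> subpath s t h)"
  proof (rule path_continuous_image)
    show "path (subpath s t h)" using path_h crosscut_ts[OF cc] by auto
    have "path_image (subpath s t h) \<subseteq> H"
      using closed_segment_ts in_H(2) crosscut_ts[OF cc] by (auto simp: path_image_subpath_gen)
    then show "continuous_on (path_image (subpath s t h)) \<alpha>" by (rule continuous_on_subset[OF \<alpha>_continuous])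
  qed
  moreover have "pathfinish (cutval r \<theta> \<theta>') = pathstart (\<alpha> \<circ> subpath s t h)"
    using cutval_ends[OF cc] \<alpha>_h crosscut_ts[OF cc] by (simp add: pathfinish_def pathstart_def subpath_def)
  ultimately show ?thesis unfolding tau_def using path_cutval[OF cc] by simp
qed

lemma tau_ends: "tau r \<theta> \<theta>' t s 0 = \<alpha> (g t)" "tau r \<theta> \<theta>' t s 1 = \<alpha> (g t) + 1"
  using cutval_ends[OF cc] \<alpha>_h[OF crosscut_ts(1)[OF cc]] by (simp_all add: tau_def joinpaths_def subpath_def)

lemma tau_cases:
  assumes \<xi>: "\<xi> \<in> {0..1}"
  shows "(\<xi> \<le> 1/2 \<and> tau r \<theta> \<theta>' t s \<xi> = cutval r \<theta> \<theta>' (2 * \<xi>)) \<or>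
    (\<exists>w\<in>{0<..<1}. tau r \<theta> \<theta>' t s \<xi> = \<alpha> (g w) + 1)"
proof (cases "\<xi> \<le> 1/2")
  case True then show ?thesis by (simp add: tau_def joinpaths_def)
next
  case False
  have "s + (2 * \<xi> - 1) * (t - s) \<in> closed_segment s t"
    unfolding segment_real_image(1) using \<xi> False by (intro imageI) auto
  then have "s + (2 * \<xi> - 1) * (t - s) \<in> {0<..<1}" using closed_segment_ts by blast
  moreover have "tau r \<theta> \<theta>' t s \<xi> = \<alpha> (h (s + (2 * \<xi> - 1) * (t - s)))"
    using False by (simp add: tau_def joinpaths_def subpath_def algebra_simps)
  ultimately show ?thesis using \<alpha>_h by auto
qed

end

text \<open>If a translate entered the image of \<open>C0\<close>, its point of entry would come
  from a boundary point of \<open>C0\<close>. This is not \<open>g 1\<close> by the choice of the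
  side, nor \<open>g 0\<close> by \<open>avoid\<close>; all other positions contradict
  \<open>cutval_gap\<close> or injectivity, except \<open>h t\<close> for the start of the first
  translate. There it is decisive that \<open>F\<close> maps the inner side of \<open>g\<close> to
  the outer side of \<open>h\<close>.\<close>

lemma translate_avoids_main_part:
  assumes cc: "crosscut r \<theta> \<theta>' t s C0 C1"
    and small: "\<And>u. u \<in> {0..1} \<Longrightarrow> norm (cutval r \<theta> \<theta>' u - w0) < 1/4"
    and good: "deriv \<alpha> (g t) \<noteq> 0"
    and avoid: "\<And>k L xs. k \<ge> (1::int) \<Longrightarrow> connected L \<Longrightarrow> L \<subseteq> C \<Longrightarrow> (\<And>n::nat. xs n \<in> L) \<Longrightarrow>
        \<alpha> ` L \<subseteq> (\<lambda>y. y + of_int k) ` path_image (tau r \<theta> \<theta>' t s) \<Longrightarrow> \<not> xs \<longlonglongrightarrow> g 0"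
    and k: "k \<ge> 1"
  shows "(\<lambda>y. y + of_int k) ` path_image (tau r \<theta> \<theta>' t s) \<inter> \<alpha> ` C0 = {}"
proof -
  define q where "q = tau r \<theta> \<theta>' t s"
  have ts: "t \<in> {0<..<1}" "s \<in> {0<..<1}" using crosscut_ts[OF cc] by auto
  define c where "c = cutval r \<theta> \<theta>'"
  have pq: "path q" and q01: "q 0 = \<alpha> (g t)" "q 1 = \<alpha> (g t) + 1"
    using path_tau[OF cc] tau_ends[OF cc] by (simp_all add: q_def)
  have qcase: "(\<xi> \<le> 1/2 \<and> q \<xi> = c (2 * \<xi>)) \<or> (\<exists>w\<in>{0<..<1}. q \<xi> = \<alpha> (g w) + 1)" if "\<xi> \<in> {0..1}" for \<xi>
    using tau_cases[OF cc that] by (simp add: q_def c_def)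
  have gap: "j = 0 \<or> j = 1" if "u \<in> {0..1}" "w \<in> {0<..<1}" "c u = \<alpha> (g w) + of_int j" for u w j
    using cutval_gap[OF cc small that(1,2)] that(3) unfolding c_def by blast
  have C0C: "C0 \<subseteq> C" using crosscut_sets(4)[OF cc] by blast
  \<comment> \<open>It suffices that a translate starts off the image of \<open>C0\<close>; this
    start is the end of the preceding translate.\<close>
  have advance: "(\<lambda>y. y + of_int k) ` path_image q \<inter> \<alpha> ` C0 = {}"
    if k1: "k \<ge> 1" and start: "q 0 + of_int k \<notin> \<alpha> ` C0" for k :: int
  proof (rule ccontr)
    assume "\<not> ?thesis"
    then obtain \<xi> where \<xi>: "\<xi> \<in> {0..1}" "q \<xi> + of_int k \<in> \<alpha> ` C0" unfolding path_image_def by blast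
    define q' where "q' = (\<lambda>\<xi>. q \<xi> + of_int k)"
    have pq': "path q'" using pq unfolding q'_def path_def by (intro continuous_intros)
    have imq': "path_image q' = (\<lambda>y. y + of_int k) ` path_image q" by (auto simp: q'_def path_image_def)
    obtain \<xi>0 x xs \<xi>s L where x0: "\<xi>0 \<in> {0..1}" "q' \<xi>0 \<notin> \<alpha> ` C0" "x \<in> closure C0"
      and sq: "\<And>n::nat. \<xi>s n \<in> {\<xi>0<..1}" "\<And>n. xs n \<in> L" "\<And>n. \<alpha> (xs n) = q' (\<xi>s n)" "\<xi>s \<longlonglongrightarrow> \<xi>0" "xs \<longlonglongrightarrow> x"
      and L: "connected L" "L \<subseteq> C0" "\<alpha> ` L \<subseteq> path_image q'"
    proof -
      have ex: "q' \<xi> \<in> \<alpha> ` C0" "q' 0 \<notin> \<alpha> ` C0" using \<xi>(2) start by (simp_all add: q'_def)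
      show ?thesis
        by (rule exit_point[OF crosscut_sets(1)[OF cc] C0C pq' \<xi>(1) ex]; rule that; assumption)
    qed
    have LC: "L \<subseteq> C" using L(2) C0C by blast
    have xQ: "x \<noteq> g 1" using x0(3) crosscut_sets(6)[OF cc] by auto
    have xP: "x \<noteq> g 0" using avoid[OF k1 L(1) LC sq(2) L(3)[unfolded imq' q_def]] sq(5) by auto
    have xCJ: "x \<in> C \<union> J" using x0(3) closure_mono[OF C0C] closure_C by blast
    have xH: "x \<in> H"
    proof -
      consider "x \<in> C" | w where "w \<in> {0..1}" "x = g w" | w where "w \<in> {0..1}" "x = h w"
        using xCJ unfolding J_def path_image_def by blast
      then show ?thesis
      proof cases
        case 1 then show ?thesis by (rule in_H(3))
      next
        case 2
        then have "w \<noteq> 0" "w \<noteq> 1" using xP xQ by auto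
        then show ?thesis using 2 in_H(1)[of w] by auto
      next
        case 3
        then have "w \<noteq> 0" "w \<noteq> 1" using xP xQ start_eq finish_eq by auto
        then show ?thesis using 3 in_H(2)[of w] by auto
      qed
    qed
    have sq01: "\<xi>s n \<in> {0..1}" for n using sq(1)[of n] x0(1) by auto
    have LH: "xs n \<in> H" for n using sq(2) LC in_H(3) by blast
    have ax: "\<alpha> x = q' \<xi>0"
    proof (rule LIMSEQ_unique)
      show "(\<lambda>n. \<alpha> (xs n)) \<longlonglongrightarrow> \<alpha> x"
        by (rule continuous_on_tendsto_compose[OF \<alpha>_continuous sq(5) xH]) (simp add: LH)
      show "(\<lambda>n. \<alpha> (xs n)) \<longlonglongrightarrow> q' \<xi>0"
        unfolding sq(3)
        by (rule continuous_on_tendsto_compose[OF pq'[unfolded path_def] sq(4) x0(1)])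
           (rule always_eventually, rule allI, rule sq01)
    qed
    have C1n: "x \<notin> C1"
      using x0(3) crosscut_sets(2,3)[OF cc] by (meson disjoint_iff open_Int_closure_eq_empty Int_commute)
    \<comment> \<open>The limit \<open>x\<close> lies on the crosscut, on \<open>g\<close> or on
      \<open>h\<close>. Its value on the translate by \<open>k\<close> would yield a long chord of
      the tiny image, a hit of index other than 0 and 1, or a common point of two translates of the
      curve; only the starting point of the first translate survives.\<close>
    have key: "\<xi>0 = 0 \<and> k = 1 \<and> x = h t"
    proof -
      consider "x \<in> C" | w where "w \<in> {0<..<1}" "x = g w" | w where "w \<in> {0<..<1}" "x = h w"
        using xH unfolding H_def by blast
      then show ?thesis
      proof cases
        case 1
        have "x \<notin> C0" using ax x0(2) by (metis imageI)
        then have "x \<in> cut r \<theta> \<theta>' ` {0<..<1}" using 1 C1n crosscut_sets(4)[OF cc] unfolding cut_image[OF cc] by blast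
        then obtain u where u: "u \<in> {0<..<1}" "\<alpha> x = c u" by (auto simp: c_def cutval_def)
        have False using qcase[OF x0(1)]
        proof (elim disjE bexE conjE)
          assume "\<xi>0 \<le> 1/2" "q \<xi>0 = c (2 * \<xi>0)"
          then have e: "c u - c (2 * \<xi>0) = of_int k" using ax u(2) by (simp add: q'_def)
          have "norm (c u - c (2 * \<xi>0)) \<le> norm (c u - w0) + norm (c (2 * \<xi>0) - w0)"
            using norm_triangle_ineq4[of "c u - w0" "c (2 * \<xi>0) - w0"] by simp
          also have "\<dots> < 1/4 + 1/4"
            using small[of u] small[of "2 * \<xi>0"] u(1) x0(1) \<open>\<xi>0 \<le> 1/2\<close> unfolding c_def by (intro add_strict_mono) auto
          finally have "norm (of_int k :: complex) < 1" unfolding e by simp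
          then show False using k1 by simp
        next
          fix w :: real assume "w \<in> {0<..<1}" "q \<xi>0 = \<alpha> (g w) + 1"
          then have "c u = \<alpha> (g w) + of_int (1 + k)" using ax u(2) by (simp add: q'_def)
          then show False using gap[of u w "1 + k"] u(1) \<open>w \<in> _\<close> k1 by auto
        qed
        then show ?thesis ..
      next
        case 2
        have False using qcase[OF x0(1)]
        proof (elim disjE bexE conjE)
          assume h: "\<xi>0 \<le> 1/2" "q \<xi>0 = c (2 * \<xi>0)"
          then have "c (2 * \<xi>0) = \<alpha> (g w) + of_int (- k)" using ax 2 by (simp add: q'_def)
          then show False using gap[of "2 * \<xi>0" w "- k"] h(1) x0(1) 2(1) k1 by auto
        next
          fix v :: real assume "v \<in> {0<..<1}" "q \<xi>0 = \<alpha> (g v) + 1"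
          then have "\<alpha> (g v) + of_int (1 + k) = \<alpha> (g w)" using ax 2 by (simp add: q'_def add.assoc)
          then show False using \<alpha>_g_translate[OF \<open>v \<in> _\<close> 2(1)] k1 by fastforce
        qed
        then show ?thesis ..
      next
        case 3
        have aw: "\<alpha> x = \<alpha> (g w) + 1" using 3 \<alpha>_h by simp
        show ?thesis using qcase[OF x0(1)]
        proof (elim disjE bexE conjE)
          assume h: "\<xi>0 \<le> 1/2" "q \<xi>0 = c (2 * \<xi>0)"
          then have e: "c (2 * \<xi>0) = \<alpha> (g w) + of_int (1 - k)" using ax aw by (simp add: q'_def algebra_simps)
          have u: "2 * \<xi>0 \<in> {0..1}" using h(1) x0(1) by auto
          have "1 - k = 0 \<or> 1 - k = 1" by (rule gap[OF u 3(1) e])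
          then have k: "k = 1" using k1 by simp
          then have "c (2 * \<xi>0) = \<alpha> (g w)" using e by simp
          then have "2 * \<xi>0 = 0 \<and> w = t" using cutval_g(1)[OF cc u 3(1)] by (simp add: c_def)
          then show ?thesis using k 3 by simp
        next
          fix v :: real assume "v \<in> {0<..<1}" "q \<xi>0 = \<alpha> (g v) + 1"
          then have "\<alpha> (g v) + of_int k = \<alpha> (g w)" using ax aw by (simp add: q'_def)
          then show ?thesis using \<alpha>_g_translate[OF \<open>v \<in> _\<close> 3(1)] k1 by fastforce
        qed
      qed
    qed
    obtain u1 u2 e where gp: "e > 0" "\<And>x. x \<in> ball (g t) e \<Longrightarrow> x \<in> C \<Longrightarrow> F x \<notin> C"
      by (rule good_point[OF ts(1) good]) blast
    obtain S where S: "open S" "H \<subseteq> S" "\<alpha> holomorphic_on S" by (rule \<alpha>_holomorphic)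
    obtain e2 where e2: "e2 > 0" "inj_on \<alpha> (ball (h t) e2)"
      using has_complex_derivative_locally_injective[OF S(3) _ S(1) deriv_h_nonzero[OF ts(1) good]] S(2) in_H(2)[OF ts(1)]
      by blast
    obtain e3 where e3: "e3 > 0" "e3 \<le> e2" "F ` ball (g t) e3 \<subseteq> ball (h t) e2"
       "\<And>x. x \<in> ball (g t) e3 \<Longrightarrow> \<alpha> (F x) = \<alpha> x + 1"
      by (rule \<alpha>_F[OF ts(1) e2(1)]) blast
    \<comment> \<open>Just after its start the first translate consists of the values
      \<open>\<alpha> (y n) + 1\<close>, that is \<open>\<alpha> (F (y n))\<close>, near
      \<open>h t\<close>. Local injectivity of \<open>\<alpha>\<close> identifies
      \<open>xs n\<close> with \<open>F (y n)\<close>, which lies outside \<open>C\<close>.\<close>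
    define y where "y = (\<lambda>n. cut r \<theta> \<theta>' (2 * \<xi>s n))"
    have lim2: "(\<lambda>n. 2 * \<xi>s n) \<longlonglongrightarrow> 0" using tendsto_mult[OF tendsto_const[of 2] sq(4)] key by simp
    have "isCont (cut r \<theta> \<theta>') 0"
      unfolding cut_def circ_def cis_conv_exp by (intro continuous_intros)
    then have ylim: "y \<longlonglongrightarrow> g t"
      using isCont_tendsto_compose[OF _ lim2, of "cut r \<theta> \<theta>'"] cut_ends(1)[OF cc] by (simp add: y_def)
    have "\<forall>\<^sub>F n in sequentially. dist (y n) (g t) < min e e3"
      by (rule tendstoD[OF ylim]) (use gp(1) e3(1) in simp)
    moreover have "\<forall>\<^sub>F n in sequentially. dist (xs n) (h t) < e2"
      using tendstoD[OF sq(5), of e2] key e2(1) by simp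
    moreover have "\<forall>\<^sub>F n in sequentially. 2 * \<xi>s n < 1"
      using lim2 by (rule order_tendstoD) simp
    ultimately have "\<forall>\<^sub>F n in sequentially. dist (y n) (g t) < min e e3 \<and> dist (xs n) (h t) < e2 \<and> 2 * \<xi>s n < 1"
      by eventually_elim auto
    then obtain n where n: "dist (y n) (g t) < min e e3" "dist (xs n) (h t) < e2" "2 * \<xi>s n < 1"
      by (auto dest: eventually_happens)
    have u: "2 * \<xi>s n \<in> {0<..<1}" using n(3) sq(1)[of n] key by auto
    have yC: "y n \<in> C" unfolding y_def by (rule cut_in_C[OF cc u])
    have "q (\<xi>s n) = \<alpha> (y n)" using n(3) by (simp add: q_def tau_def joinpaths_def y_def cutval_def)
    then have "\<alpha> (xs n) = \<alpha> (y n) + 1" using sq(3)[of n] key by (simp add: q'_def)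
    also have "\<dots> = \<alpha> (F (y n))" using e3(4)[of "y n"] n(1) by (simp add: dist_commute)
    finally have eq: "\<alpha> (xs n) = \<alpha> (F (y n))" .
    have "y n \<in> ball (g t) e3" "xs n \<in> ball (h t) e2" using n(1,2) by (simp_all add: dist_commute)
    moreover from this(1) have "F (y n) \<in> ball (h t) e2" using e3(3) by blast
    ultimately have "xs n = F (y n)" using inj_onD[OF e2(2) eq] by blast
    moreover have "F (y n) \<notin> C" using gp(2)[of "y n"] n(1) yC by (simp add: dist_commute)
    ultimately show False using sq(2)[of n] LC by auto
  qed
  have "(\<lambda>y. y + of_int k) ` path_image q \<inter> \<alpha> ` C0 = {}"
    using k
  proof (induction k rule: int_ge_induct)
    case base
    show ?case
    proof (rule advance)
      show "q 0 + of_int 1 \<notin> \<alpha> ` C0"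
      proof
        assume "q 0 + of_int 1 \<in> \<alpha> ` C0"
        then obtain z where "z \<in> C" "\<alpha> z = \<alpha> (g t) + 1" using C0C q01 by auto
        then show False using \<alpha>_C_neq(2)[OF _ ts(1)] by blast
      qed
    qed simp
  next
    case (step i)
    show ?case
    proof (rule advance)
      have "q 1 + of_int i \<in> (\<lambda>y. y + of_int i) ` path_image q" unfolding path_image_def by (intro imageI) simp
      then have "q 1 + of_int i \<notin> \<alpha> ` C0" using step.IH by blast
      then show "q 0 + of_int (i + 1) \<notin> \<alpha> ` C0" using q01 by (simp add: algebra_simps)
    qed (use step.hyps in simp)
  qed
  then show ?thesis by (simp add: q_def)
qed

end

section \<open>Disjointness of the translates\<close>

context two_arcs
begin

text \<open>Both arcs run from \<open>g 0\<close> to \<open>g 1\<close>, so reversing both exchanges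
  the fixed points and keeps \<open>J\<close> and \<open>C\<close>. Statements about
  \<open>g 1\<close> thereby hold at \<open>g 0\<close> as well.\<close>

lemma two_arcs_reverse: "two_arcs (reversepath g) (reversepath h)"
proof
  show "path_image (reversepath g) \<inter> path_image (reversepath h) = {reversepath g 0, reversepath g 1}"
    using meet by (simp add: insert_commute) (simp add: reversepath_def insert_commute)
qed (use arc_g arc_h start_eq finish_eq in \<open>simp_all add: arc_reversepath, simp_all add: reversepath_def\<close>)

lemma reverse_J: "two_arcs.J (reversepath g) (reversepath h) = J"
  by (simp add: two_arcs.J_def[OF two_arcs_reverse] J_def)

lemma reverse_C: "two_arcs.C (reversepath g) (reversepath h) = C"
  by (simp add: two_arcs.C_def[OF two_arcs_reverse] C_def reverse_J)

end

lemma reversepath_image_open: "reversepath p ` {0<..<1} = p ` {0<..<1}"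
proof -
  have "(\<lambda>t. 1 - t) ` {0<..<1::real} = {0<..<1}"
  proof (intro equalityI subsetI)
    fix x :: real assume "x \<in> {0<..<1}"
    then have "x = 1 - (1 - x)" "1 - x \<in> {0<..<1}" by auto
    then show "x \<in> (\<lambda>t. 1 - t) ` {0<..<1}" by blast
  qed auto
  then show ?thesis unfolding reversepath_def by (metis image_image)
qed

context tile
begin

lemma tile_reverse: "tile (reversepath g) (reversepath h) \<alpha> F"
proof (intro tile.intro two_arcs_reverse tile_axioms.intro)
  show "F analytic_on reversepath g ` {0<..<1}" using F_analytic by (simp only: reversepath_image_open)
  show "\<alpha> analytic_on reversepath g ` {0<..<1} \<union> two_arcs.C (reversepath g) (reversepath h) \<union> reversepath h ` {0<..<1}"
    using \<alpha>_analytic by (simp only: reversepath_image_open reverse_C)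
  show "inj_on \<alpha> (reversepath g ` {0<..<1} \<union> two_arcs.C (reversepath g) (reversepath h) \<union> reversepath h ` {0<..<1})"
    using \<alpha>_inj by (simp only: reversepath_image_open reverse_C)
  show "F (reversepath g u) = reversepath h u" if "u \<in> {0<..<1}" for u
    using F_g[of "1 - u"] that by (simp add: reversepath_def)
  show "\<alpha> (reversepath h u) = \<alpha> (reversepath g u) + 1" if "u \<in> {0<..<1}" for u
    using \<alpha>_h[of "1 - u"] that by (simp add: reversepath_def)
qed

lemma countable_integer_translates: "countable {x \<in> H. \<exists>k::int. \<alpha> x = w + of_int k}"
proof -
  have "countable (range (\<lambda>k::int. w + of_int k))" by simp
  then have "countable (\<alpha> ` {x \<in> H. \<exists>k::int. \<alpha> x = w + of_int k})"
    by (rule countable_subset[rotated]) auto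
  then show ?thesis by (rule countable_image_inj_on) (use \<alpha>_injD in \<open>auto simp: inj_on_def\<close>)
qed

text \<open>The translates of the arc \<open>tau\<close>, which joins \<open>\<alpha> (g t)\<close> to \<open>\<alpha> (g t) + 1\<close>, chain up to a
  ray to infinity that avoids the loop \<open>p\<close>.\<close>

lemma tail_winding_number_zero:
  assumes p: "path p" "pathfinish p = pathstart p" and v: "0 < v" "v < 1"
    and E1: "compact E1" "E1 \<subseteq> C \<union> g ` {0<..<1}" and E2: "compact E2" "E2 \<subseteq> C \<union> h ` {0<..<1}"
    and pE: "path_image p \<subseteq> \<alpha> ` E1 \<union> (\<lambda>x. \<alpha> x - 1) ` E2"
    and avoid: "\<And>u. v \<le> u \<Longrightarrow> u < 1 \<Longrightarrow> \<alpha> (g u) \<notin> path_image p"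
  shows "winding_number p (\<alpha> (g v)) = 0"
proof -
  have const: "winding_number p (\<alpha> (g v)) = winding_number p (\<alpha> (g t))" if "v < t" "t < 1" for t
  proof (rule winding_number_eq[OF p])
    show "\<alpha> (g v) \<in> (\<lambda>u. \<alpha> (g u)) ` {v..<1}" "\<alpha> (g t) \<in> (\<lambda>u. \<alpha> (g u)) ` {v..<1}" using v that by auto
    show "connected ((\<lambda>u. \<alpha> (g u)) ` {v..<1})"
      by (intro connected_continuous_image continuous_on_subset[OF continuous_\<alpha>_g]) (use v in auto)
    show "(\<lambda>u. \<alpha> (g u)) ` {v..<1} \<inter> path_image p = {}" using avoid by auto
  qed
  obtain B where B: "\<And>z. B \<le> norm z \<Longrightarrow> winding_number p z = 0"
    using winding_number_zero_at_infinity[OF p] by blast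
  \<comment> \<open>Crosscuts within a disc around \<open>g 1\<close> that avoids \<open>K\<close>
    lie beyond the parameter \<open>v\<close> and beyond the points that generate the loop.\<close>
  define K where "K = E1 \<union> E2 \<union> g ` {0..v}"
  have K: "compact K" unfolding K_def
    by (intro compact_Un E1 E2 compact_continuous_image continuous_on_subset[OF continuous_g]) (use v in auto)
  have "g 1 \<notin> K"
  proof
    assume "g 1 \<in> K"
    then have K: "g 1 \<in> E1 \<union> E2 \<or> g 1 \<in> g ` {0..v}" by (auto simp: K_def)
    have C: "g 1 \<notin> C" using not_in_C(1)[of 1] by simp
    have "g 1 \<noteq> g x" "g 1 \<noteq> h x" if "x \<in> {0..<1}" for x
      using inj_onD[OF inj_g, of 1 x] inj_onD[OF inj_h, of 1 x] finish_eq that by auto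
    then have "g 1 \<notin> g ` {0..<1}" "g 1 \<notin> h ` {0..<1}" by blast+
    moreover have "{0<..<1} \<subseteq> {0..<1::real}" "{0..v} \<subseteq> {0..<1}" using v by auto
    ultimately have "g 1 \<notin> g ` {0<..<1}" "g 1 \<notin> g ` {0..v}" "g 1 \<notin> h ` {0<..<1}" by blast+
    with K C show False using E1(2) E2(2) by blast
  qed
  then obtain \<rho> where \<rho>: "\<rho> > 0" "ball (g 1) \<rho> \<subseteq> - K"
    using openE[of "- K" "g 1"] compact_imp_closed[OF K] by auto
  have after: "v < t" if "smallcut \<rho> r \<theta> \<theta>' t s C0 C1" for r \<theta> \<theta>' t s C0 C1
  proof (rule ccontr)
    assume "\<not> v < t"
    have cc: "crosscut r \<theta> \<theta>' t s C0 C1" using that by (simp add: smallcut_def)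
    have "g t \<in> g ` {t..1}" using crosscut_ts(1)[OF cc] by auto
    then have "g t \<in> ball (g 1) \<rho>" using that unfolding smallcut_def by blast
    moreover have "g t \<in> K" using crosscut_ts(1)[OF cc] \<open>\<not> v < t\<close> by (auto simp: K_def)
    ultimately show False using \<rho>(2) by blast
  qed
  show ?thesis
  proof (cases far)
    case True
    then obtain r \<theta> \<theta>' t s C0 C1 where sc: "smallcut \<rho> r \<theta> \<theta>' t s C0 C1" "\<And>u. u \<in> {0..1} \<Longrightarrow> B < norm (cutval r \<theta> \<theta>' u)"
      using \<rho>(1) unfolding far_def by metis
    have cc: "crosscut r \<theta> \<theta>' t s C0 C1" using sc by (simp add: smallcut_def)
    \<comment> \<open>The cut starts at a point of the tail whose value is so large that the winding
      number of \<open>p\<close> vanishes there.\<close>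
    have "B < norm (\<alpha> (g t))" using sc(2)[of 0] cutval_ends(1)[OF cc] by simp
    then show ?thesis using B const after[OF sc(1)] crosscut_ts(1)[OF cc] by auto
  next
    case False
    obtain M where M: "\<And>\<epsilon> \<rho> Z. 0 < \<epsilon> \<Longrightarrow> 0 < \<rho> \<Longrightarrow> countable Z \<Longrightarrow> \<exists>r \<theta> \<theta>' t s C0 C1 w. smallcut \<rho> r \<theta> \<theta>' t s C0 C1 \<and> r \<notin> Z \<and>
      norm w \<le> M \<and> (\<forall>u\<in>{0..1}. norm (cutval r \<theta> \<theta>' u - w) < \<epsilon>)"
      using not_far[OF False] by metis
    interpret R: tile "reversepath g" "reversepath h" \<alpha> F by (rule tile_reverse)
    have rg: "reversepath g 1 = g 0" by (simp add: reversepath_def)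
    obtain w' where w': "R.far \<or> R.limit_value w'" using R.not_far_limit_value by metis
    \<comment> \<open>The radius is to avoid the zeros of \<open>deriv \<alpha>\<close> on
      \<open>g\<close> and all points whose value is congruent to \<open>w'\<close> modulo the
      integers. Then no translate of the crosscut image contains the limit value \<open>w'\<close>
      of the opposite end. If that end is \<open>far\<close>, \<open>w'\<close> is
      arbitrary.\<close>
    define Z where "Z = (\<lambda>u. dist (g 1) (g u)) ` {u \<in> {0<..<1}. deriv \<alpha> (g u) = 0} \<union>
      dist (g 1) ` {x \<in> H. \<exists>k::int. \<alpha> x = w' + of_int k}"
    have "countable Z" unfolding Z_def
      by (intro countable_Un countable_image countable_bad countable_integer_translates)
    with M[of "1/4" \<rho> Z] \<rho>(1) have "\<exists>r \<theta> \<theta>' t s C0 C1 w. smallcut \<rho> r \<theta> \<theta>' t s C0 C1 \<and> r \<notin> Z \<and>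
      norm w \<le> M \<and> (\<forall>u\<in>{0..1}. norm (cutval r \<theta> \<theta>' u - w) < 1/4)"
      by (metis zero_less_divide_1_iff zero_less_numeral)
    then obtain r \<theta> \<theta>' t s C0 C1 w0 where sc: "smallcut \<rho> r \<theta> \<theta>' t s C0 C1" and rZ: "r \<notin> Z"
      and tiny: "\<And>u. u \<in> {0..1} \<Longrightarrow> norm (cutval r \<theta> \<theta>' u - w0) < 1/4"
      by blast
    have cc: "crosscut r \<theta> \<theta>' t s C0 C1" using sc by (simp add: smallcut_def)
    note ts = crosscut_ts(1,2)[OF cc]
    define q where "q = tau r \<theta> \<theta>' t s"
    have pq: "path q" and q01: "q 0 = \<alpha> (g t)" "q 1 = \<alpha> (g t) + 1"
      using path_tau[OF cc] tau_ends[OF cc] by (simp_all add: q_def)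
    have good: "deriv \<alpha> (g t) \<noteq> 0"
    proof
      assume "deriv \<alpha> (g t) = 0"
      then have "dist (g 1) (g t) \<in> Z" using ts(1) by (auto simp: Z_def)
      then show False using rZ dist_cut[OF cc, of 0] cut_ends(1)[OF cc] by simp
    qed
    \<comment> \<open>A part of the translate lifting to a set in \<open>C\<close> that accumulates
      at \<open>g 0\<close> would have to meet small crosscut images at that end, but
      \<open>R.exists_cut_avoiding\<close> supplies arbitrarily small ones that miss the
      translate.\<close>
    have W: "(\<lambda>y. y + of_int k) ` path_image q \<inter> \<alpha> ` C0 = {}" if k: "k \<ge> 1" for k :: int
      unfolding q_def
    proof (rule translate_avoids_main_part[OF cc tiny good _ k])
      fix k :: int and L :: "complex set" and xs :: "nat \<Rightarrow> complex"
      assume k: "k \<ge> 1" and L: "connected L" "L \<subseteq> C" "\<And>n. xs n \<in> L"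
        and aL: "\<alpha> ` L \<subseteq> (\<lambda>y. y + of_int k) ` path_image (tau r \<theta> \<theta>' t s)"
      define X where "X = (\<lambda>y. y + of_int k) ` path_image q"
      define Y where "Y = (\<lambda>u. cutval r \<theta> \<theta>' u + of_int k) ` {0..1}"
      have "bounded X" unfolding X_def
        by (intro compact_imp_bounded compact_continuous_image continuous_intros compact_path_image pq)
      have "closed Y" unfolding Y_def
        by (intro compact_imp_closed compact_continuous_image continuous_intros path_cutval[OF cc, unfolded path_def]) simp
      have wY: "w' \<notin> Y"
      proof
        assume "w' \<in> Y"
        then obtain u where u: "u \<in> {0..1}" "w' = \<alpha> (cut r \<theta> \<theta>' u) + of_int k" unfolding Y_def cutval_def by blast
        then have "\<alpha> (cut r \<theta> \<theta>' u) = w' + of_int (- k)" by simp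
        then have "dist (g 1) (cut r \<theta> \<theta>' u) \<in> Z" unfolding Z_def using cut_in_H[OF cc u(1)] by blast
        then show False using rZ dist_cut[OF cc] by simp
      qed
      have XY: "x \<in> Y \<or> (\<exists>w\<in>{0<..<1}. \<exists>k::int. k \<noteq> 0 \<and> k \<noteq> 1 \<and> x = \<alpha> (reversepath g w) + of_int k)" if "x \<in> X" for x
      proof -
        obtain \<xi> where \<xi>: "\<xi> \<in> {0..1}" "x = q \<xi> + of_int k" using \<open>x \<in> X\<close> unfolding X_def path_image_def by blast
        from tau_cases[OF cc \<xi>(1)] show ?thesis
        proof (elim disjE bexE conjE)
          assume "\<xi> \<le> 1 / 2" "tau r \<theta> \<theta>' t s \<xi> = cutval r \<theta> \<theta>' (2 * \<xi>)"
          then have "2 * \<xi> \<in> {0..1}" "x = cutval r \<theta> \<theta>' (2 * \<xi>) + of_int k" using \<xi> by (auto simp: q_def)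
          then show ?thesis unfolding Y_def by blast
        next
          fix w :: real assume w: "w \<in> {0<..<1}" "tau r \<theta> \<theta>' t s \<xi> = \<alpha> (g w) + 1"
          then have "1 - w \<in> {0<..<1}" "1 + k \<noteq> 0" "1 + k \<noteq> 1" "x = \<alpha> (reversepath g (1 - w)) + of_int (1 + k)"
            using \<xi> k by (auto simp: q_def reversepath_def)
          then show ?thesis by blast
        qed
      qed
      have "R.far \<or> (\<exists>w. R.limit_value w \<and> w \<notin> Y)" using w' wY by blast
      note ex = R.exists_cut_avoiding[OF this \<open>bounded X\<close> \<open>closed Y\<close> _ XY]
      show "\<not> xs \<longlonglongrightarrow> g 0"
      proof
        assume "xs \<longlonglongrightarrow> g 0"
        then have lim: "xs \<longlonglongrightarrow> reversepath g 1" by (simp add: rg)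
        have LC: "L \<subseteq> R.C" using L(2) by (simp add: reverse_C)
        show False
        proof (rule R.not_tendsto_end[OF L(1) LC L(3) lim])
          fix \<rho>' :: real assume "0 < \<rho>'"
          from ex[OF this] obtain r' \<phi> \<phi>' t' s' C0' C1' where
            "R.smallcut \<rho>' r' \<phi> \<phi>' t' s' C0' C1'" "\<And>u. u \<in> {0..1} \<Longrightarrow> R.cutval r' \<phi> \<phi>' u \<notin> X"
            by metis
          moreover have "\<alpha> ` L \<subseteq> X" using aL by (simp add: X_def q_def)
          ultimately show "\<exists>r \<theta> \<theta>' t s C0 C1. R.smallcut \<rho>' r \<theta> \<theta>' t s C0 C1 \<and> (\<forall>u\<in>{0..1}. R.cutval r \<theta> \<theta>' u \<notin> \<alpha> ` L)"
            by blast
        qed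
      qed
    qed
    have C0C: "C0 \<subseteq> C" using crosscut_sets(4)[OF cc] by blast
    have vt: "v < t" by (rule after[OF sc])
    have cutball: "cut r \<theta> \<theta>' u \<in> ball (g 1) \<rho>" for u
      using dist_cut[OF cc] sc by (simp add: smallcut_def)
    have EC0: "x \<in> C0" if "x \<in> E1 \<union> E2" "x \<in> C" for x
    proof -
      have "x \<notin> ball (g 1) \<rho>" using that(1) \<rho>(2) by (auto simp: K_def)
      moreover have "C1 \<subseteq> ball (g 1) \<rho>" using sc by (simp add: smallcut_def)
      moreover have "cut r \<theta> \<theta>' ` {0<..<1} \<subseteq> ball (g 1) \<rho>" using cutball by blast
      ultimately show ?thesis using that(2) crosscut_sets(4)[OF cc] unfolding cut_image[OF cc] by blast
    qed
    \<comment> \<open>A common point on the curve forces a hit of index 0, hence the parameter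
      \<open>t\<close>; but there the loop does not meet the curve, since \<open>t\<close> lies
      beyond \<open>v\<close>.\<close>
    have avg: False if \<xi>: "\<xi> \<in> {0..1}" and w: "w \<in> {0<..<1}" and eq: "q \<xi> + of_nat n = \<alpha> (g w)" and im: "\<alpha> (g w) \<in> path_image p" for \<xi> w n
      using tau_cases[OF cc \<xi>]
    proof (elim disjE bexE conjE)
      assume h: "\<xi> \<le> 1 / 2" "tau r \<theta> \<theta>' t s \<xi> = cutval r \<theta> \<theta>' (2 * \<xi>)"
      have u: "2 * \<xi> \<in> {0..1}" using h(1) \<xi> by auto
      have e: "cutval r \<theta> \<theta>' (2 * \<xi>) = \<alpha> (g w) + of_int (- int n)" using eq h(2) by (simp add: q_def algebra_simps)
      have "- int n = 0 \<or> - int n = 1" by (rule cutval_gap[OF cc tiny u w e])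
      then have "cutval r \<theta> \<theta>' (2 * \<xi>) = \<alpha> (g w)" using e by auto
      then have "w = t" using cutval_g(1)[OF cc u w] by simp
      then show False using im avoid[of t] vt ts by auto
    next
      fix w' :: real assume h: "w' \<in> {0<..<1}" "tau r \<theta> \<theta>' t s \<xi> = \<alpha> (g w') + 1"
      then have "\<alpha> (g w') + of_int (1 + int n) = \<alpha> (g w)" using eq by (simp add: q_def add.assoc)
      then show False using \<alpha>_g_translate[OF h(1) w] by fastforce
    qed
    \<comment> \<open>Points of the loop are values on \<open>E1\<close>, or values on
      \<open>E2\<close> minus one. The latter turn translate \<open>n\<close> into translate
      \<open>n + 1\<close>, so that \<open>W\<close> applies even for \<open>n = 0\<close>; on
      \<open>E1\<close> that case is settled by injectivity.\<close>
    have disj: "(\<lambda>y. y + of_nat n) ` path_image q \<inter> path_image p = {}" for n :: nat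
    proof (rule ccontr)
      assume "\<not> ?thesis"
      then obtain \<xi> where \<xi>: "\<xi> \<in> {0..1}" and im: "q \<xi> + of_nat n \<in> path_image p" unfolding path_image_def[of q] by blast
      have inq: "q \<xi> + of_int k \<in> (\<lambda>y. y + of_int k) ` path_image q" for k :: int using \<xi> unfolding path_image_def by blast
      from im pE consider x where "x \<in> E1" "q \<xi> + of_nat n = \<alpha> x" | x where "x \<in> E2" "q \<xi> + of_nat n = \<alpha> x - 1" by blast
      then show False
      proof cases
        case (1 x)
        show False
        proof (cases "x \<in> C")
          case True
          have x0: "x \<in> C0" using EC0 1(1) True by blast
          have n: "n = 0"
          proof (rule ccontr)
            assume "n \<noteq> 0"
            then have "(\<lambda>y. y + of_int (int n)) ` path_image q \<inter> \<alpha> ` C0 = {}" by (intro W) simp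
            then show False using inq[of "int n"] 1(2) x0 by auto
          qed
          from tau_cases[OF cc \<xi>] show False
          proof (elim disjE bexE conjE)
            assume h: "\<xi> \<le> 1 / 2" "tau r \<theta> \<theta>' t s \<xi> = cutval r \<theta> \<theta>' (2 * \<xi>)"
            then have "\<alpha> (cut r \<theta> \<theta>' (2 * \<xi>)) = \<alpha> x" using 1(2) n by (simp add: q_def cutval_def)
            then have "cut r \<theta> \<theta>' (2 * \<xi>) = x"
              using \<alpha>_injD[OF cut_in_H[OF cc] in_H(3)[OF True]] h(1) \<xi> by auto
            then have "x \<in> ball (g 1) \<rho>" using cutball by metis
            then show False using \<rho>(2) 1(1) by (auto simp: K_def)
          next
            fix w :: real assume "w \<in> {0<..<1}" "tau r \<theta> \<theta>' t s \<xi> = \<alpha> (g w) + 1"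
            then show False using 1(2) n \<alpha>_C_neq(2)[OF True, of w] by (simp add: q_def)
          qed
        next
          case False
          then obtain w where w: "w \<in> {0<..<1}" "x = g w" using 1(1) E1(2) by blast
          show False using avg[OF \<xi> w(1)] 1(2) im w(2) by simp
        qed
      next
        case (2 x)
        show False
        proof (cases "x \<in> C")
          case True
          have x0: "x \<in> C0" using EC0 2(1) True by blast
          have "q \<xi> + of_int (int n + 1) = \<alpha> x" using 2(2) by (simp add: algebra_simps)
          then have "\<alpha> x \<in> (\<lambda>y. y + of_int (int n + 1)) ` path_image q" using inq by metis
          moreover have "(\<lambda>y. y + of_int (int n + 1)) ` path_image q \<inter> \<alpha> ` C0 = {}" by (intro W) simp
          ultimately show False using x0 by blast
        next
          case False
          then obtain w where w: "w \<in> {0<..<1}" "x = h w" using 2(1) E2(2) by blast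
          have "q \<xi> + of_nat n = \<alpha> (g w)" using 2(2) w(2) \<alpha>_h[OF w(1)] by simp
          then show False using avg[OF \<xi> w(1)] im by simp
        qed
      qed
    qed
    have step: "winding_number p (\<alpha> (g t) + of_nat n) = winding_number p (\<alpha> (g t))" for n :: nat
    proof (induction n)
      case (Suc n)
      have "winding_number p (\<alpha> (g t) + of_nat (Suc n)) = winding_number p (\<alpha> (g t) + of_nat n)"
      proof (rule winding_number_eq[OF p])
        have "q 1 + of_nat n \<in> (\<lambda>y. y + of_nat n) ` path_image q" "q 0 + of_nat n \<in> (\<lambda>y. y + of_nat n) ` path_image q"
          unfolding path_image_def by (intro imageI; simp)+
        then show "\<alpha> (g t) + of_nat (Suc n) \<in> (\<lambda>y. y + of_nat n) ` path_image q"
          "\<alpha> (g t) + of_nat n \<in> (\<lambda>y. y + of_nat n) ` path_image q"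
          using q01 by (simp_all add: add.assoc)
        show "connected ((\<lambda>y. y + of_nat n) ` path_image q)"
          by (intro connected_continuous_image connected_path_image pq continuous_intros)
      qed (rule disj)
      then show ?case using Suc.IH by simp
    qed simp
    obtain n :: nat where n: "B + norm (\<alpha> (g t)) \<le> real n" using real_arch_simple by blast
    have "B \<le> norm (\<alpha> (g t) + of_nat n)"
      using n norm_triangle_ineq2[of "of_nat n" "- \<alpha> (g t)"] by (simp add: add.commute)
    then have "winding_number p (\<alpha> (g t)) = 0" using B step by metis
    then show ?thesis using const[OF vt] ts by auto
  qed
qed

section \<open>Pairwise disjoint translates\<close>

lemma no_chord_C:
  assumes "z1 \<in> C" "z2 \<in> C"
  shows "\<alpha> z2 \<noteq> \<alpha> z1 + 1"
proof
  assume eq: "\<alpha> z2 = \<alpha> z1 + 1"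
  obtain p v1 v2 E1 E2 where p: "path p" "pathfinish p = pathstart p" and v: "0 < v1" "v1 < v2" "v2 < 1"
    and E1: "compact E1" "E1 \<subseteq> C \<union> g ` {0<..<1}" and E2: "compact E2" "E2 \<subseteq> C \<union> h ` {0<..<1}"
    and pE: "path_image p \<subseteq> \<alpha> ` E1 \<union> (\<lambda>x. \<alpha> x - 1) ` E2"
    and av: "\<And>u. 0 < u \<Longrightarrow> u \<le> v1 \<Longrightarrow> \<alpha> (g u) \<notin> path_image p" "\<And>u. v2 \<le> u \<Longrightarrow> u < 1 \<Longrightarrow> \<alpha> (g u) \<notin> path_image p"
    and ne: "winding_number p (\<alpha> (g v2)) \<noteq> winding_number p (\<alpha> (g v1))"
    by (rule exists_winding_loop[OF assms eq]; rule that; assumption)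
  interpret R: tile "reversepath g" "reversepath h" \<alpha> F by (rule tile_reverse)
  have "winding_number p (\<alpha> (g v2)) = 0"
    by (rule tail_winding_number_zero[OF p _ v(3) E1 E2 pE av(2)]) (use v in auto)
  \<comment> \<open>The head of the curve is the tail of the reversed tile.\<close>
  moreover have "winding_number p (\<alpha> (reversepath g (1 - v1))) = 0"
  proof (rule R.tail_winding_number_zero[OF p _ _ E1(1) _ E2(1) _ pE])
    show "E1 \<subseteq> R.C \<union> reversepath g ` {0<..<1}" "E2 \<subseteq> R.C \<union> reversepath h ` {0<..<1}"
      using E1(2) E2(2) by (simp_all only: reverse_C reversepath_image_open)
    show "\<alpha> (reversepath g u) \<notin> path_image p" if "1 - v1 \<le> u" "u < 1" for u
      using av(1)[of "1 - u"] that by (simp add: reversepath_def)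
  qed (use v in auto)
  ultimately show False using ne by (simp add: reversepath_def)
qed

lemma translate_C:
  assumes "z1 \<in> C" "z2 \<in> C" "\<alpha> z1 + of_int k = \<alpha> z2"
  shows "k = 0" "z1 = z2"
proof -
  show k: "k = 0"
  proof (rule path_connected_no_chord_int[of "\<alpha> ` C" "\<alpha> z1"])
    show "path_connected (\<alpha> ` C)"
      by (intro path_connected_continuous_image path_connected_C holomorphic_on_imp_continuous_on \<alpha>_holomorphic_C)
    show "x + 1 \<notin> \<alpha> ` C" if "x \<in> \<alpha> ` C" for x using that no_chord_C by (metis imageE)
  qed (use assms in auto)
  then show "z1 = z2" using assms \<alpha>_injD in_H by auto
qed

text \<open>By openness a coincidence at the boundary point \<open>g u\<close> would spread to one
  between two points of \<open>C\<close>, so \<open>k = 0\<close>, and then injectivity on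
  \<open>H\<close> fails.\<close>

lemma translate_C_g:
  assumes "z \<in> C" "u \<in> {0<..<1}"
  shows "\<alpha> z + of_int k \<noteq> \<alpha> (g u)"
proof
  assume eq: "\<alpha> z + of_int k = \<alpha> (g u)"
  have op: "open ((\<lambda>w. of_int k + w) ` \<alpha> ` C)" by (intro open_translation open_\<alpha>_image open_C) simp
  obtain S where S: "open S" "H \<subseteq> S" "\<alpha> holomorphic_on S" by (rule \<alpha>_holomorphic)
  define U where "U = S \<inter> \<alpha> -` ((\<lambda>w. of_int k + w) ` \<alpha> ` C)"
  have opU: "open U" unfolding U_def
    by (intro continuous_open_preimage holomorphic_on_imp_continuous_on S op)
  have "g u \<in> U" unfolding U_def
    using S(2) in_H(1)[OF assms(2)] assms(1) eq by (auto simp: add.commute image_iff intro!: bexI[of _ z])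
  moreover have "g u \<in> closure C" using in_J(1)[of u] assms(2) closure_C by auto
  ultimately have "U \<inter> C \<noteq> {}" using open_Int_closure_eq_empty[OF opU] by blast
  then obtain x y where xy: "x \<in> C" "y \<in> C" "\<alpha> x = of_int k + \<alpha> y" unfolding U_def by blast
  then have "k = 0" using translate_C(1)[of y x k] by (simp add: add.commute)
  then show False using eq \<alpha>_C_neq(1)[OF assms] by simp
qed

end

section \<open>The transition function of two Abel functions\<close>

text \<open>Suppose that \<open>x\<close> on the larger curve is missed by the smaller. The inside
  of the larger curve then lies in the inside of the smaller, and likewise for the outsides. Both
  sides of the larger curve accumulate at \<open>x\<close>, which can thus belong to neither side of
  the smaller.\<close>

lemma closed_Jordan_curve_subset:
  fixes p q :: "real \<Rightarrow> complex"
  assumes p: "simple_path p" "pathfinish p = pathstart p" and q: "simple_path q" "pathfinish q = pathstart q"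
    and sub: "path_image q \<subseteq> path_image p"
  shows "path_image q = path_image p"
proof (rule ccontr)
  assume "path_image q \<noteq> path_image p"
  then obtain x where x: "x \<in> path_image p" "x \<notin> path_image q" using sub by blast
  note P = Jordan_inside_outside[OF p] and Q = Jordan_inside_outside[OF q]
  define I O' where "I = inside (path_image p)" and "O' = outside (path_image p)"
  define I2 O2 where "I2 = inside (path_image q)" and "O2 = outside (path_image q)"
  have IO: "connected I" "I \<union> O' = - path_image p" "frontier I = path_image p" "frontier O' = path_image p" "open I" "open O'"
    using P by (auto simp: I_def O'_def)
  have IO2: "open I2" "open O2" "I2 \<inter> O2 = {}" "I2 \<union> O2 = - path_image q" "I2 \<noteq> {}"
    using Q by (auto simp: I2_def O2_def)
  have out: "O' \<subseteq> O2" unfolding O'_def O2_def by (rule outside_mono[OF sub])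
  have clI: "closure I = I \<union> path_image p" and clO: "closure O' = O' \<union> path_image p"
    using closure_Un_frontier IO by metis+
  have xcl: "x \<in> closure I" "x \<in> closure O'" using x(1) clI clO by auto
  have meets: "S \<inter> I \<noteq> {}" "S \<inter> O' \<noteq> {}" if "open S" "x \<in> S" for S
    using that xcl open_Int_closure_eq_empty by blast+
  have I: "I \<inter> I2 = {} \<or> I \<inter> O2 = {}"
    using connectedD[OF IO(1) IO2(1,2)] IO(2) IO2(3,4) sub by blast
  \<comment> \<open>The open set \<open>I2\<close> lies off \<open>O'\<close>; if it missed
    \<open>I\<close>, and hence the closure of \<open>I\<close>, it would be empty.\<close>
  have "I \<inter> I2 \<noteq> {}"
  proof
    assume e: "I \<inter> I2 = {}"
    have "I2 \<inter> closure I = {}" using e IO2(1) open_Int_closure_eq_empty by blast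
    moreover have "I2 \<inter> O' = {}" using out IO2(3) by blast
    ultimately have "I2 = {}" using clI IO(2) by blast
    then show False using IO2(5) by simp
  qed
  then have "I \<inter> O2 = {}" using I by blast
  then have "x \<notin> O2" using meets(1)[OF IO2(2)] by blast
  moreover have "x \<notin> I2" using meets(2)[OF IO2(1)] out IO2(3) by blast
  ultimately show False using IO2(4) x(2) by blast
qed

text \<open>An entire homeomorphism of the plane is proper, hence a polynomial. Commuting with the
  unit translation, it makes \<open>G z - G 0 - z\<close> vanish at all natural numbers, hence
  identically.\<close>

lemma entire_translation:
  fixes G G' :: "complex \<Rightarrow> complex"
  assumes G: "G holomorphic_on UNIV" and G': "continuous_on UNIV G'"
    and inv: "\<And>z. G' (G z) = z" "\<And>w. G (G' w) = w" and shift: "\<And>z. G (z + 1) = G z + 1"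
  shows "G z = z + G 0"
proof -
  have nat: "G (of_nat n) = G 0 + of_nat n" for n
  proof (induction n)
    case (Suc n)
    then show ?case using shift[of "of_nat n"] by (simp add: add.commute add.left_commute)
  qed simp
  have "compact {z. G z \<in> k}" if "compact k" for k
  proof -
    have "{z. G z \<in> k} = G' ` k" using inv by (auto simp: image_iff) metis
    then show ?thesis using compact_continuous_image[OF continuous_on_subset[OF G']] that by simp
  qed
  then obtain c n where c: "0 < n" "c n \<noteq> 0" "G = (\<lambda>z. \<Sum>i\<le>n. c i * z ^ i)"
    using proper_map_polyfun_eq[OF G] by blast
  \<comment> \<open>The coefficients of \<open>G z - G 0 - z\<close>; \<open>0 < n\<close> ensures
    that the linear term is within the range of summation.\<close>
  define b where "b = (\<lambda>i. c i - (if i = 0 then G 0 else 0) - (if i = 1 then 1 else 0))"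
  have b: "(\<Sum>i\<le>n. b i * z ^ i) = G z - G 0 - z" for z
  proof -
    have "(\<Sum>i\<le>n. b i * z ^ i) = (\<Sum>i\<le>n. c i * z ^ i - (if i = 0 then G 0 else 0) - (if i = 1 then z else 0))"
      by (intro sum.cong) (auto simp: b_def algebra_simps)
    also have "\<dots> = G z - G 0 - z" using c(1) by (subst c(3)) (simp add: sum_subtractf)
    finally show ?thesis .
  qed
  have "infinite {z. (\<Sum>i\<le>n. b i * z ^ i) = 0}"
  proof (rule infinite_super)
    show "range (of_nat :: nat \<Rightarrow> complex) \<subseteq> {z. (\<Sum>i\<le>n. b i * z ^ i) = 0}" using b nat by auto
    show "infinite (range (of_nat :: nat \<Rightarrow> complex))" by (intro range_inj_infinite inj_of_nat)
  qed
  then have "\<forall>i\<le>n. b i = 0" using polyfun_finite_roots[of b n] by blast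
  then have "(\<Sum>i\<le>n. b i * z ^ i) = 0" by simp
  then show ?thesis using b[of z] by (simp add: algebra_simps)
qed

context tile
begin

lemma translate_unique:
  assumes "x \<in> C \<union> g ` {0<..<1}" "y \<in> C \<union> g ` {0<..<1}" "\<alpha> x + of_int k = \<alpha> y + of_int l"
  shows "x = y" "k = l"
proof -
  have e: "\<alpha> x + of_int (k - l) = \<alpha> y" "\<alpha> y + of_int (l - k) = \<alpha> x"
    using assms(3) by (simp_all add: algebra_simps)
  have "k - l = 0"
  proof -
    consider "x \<in> C" "y \<in> C" | u where "u \<in> {0<..<1}" "x \<in> C" "y = g u" | u where "u \<in> {0<..<1}" "x = g u" "y \<in> C"
      | u v where "u \<in> {0<..<1}" "v \<in> {0<..<1}" "x = g u" "y = g v"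
      using assms(1,2) by blast
    then show ?thesis
    proof cases
      case 1 then show ?thesis using translate_C(1) e(1) by blast
    next
      case 2 then show ?thesis using translate_C_g e(1) by blast
    next
      case 3 then show ?thesis using translate_C_g e(2) by blast
    next
      case 4 then show ?thesis using \<alpha>_g_translate e(1) by blast
    qed
  qed
  then show kl: "k = l" by simp
  have "x \<in> H" "y \<in> H" using assms(1,2) by (auto simp: H_def)
  then show "x = y" using \<alpha>_injD assms(3) kl by simp
qed

lemma deriv_isolated:
  assumes u: "u \<in> {0<..<1}"
  obtains e where "e > 0" "\<And>z. z \<in> ball (g u) e - {g u} \<Longrightarrow> deriv \<alpha> z \<noteq> 0"
proof -
  obtain S' where S': "open S'" "connected S'" "H \<subseteq> S'" and "\<alpha> holomorphic_on S'"
    by (rule \<alpha>_holomorphic_connected)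
  then have hol: "deriv \<alpha> holomorphic_on S'" using holomorphic_deriv by blast
  have gS: "g u \<in> S'" using in_H(1)[OF u] S'(3) by blast
  show ?thesis
  proof (cases "deriv \<alpha> (g u) = 0")
    case True
    obtain w where w: "w \<in> {0<..<1}" "deriv \<alpha> (g w) \<noteq> 0" using exists_good by blast
    then have "g w \<in> S'" using in_H(1) S'(3) by blast
    from isolated_zeros[OF hol S'(1,2) gS True this w(2)] show ?thesis using that by metis
  next
    case False
    have "open (S' \<inter> deriv \<alpha> -` (- {0}))"
      by (intro continuous_open_preimage holomorphic_on_imp_continuous_on hol S') auto
    moreover have "g u \<in> S' \<inter> deriv \<alpha> -` (- {0})" using False gS by simp
    ultimately obtain e where "e > 0" "ball (g u) e \<subseteq> S' \<inter> deriv \<alpha> -` (- {0})" using openE by metis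
    then show ?thesis using that[of e] by blast
  qed
qed

text \<open>Near a point \<open>\<alpha> (g u)\<close>, also one with \<open>\<alpha>'\<close> vanishing at \<open>g u\<close>, the values of \<open>\<alpha>\<close> in the tile
  near \<open>g u\<close> together with those near \<open>h u\<close>, shifted by \<open>-1\<close>, leave no gap: they form a relatively
  clopen subset of a punctured disc.\<close>

lemma value_neighbourhood:
  assumes u: "u \<in> {0<..<1}" and "\<epsilon> > 0"
  obtains \<delta> where "\<delta> > 0" "\<And>v. v \<in> {0<..<1} \<Longrightarrow> \<alpha> (g v) \<in> ball (\<alpha> (g u)) \<delta> \<Longrightarrow> v \<noteq> u \<Longrightarrow> deriv \<alpha> (g v) \<noteq> 0"
    "\<And>y. y \<in> ball (\<alpha> (g u)) \<delta> \<Longrightarrow>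
      (\<exists>x \<in> C \<union> g ` {0<..<1}. dist (g u) x < \<epsilon> \<and> y = \<alpha> x) \<or> (\<exists>x \<in> C. dist (h u) x < \<epsilon> \<and> y = \<alpha> x - 1)"
proof -
  define q where "q = \<alpha> (g u)"
  have q': "q = \<alpha> (h u) - 1" using \<alpha>_h[OF u] by (simp add: q_def)
  have ne: "g u \<noteq> g 0" "g u \<noteq> g 1" "h u \<noteq> g 0" "h u \<noteq> g 1"
    using inj_onD[OF inj_g, of u 0] inj_onD[OF inj_g, of u 1] inj_onD[OF inj_h, of u 0] inj_onD[OF inj_h, of u 1] u start_eq finish_eq
    by auto
  obtain e0 where e0: "e0 > 0" "\<And>z. z \<in> ball (g u) e0 - {g u} \<Longrightarrow> deriv \<alpha> z \<noteq> 0"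
    by (rule deriv_isolated[OF u]) blast
  define D where "D = {\<epsilon>, e0, dist (g u) (g 0), dist (g u) (g 1), dist (h u) (g 0), dist (h u) (g 1)}"
  define e where "e = Min D / 2"
  have D: "finite D" "0 < Min D"
    using e0(1) assms(2) ne by (simp_all add: D_def)
  have less: "e < x" if "x \<in> D" for x
    using Min_le[OF D(1) that] D(2) by (simp add: e_def)
  have e: "e > 0" "e < \<epsilon>" "e < e0" "e < dist (g u) (g 0)" "e < dist (g u) (g 1)" "e < dist (h u) (g 0)" "e < dist (h u) (g 1)"
    using D(2) by (simp add: e_def) (rule less, simp add: D_def)+
  define N1 N2 where "N1 = cball (g u) e" and "N2 = cball (h u) e"
  have CJ: "closed (C \<union> J)" using closed_closure[of C] by (simp add: closure_C)
  have NH: "x \<in> H" if "x \<in> N1 \<union> N2" "x \<in> C \<union> J" for x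
  proof -
    have "x \<noteq> g 0" "x \<noteq> g 1" using that(1) e by (auto simp: N1_def N2_def)
    then show ?thesis using that(2) start_eq finish_eq unfolding J_def path_image_def H_def by force
  qed
  obtain d where d: "d > 0" "\<And>v. v \<in> {0..1} \<Longrightarrow> dist v u < d \<Longrightarrow> dist (g v) (g u) < e \<and> dist (h v) (h u) < e"
  proof -
    obtain d1 where d1: "d1 > 0" "\<And>v. v \<in> {0..1} \<Longrightarrow> dist v u < d1 \<Longrightarrow> dist (g v) (g u) < e"
      using continuous_g u e(1) unfolding continuous_on_iff
      by (metis greaterThanLessThan_subseteq_atLeastAtMost_iff order_refl subsetD)
    obtain d2 where d2: "d2 > 0" "\<And>v. v \<in> {0..1} \<Longrightarrow> dist v u < d2 \<Longrightarrow> dist (h v) (h u) < e"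
      using continuous_h u e(1) unfolding continuous_on_iff
      by (metis greaterThanLessThan_subseteq_atLeastAtMost_iff order_refl subsetD)
    show ?thesis by (rule that[of "min d1 d2"]) (use d1 d2 in auto)
  qed
  define m where "m = min (d / 2) (min (u / 2) ((1 - u) / 2))"
  define v1 v2 where "v1 = u - m" and "v2 = u + m"
  have m: "0 < m" "m < d" "m < u" "m < 1 - u" using d(1) u by (auto simp: m_def min_def field_simps)
  have v12: "0 < v1" "v1 < u" "u < v2" "v2 < 1" using m by (auto simp: v1_def v2_def)
  have ghN: "dist (g u) (g v) < e" "dist (h u) (h v) < e" if "v \<in> {v1<..<v2}" for v
  proof -
    have "dist v u < d" "v \<in> {0..1}" using that m v12 by (auto simp: v1_def v2_def dist_real_def)
    then show "dist (g u) (g v) < e" "dist (h u) (h v) < e" using d(2)[of v] by (simp_all add: dist_commute)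
  qed
  define J1 where "J1 = g ` {0..v1} \<union> g ` {v2..1} \<union> path_image h"
  define J2 where "J2 = h ` {0..v1} \<union> h ` {v2..1} \<union> path_image g"
  have cl: "closed (p ` {v..w})" if "path p" "0 \<le> v" "w \<le> 1" for p :: "real \<Rightarrow> complex" and v w
    using that by (intro compact_imp_closed compact_continuous_image) (auto simp: path_def intro: continuous_on_subset)
  have clJ: "closed J1" "closed J2" unfolding J1_def J2_def
    using cl[OF path_g] cl[OF path_h] v12 path_g path_h by (auto intro!: closed_Un closed_path_image)
  have nJ1: "g u \<notin> J1"
    using g_neq_h[OF u] v12 inj_onD[OF inj_g, of u] by (force simp: J1_def)
  have nJ2: "h u \<notin> J2"
    using h_neq_g[OF u] v12 inj_onD[OF inj_h, of u] by (force simp: J2_def)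
  have J1: "x \<in> g ` {v1<..<v2}" if "x \<in> J" "x \<notin> J1" for x
    using that v12 unfolding J_def J1_def path_image_def by force
  have J2: "x \<in> h ` {v1<..<v2}" if "x \<in> J" "x \<notin> J2" for x
    using that v12 unfolding J_def J2_def path_image_def by force
  \<comment> \<open>The parts of the neighbourhoods \<open>K1\<close> and \<open>K2\<close> on the
    bounding circle or on a remote piece of \<open>J\<close>. Their values miss \<open>q\<close> by
    injectivity, so a small disc around \<open>q\<close> sees only inner points and nearby points of
    the two arcs.\<close>
  define B1 where "B1 = (C \<union> J) \<inter> N1 \<inter> (J1 \<union> sphere (g u) e)"
  define B2 where "B2 = (C \<union> J) \<inter> N2 \<inter> (J2 \<union> sphere (h u) e)"
  define K1 where "K1 = (C \<union> J) \<inter> N1"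
  define K2 where "K2 = (C \<union> J) \<inter> N2"
  have comK: "compact K1" "compact K2" unfolding K1_def K2_def N1_def N2_def
    by (rule closed_Int_compact[OF CJ compact_cball])+
  have "compact B1" "compact B2" unfolding B1_def B2_def K1_def[symmetric] K2_def[symmetric]
    using clJ by (auto intro!: compact_Int_closed comK)
  note com = this comK
  have H: "B1 \<subseteq> H" "B2 \<subseteq> H" "K1 \<subseteq> H" "K2 \<subseteq> H" using NH by (auto simp: B1_def B2_def K1_def K2_def)
  have comi: "compact (\<alpha> ` B1)" "compact (\<alpha> ` B2)" "compact (\<alpha> ` K1)" "compact (\<alpha> ` K2)"
    using com H by (auto intro!: compact_continuous_image continuous_on_subset[OF \<alpha>_continuous])
  have shift: "compact ((\<lambda>x. \<alpha> x - 1) ` X)" if "compact (\<alpha> ` X)" for X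
  proof -
    have "(\<lambda>x. \<alpha> x - 1) ` X = (\<lambda>y. y - 1) ` \<alpha> ` X" by (simp add: image_image)
    then show ?thesis using that by (simp add: compact_translation_subtract)
  qed
  define B where "B = \<alpha> ` B1 \<union> (\<lambda>x. \<alpha> x - 1) ` B2"
  define K where "K = \<alpha> ` K1 \<union> (\<lambda>x. \<alpha> x - 1) ` K2"
  have cB: "closed B" and cK: "closed K" unfolding B_def K_def
    using comi shift by (auto intro!: closed_Un compact_imp_closed)
  have "q \<notin> B"
  proof
    assume "q \<in> B"
    then consider x where "x \<in> B1" "\<alpha> x = \<alpha> (g u)" | x where "x \<in> B2" "\<alpha> x = \<alpha> (h u)"
      unfolding B_def using q' q_def by (metis (no_types, lifting) UnE imageE diff_eq_eq diff_add_cancel)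
    then show False
    proof cases
      case 1
      then have "x = g u" using \<alpha>_injD H(1) in_H(1)[OF u] by blast
      then show False using 1(1) nJ1 e(1) by (auto simp: B1_def)
    next
      case 2
      then have "x = h u" using \<alpha>_injD H(2) in_H(2)[OF u] by blast
      then show False using 2(1) nJ2 e(1) by (auto simp: B2_def)
    qed
  qed
  then obtain \<delta> where \<delta>: "\<delta> > 0" "ball q \<delta> \<subseteq> - B" using openE[of "- B" q] cB by auto
  have K1c: "x \<in> C \<and> dist (g u) x < e \<or> x \<in> g ` {v1<..<v2}" if "x \<in> K1" "\<alpha> x \<in> ball q \<delta>" for x
  proof -
    have "x \<notin> B1" using that(2) \<delta>(2) unfolding B_def by blast
    then have "x \<notin> J1" "dist (g u) x \<noteq> e" using that(1) by (auto simp: B1_def K1_def)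
    then show ?thesis using that(1) J1 by (auto simp: K1_def N1_def)
  qed
  have K2c: "x \<in> C \<and> dist (h u) x < e \<or> x \<in> h ` {v1<..<v2}" if "x \<in> K2" "\<alpha> x - 1 \<in> ball q \<delta>" for x
  proof -
    have "x \<notin> B2" using that(2) \<delta>(2) unfolding B_def by blast
    then have "x \<notin> J2" "dist (h u) x \<noteq> e" using that(1) by (auto simp: B2_def K2_def)
    then show ?thesis using that(1) J2 by (auto simp: K2_def N2_def)
  qed
  have Kc: "(\<exists>x\<in>C. dist (g u) x < e \<and> y = \<alpha> x) \<or> (\<exists>v\<in>{v1<..<v2}. y = \<alpha> (g v)) \<or> (\<exists>x\<in>C. dist (h u) x < e \<and> y = \<alpha> x - 1)"
    if y: "y \<in> K" "y \<in> ball q \<delta>" for y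
  proof -
    consider x where "x \<in> K1" "y = \<alpha> x" | x where "x \<in> K2" "y = \<alpha> x - 1" using y(1) unfolding K_def by blast
    then show ?thesis
    proof cases
      case 1
      then show ?thesis using K1c[of x] y(2) by blast
    next
      case 2
      then consider "x \<in> C \<and> dist (h u) x < e" | v where "v \<in> {v1<..<v2}" "x = h v" using K2c[of x] y(2) by blast
      then show ?thesis
      proof cases
        case 1 then show ?thesis using 2(2) by blast
      next
        case (2 v)
        then have "y = \<alpha> (g v)" using \<open>y = \<alpha> x - 1\<close> \<alpha>_h[of v] v12 by auto
        then show ?thesis using 2(1) by blast
      qed
    qed
  qed
  have good: "deriv \<alpha> (g v) \<noteq> 0" if "v \<in> {v1<..<v2}" "v \<noteq> u" for v
  proof (rule e0(2))
    have "g v \<noteq> g u" using inj_onD[OF inj_g, of v u] that v12 by auto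
    then show "g v \<in> ball (g u) e0 - {g u}" using ghN(1)[OF that(1)] e(3) by auto
  qed
  \<comment> \<open>The centre is removed because \<open>deriv \<alpha>\<close> may vanish at
    \<open>g u\<close>; at the other curve points involved \<open>good_point\<close> applies. A
    punctured disc is still connected.\<close>
  define W where "W = ball q \<delta> - {q}"
  have "open (W \<inter> K)"
  proof (subst open_contains_ball, rule ballI)
    fix y assume y: "y \<in> W \<inter> K"
    then have yb: "y \<in> ball q \<delta>" "y \<noteq> q" "y \<in> K" by (auto simp: W_def)
    have "\<exists>U. open U \<and> y \<in> U \<and> U \<subseteq> K"
      using Kc[OF yb(3,1)]
    proof (elim disjE bexE conjE)
      fix x assume x: "x \<in> C" "dist (g u) x < e" "y = \<alpha> x"
      have "open (\<alpha> ` (C \<inter> ball (g u) e))" by (intro open_\<alpha>_image open_Int open_C open_ball) auto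
      moreover have "\<alpha> ` (C \<inter> ball (g u) e) \<subseteq> K" by (auto simp: K_def K1_def N1_def)
      ultimately show ?thesis using x by (intro exI[of _ "\<alpha> ` (C \<inter> ball (g u) e)"]) auto
    next
      fix x assume x: "x \<in> C" "dist (h u) x < e" "y = \<alpha> x - 1"
      have "open (\<alpha> ` (C \<inter> ball (h u) e))" by (intro open_\<alpha>_image open_Int open_C open_ball) auto
      then have "open ((\<lambda>z. z - 1) ` \<alpha> ` (C \<inter> ball (h u) e))" by (rule open_translation_subtract)
      moreover have "(\<lambda>z. z - 1) ` \<alpha> ` (C \<inter> ball (h u) e) \<subseteq> K" by (auto simp: K_def K2_def N2_def)
      ultimately show ?thesis using x by (intro exI[of _ "(\<lambda>z. z - 1) ` \<alpha> ` (C \<inter> ball (h u) e)"]) auto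
    next
      fix v assume v: "v \<in> {v1<..<v2}" "y = \<alpha> (g v)"
      have v01: "v \<in> {0<..<1}" using v v12 by auto
      have "v \<noteq> u" using v(2) yb(2) by (auto simp: q_def)
      note gv = good[OF v(1) this]
      obtain e1 where e1: "e1 > 0" "\<alpha> holomorphic_on ball (g v) e1" "inj_on \<alpha> (ball (g v) e1)"
        "\<And>x. x \<in> ball (g v) e1 \<Longrightarrow> x \<notin> C \<Longrightarrow> x \<notin> J \<Longrightarrow> F x \<in> C"
        by (rule good_point[OF v01 gv]) blast
      define e2 where "e2 = min e1 (min (e - dist (g u) (g v)) (e - dist (h u) (h v)))"
      have e2: "e2 > 0" "e2 \<le> e1" "e2 \<le> e - dist (g u) (g v)" "e2 \<le> e - dist (h u) (h v)"
        using e1(1) ghN[OF v(1)] by (auto simp: e2_def)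
      obtain e3 where e3: "e3 > 0" "e3 \<le> e2" "F ` ball (g v) e3 \<subseteq> ball (h v) e2"
          "\<And>x. x \<in> ball (g v) e3 \<Longrightarrow> \<alpha> (F x) = \<alpha> x + 1"
        by (rule \<alpha>_F[OF v01 e2(1)]) blast
      have b31: "ball (g v) e3 \<subseteq> ball (g v) e1" using e3(2) e2(2) by (intro subset_ball) simp
      have b3N: "ball (g v) e3 \<subseteq> N1"
      proof
        fix x assume "x \<in> ball (g v) e3"
        then show "x \<in> N1" using dist_triangle[of "g u" x "g v"] e3(2) e2(3) by (simp add: N1_def)
      qed
      have bFN: "F x \<in> N2" if "x \<in> ball (g v) e3" for x
      proof -
        have "dist (h v) (F x) < e2" using imageI[OF that, of F] e3(3) by auto
        then show ?thesis using dist_triangle[of "h u" "F x" "h v"] e2(4) by (simp add: N2_def)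
      qed
      have "open (\<alpha> ` ball (g v) e3)"
        by (rule open_mapping_thm3[OF holomorphic_on_subset[OF e1(2) b31] open_ball inj_on_subset[OF e1(3) b31]])
      \<comment> \<open>Points of the closed inner side contribute through \<open>K1\<close>, outer
        ones through \<open>F\<close> and \<open>K2\<close>; together they fill a full neighbourhood
        of \<open>\<alpha> (g v)\<close>.\<close>
      moreover have "\<alpha> x \<in> K" if x: "x \<in> ball (g v) e3" for x
      proof (cases "x \<in> C \<union> J")
        case True
        then show ?thesis using b3N x by (auto simp: K_def K1_def)
      next
        case False
        then have "F x \<in> C" using e1(4) b31 x by blast
        then have "F x \<in> K2" using bFN[OF x] by (simp add: K2_def)
        moreover have "\<alpha> x = \<alpha> (F x) - 1" using e3(4)[OF x] by simp
        ultimately show ?thesis unfolding K_def by blast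
      qed
      ultimately show ?thesis using v(2) e3(1) by (intro exI[of _ "\<alpha> ` ball (g v) e3"]) auto
    qed
    then obtain U where U: "open U" "y \<in> U" "U \<subseteq> K" by blast
    have "open (U \<inter> W)" using U(1) by (auto simp: W_def intro!: open_Int open_Diff)
    then obtain b where "b > 0" "ball y b \<subseteq> U \<inter> W" using y U(2) openE[of "U \<inter> W" y] by blast
    then show "\<exists>b>0. ball y b \<subseteq> W \<inter> K" using U(3) by blast
  qed
  moreover have "open (W \<inter> - K)" using cK by (auto simp: W_def intro!: open_Int open_Diff)
  moreover have "connected W" unfolding W_def
    by (intro connected_punctured_convex convex_ball) (use \<delta>(1) in \<open>simp add: aff_dim_open\<close>)
  moreover have "W \<inter> K \<noteq> {}"
  proof -
    have "isCont (\<lambda>v. \<alpha> (g v)) u"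
      using continuous_\<alpha>_g u by (simp add: continuous_on_eq_continuous_at)
    then obtain d' where d': "d' > 0" "\<And>v. dist v u < d' \<Longrightarrow> dist (\<alpha> (g v)) q < \<delta>"
      using \<delta>(1) unfolding continuous_at_eps_delta q_def by (metis dist_commute)
    define v where "v = u + min (d' / 2) (m / 2)"
    have v: "v \<in> {v1<..<v2}" "v \<noteq> u" "dist v u < d'"
      using d'(1) m(1) by (auto simp: v_def v1_def v2_def dist_real_def min_def)
    have v01: "v \<in> {0<..<1}" using v v12 by auto
    have "\<alpha> (g v) \<noteq> q" using \<alpha>_g_inj[OF u v01] v(2) by (auto simp: q_def)
    then have "\<alpha> (g v) \<in> W" using d'(2)[OF v(3)] by (simp add: W_def dist_commute)
    moreover have "g v \<in> K1" using ghN(1)[OF v(1)] in_J(1)[of v] v01 by (auto simp: K1_def N1_def)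
    ultimately show ?thesis unfolding K_def by blast
  qed
  ultimately have WK: "W \<subseteq> K"
    unfolding connected_def by blast
  show ?thesis
  proof (rule that[OF \<delta>(1)])
    fix v assume v: "v \<in> {0<..<1}" "\<alpha> (g v) \<in> ball (\<alpha> (g u)) \<delta>" "v \<noteq> u"
    have "\<alpha> (g v) \<noteq> q" using \<alpha>_g_inj[OF u v(1)] v(3) by (auto simp: q_def)
    then have K: "\<alpha> (g v) \<in> K" and b: "\<alpha> (g v) \<in> ball q \<delta>" using WK v(2) by (auto simp: W_def q_def)
    from Kc[OF K b] consider "\<exists>x\<in>C. \<alpha> (g v) = \<alpha> x" | w where "w \<in> {v1<..<v2}" "\<alpha> (g v) = \<alpha> (g w)"
      | "\<exists>x\<in>C. \<alpha> x = \<alpha> (g v) + 1" by fastforce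
    then show "deriv \<alpha> (g v) \<noteq> 0"
    proof cases
      case 1 then show ?thesis using \<alpha>_C_neq(1)[OF _ v(1)] by metis
    next
      case 2
      then have "v = w" using \<alpha>_g_inj[of w v] v(1) v12 by auto
      then show ?thesis using good 2(1) v(3) by blast
    next
      case 3 then show ?thesis using \<alpha>_C_neq(2)[OF _ v(1)] by metis
    qed
  next
    fix y assume y: "y \<in> ball (\<alpha> (g u)) \<delta>"
    show "(\<exists>x \<in> C \<union> g ` {0<..<1}. dist (g u) x < \<epsilon> \<and> y = \<alpha> x) \<or> (\<exists>x \<in> C. dist (h u) x < \<epsilon> \<and> y = \<alpha> x - 1)"
    proof (cases "y = q")
      case True
      then show ?thesis using u assms(2) by (intro disjI1 bexI[of _ "g u"]) (auto simp: q_def)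
    next
      case False
      then have "y \<in> K" "y \<in> ball q \<delta>" using WK y by (auto simp: W_def q_def)
      from Kc[OF this] show ?thesis
      proof (elim disjE bexE conjE)
        fix v assume "v \<in> {v1<..<v2}" "y = \<alpha> (g v)"
        then show ?thesis using ghN(1)[of v] e(2) v12 by (intro disjI1 bexI[of _ "g v"]) auto
      next
        fix x assume "x \<in> C" "dist (g u) x < e" "y = \<alpha> x"
        then show ?thesis using e(2) by (intro disjI1 bexI[of _ x]) auto
      next
        fix x assume "x \<in> C" "dist (h u) x < e" "y = \<alpha> x - 1"
        then show ?thesis using e(2) by (intro disjI2 bexI[of _ x]) auto
      qed
    qed
  qed
qed

end

section \<open>Construction of the transition function\<close>

locale tile_pair = A: tile g h \<alpha> F + B: tile g h \<beta> F
  for g h :: "real \<Rightarrow> complex" and \<alpha> \<beta> F :: "complex \<Rightarrow> complex" +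
  assumes covers: "(\<Union>k::int. (\<lambda>w. w + of_int k) ` \<alpha> ` A.H) = UNIV"
begin

text \<open>Without \<open>h\<close> the tile is a fundamental domain: \<open>\<alpha>\<close> maps
  it bijectively onto a set of representatives of the plane modulo the integers.\<close>

abbreviation "T \<equiv> A.C \<union> g ` {0<..<1}"

definition G :: "complex \<Rightarrow> complex" where
  "G w = (THE y. \<exists>x\<in>T. \<exists>k::int. w = \<alpha> x + of_int k \<and> y = \<beta> x + of_int k)"

lemma G_T: "x \<in> T \<Longrightarrow> G (\<alpha> x + of_int k) = \<beta> x + of_int k"
  unfolding G_def
proof (rule the_equality)
  fix y assume x: "x \<in> T" and "\<exists>x'\<in>T. \<exists>l::int. \<alpha> x + of_int k = \<alpha> x' + of_int l \<and> y = \<beta> x' + of_int l"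
  then obtain x' l where "x' \<in> T" "\<alpha> x + of_int k = \<alpha> x' + of_int l" "y = \<beta> x' + of_int l" by blast
  then show "y = \<beta> x + of_int k" using A.translate_unique[OF x, of x' k l] by simp
qed blast

lemma in_T: "x \<in> A.C \<Longrightarrow> x \<in> T" "u \<in> {0<..<1} \<Longrightarrow> g u \<in> T"
  by blast+

lemma G_\<alpha>: "x \<in> A.H \<Longrightarrow> G (\<alpha> x + of_int k) = \<beta> x + of_int k"
proof -
  assume "x \<in> A.H"
  then consider "x \<in> T" | u where "u \<in> {0<..<1}" "x = h u" unfolding A.H_def by blast
  then show ?thesis
  proof cases
    case 1 then show ?thesis by (rule G_T)
  next
    case 2
    then have "G (\<alpha> (g u) + of_int (k + 1)) = \<beta> (g u) + of_int (k + 1)" using G_T in_T(2) by blast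
    then show ?thesis using 2 A.\<alpha>_h[OF 2(1)] B.\<alpha>_h[OF 2(1)] by (simp add: algebra_simps)
  qed
qed

lemma G_\<alpha>0: "x \<in> A.H \<Longrightarrow> G (\<alpha> x) = \<beta> x"
  using G_\<alpha>[of x 0] by simp

lemma exists_preimage: obtains x k where "x \<in> T" "w = \<alpha> x + of_int k"
proof -
  have "w \<in> (\<Union>k::int. (\<lambda>w. w + of_int k) ` \<alpha> ` A.H)" unfolding covers by simp
  then obtain x k where x: "x \<in> A.H" "w = \<alpha> x + of_int k" by blast
  then consider "x \<in> T" | u where "u \<in> {0<..<1}" "x = h u" unfolding A.H_def by blast
  then show ?thesis
  proof cases
    case 1 then show ?thesis using that x by blast
  next
    case (2 u)
    have "w = \<alpha> (g u) + of_int (k + 1)" using x(2) 2 A.\<alpha>_h[OF 2(1)] by simp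
    then show ?thesis using that in_T(2)[OF 2(1)] by blast
  qed
qed

lemma G_translate: "G (w + of_int k) = G w + of_int k"
proof -
  obtain x l where x: "x \<in> T" "w = \<alpha> x + of_int l" by (rule exists_preimage)
  have "G (\<alpha> x + of_int (l + k)) = \<beta> x + of_int (l + k)" "G (\<alpha> x + of_int l) = \<beta> x + of_int l"
    using G_T[OF x(1)] by blast+
  then show ?thesis using x(2) by (simp add: add.assoc)
qed

lemma G_analytic_translate:
  assumes "G analytic_on {w}"
  shows "G analytic_on {w + of_int k}"
proof -
  have "(\<lambda>z. z - of_int k) analytic_on {w + of_int k}" by (intro analytic_intros)
  then have "(\<lambda>z. G (z - of_int k)) analytic_on {w + of_int k}"
    using analytic_on_compose[of "\<lambda>z. z - of_int k" "{w + of_int k}" G] assms by (simp add: o_def)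
  then have "(\<lambda>z. G (z - of_int k) + of_int k) analytic_on {w + of_int k}" by (intro analytic_intros)
  moreover have "(\<lambda>z. G (z - of_int k) + of_int k) = G"
  proof
    fix z show "G (z - of_int k) + of_int k = G z" using G_translate[of "z - of_int k" k] by simp
  qed
  ultimately show ?thesis by simp
qed

lemma G_analytic_local:
  assumes "open X" "inj_on \<alpha> X" "\<alpha> holomorphic_on X" "\<beta> holomorphic_on X" "x \<in> X"
    and G: "\<And>z. z \<in> X \<Longrightarrow> G (\<alpha> z) = \<beta> z"
  shows "G analytic_on {\<alpha> x}"
proof -
  obtain \<phi> where \<phi>: "\<phi> holomorphic_on \<alpha> ` X" "\<And>z. z \<in> X \<Longrightarrow> \<phi> (\<alpha> z) = z"
    using holomorphic_has_inverse[OF assms(3,1,2)] by metis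
  have "\<beta> \<circ> \<phi> holomorphic_on \<alpha> ` X"
    by (rule holomorphic_on_compose[OF \<phi>(1)]) (use \<phi>(2) assms(4) in \<open>simp add: image_image\<close>)
  then have "G holomorphic_on \<alpha> ` X"
    by (rule holomorphic_transform) (use \<phi>(2) G in auto)
  moreover have "open (\<alpha> ` X)" by (rule open_mapping_thm3[OF assms(3,1,2)])
  ultimately have "G analytic_on \<alpha> ` X" by (simp add: analytic_on_open)
  then show ?thesis using assms(5) by (elim analytic_on_subset) auto
qed

lemma G_analytic_C: "x \<in> A.C \<Longrightarrow> G analytic_on {\<alpha> x}"
  by (rule G_analytic_local[OF A.open_C A.\<alpha>_inj_C A.\<alpha>_holomorphic_C B.\<alpha>_holomorphic_C]) (use G_\<alpha>0 A.in_H in auto)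

text \<open>Here \<open>G\<close> is \<open>\<beta>\<close> composed with a local inverse of
  \<open>\<alpha>\<close>. On the outer side this rests on \<open>F\<close>, which leads into
  \<open>C\<close>, and on the Abel equations of both functions.\<close>

lemma G_analytic_good:
  assumes u: "u \<in> {0<..<1}" and good: "deriv \<alpha> (g u) \<noteq> 0"
  shows "G analytic_on {\<alpha> (g u)}"
proof -
  obtain e where e: "e > 0" "\<alpha> holomorphic_on ball (g u) e" "inj_on \<alpha> (ball (g u) e)"
    "\<And>x. x \<in> ball (g u) e \<Longrightarrow> \<alpha> (F x) = \<alpha> x + 1" "\<And>x u1 u2. x \<in> ball (g u) e \<Longrightarrow> x \<in> A.J \<Longrightarrow> x \<in> g ` {0<..<1}"
    "\<And>x. x \<in> ball (g u) e \<Longrightarrow> x \<notin> A.C \<Longrightarrow> x \<notin> A.J \<Longrightarrow> F x \<in> A.C"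
  proof (rule A.good_point[OF u good])
    fix u1 u2 e assume *: "0 < u1" "u2 < 1" "e > 0" "\<alpha> holomorphic_on ball (g u) e" "inj_on \<alpha> (ball (g u) e)"
      "\<And>x. x \<in> ball (g u) e \<Longrightarrow> \<alpha> (F x) = \<alpha> x + 1" "\<And>x. x \<in> ball (g u) e \<Longrightarrow> x \<in> A.J \<Longrightarrow> x \<in> g ` {u1<..<u2}"
      "\<And>x. x \<in> ball (g u) e \<Longrightarrow> x \<notin> A.C \<Longrightarrow> x \<notin> A.J \<Longrightarrow> F x \<in> A.C"
    have "g ` {u1<..<u2} \<subseteq> g ` {0<..<1}" using *(1,2) by (intro image_mono) auto
    then show ?thesis using that[OF *(3-6)] *(7,8) by blast
  qed
  obtain e' where e': "e' > 0" "e' \<le> e" "\<beta> holomorphic_on ball (g u) e'"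
    "\<And>x. x \<in> ball (g u) e' \<Longrightarrow> \<beta> (F x) = \<beta> x + 1"
    by (rule B.\<alpha>_F[OF u e(1)]) blast
  have sub: "ball (g u) e' \<subseteq> ball (g u) e" using e'(2) by (rule subset_ball)
  show ?thesis
  proof (rule G_analytic_local[OF open_ball _ _ e'(3)])
    show "inj_on \<alpha> (ball (g u) e')" by (rule inj_on_subset[OF e(3) sub])
    show "\<alpha> holomorphic_on ball (g u) e'" by (rule holomorphic_on_subset[OF e(2) sub])
    fix z assume z: "z \<in> ball (g u) e'"
    show "G (\<alpha> z) = \<beta> z"
    proof (cases "z \<in> A.C \<union> A.J")
      case True
      then have "z \<in> T" using e(5) z sub by blast
      then show ?thesis using G_T[of z 0] by simp
    next
      case False
      then have "F z \<in> A.H" using e(6) z sub A.in_H(3) by blast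
      then have "G (\<alpha> (F z) + of_int (- 1)) = \<beta> (F z) + of_int (- 1)" by (rule G_\<alpha>)
      then show ?thesis using e(4) e'(4) z sub by auto
    qed
  qed (use e'(1) in simp)
qed

lemma G_analytic_g:
  assumes u: "u \<in> {0<..<1}"
  shows "G analytic_on {\<alpha> (g u)}"
proof -
  obtain \<delta>0 where \<delta>0: "\<delta>0 > 0" "\<And>v. v \<in> {0<..<1} \<Longrightarrow> \<alpha> (g v) \<in> ball (\<alpha> (g u)) \<delta>0 \<Longrightarrow> v \<noteq> u \<Longrightarrow> deriv \<alpha> (g v) \<noteq> 0"
    "\<And>y. y \<in> ball (\<alpha> (g u)) \<delta>0 \<Longrightarrow>
      (\<exists>x \<in> T. dist (g u) x < 1 \<and> y = \<alpha> x) \<or> (\<exists>x \<in> A.C. dist (h u) x < 1 \<and> y = \<alpha> x - 1)"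
    by (rule A.value_neighbourhood[OF u zero_less_one]) blast
  have an: "G analytic_on {y}" if y: "y \<in> ball (\<alpha> (g u)) \<delta>0 - {\<alpha> (g u)}" for y
  proof -
    from \<delta>0(3)[of y] y consider x where "x \<in> A.C" "y = \<alpha> x" | v where "v \<in> {0<..<1}" "y = \<alpha> (g v)"
      | x where "x \<in> A.C" "y = \<alpha> x + of_int (- 1)" by auto
    then show ?thesis
    proof cases
      case 1 then show ?thesis using G_analytic_C by simp
    next
      case 2
      then have "v \<noteq> u" using y by auto
      then show ?thesis using G_analytic_good[OF 2(1)] \<delta>0(2) 2 y by auto
    next
      case 3 then show ?thesis using G_analytic_translate[OF G_analytic_C, of x "- 1"] by simp
    qed
  qed
  have "G holomorphic_on ball (\<alpha> (g u)) \<delta>0"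
  proof (rule no_isolated_singularity'[where K = "{\<alpha> (g u)}"])
    have "G analytic_on ball (\<alpha> (g u)) \<delta>0 - {\<alpha> (g u)}"
      using an analytic_on_analytic_at by blast
    then show "G holomorphic_on ball (\<alpha> (g u)) \<delta>0 - {\<alpha> (g u)}" by (rule analytic_imp_holomorphic)
    fix z assume "z \<in> {\<alpha> (g u)}"
    then have z: "z = \<alpha> (g u)" by simp
    have Gz: "G z = \<beta> (g u)" using G_\<alpha>0 A.in_H(1)[OF u] by (simp add: z)
    \<comment> \<open>Values near \<open>\<alpha> (g u)\<close> come from points near
      \<open>g u\<close> or, shifted, from points near \<open>h u\<close>. Continuity of
      \<open>\<beta>\<close> at both points gives that of \<open>G\<close>, since
      \<open>\<beta> (h u) - 1 = \<beta> (g u)\<close>.\<close>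
    have "(G \<longlongrightarrow> G z) (at z)"
    proof (rule tendstoI)
      fix \<epsilon> :: real assume "\<epsilon> > 0"
      have cont: "isCont \<beta> x" if "x \<in> A.H" for x
      proof -
        obtain S where S: "open S" "A.H \<subseteq> S" "\<beta> holomorphic_on S" by (rule B.\<alpha>_holomorphic)
        then show ?thesis using that holomorphic_on_imp_continuous_on continuous_on_eq_continuous_at by blast
      qed
      obtain d1 where d1: "d1 > 0" "\<And>x. dist x (g u) < d1 \<Longrightarrow> dist (\<beta> x) (\<beta> (g u)) < \<epsilon>"
        using cont[OF A.in_H(1)[OF u]] \<open>\<epsilon> > 0\<close> unfolding continuous_at_eps_delta by blast
      obtain d2 where d2: "d2 > 0" "\<And>x. dist x (h u) < d2 \<Longrightarrow> dist (\<beta> x) (\<beta> (h u)) < \<epsilon>"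
        using cont[OF A.in_H(2)[OF u]] \<open>\<epsilon> > 0\<close> unfolding continuous_at_eps_delta by blast
      have "min d1 d2 > 0" using d1 d2 by simp
      then obtain \<delta> where \<delta>: "\<delta> > 0" "\<And>y. y \<in> ball (\<alpha> (g u)) \<delta> \<Longrightarrow>
        (\<exists>x \<in> T. dist (g u) x < min d1 d2 \<and> y = \<alpha> x) \<or> (\<exists>x \<in> A.C. dist (h u) x < min d1 d2 \<and> y = \<alpha> x - 1)"
        by (rule A.value_neighbourhood[OF u]) blast
      have "dist (G y) (G z) < \<epsilon>" if y: "dist y z < \<delta>" for y
      proof -
        have "y \<in> ball (\<alpha> (g u)) \<delta>" using y by (simp add: z dist_commute)
        from \<delta>(2)[OF this] show ?thesis
        proof (elim disjE bexE conjE)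
          fix x assume x: "x \<in> T" "dist (g u) x < min d1 d2" "y = \<alpha> x"
          then have "G y = \<beta> x" using G_T[of x 0] by simp
          then show ?thesis using d1(2)[of x] x(2) Gz by (simp add: dist_commute)
        next
          fix x assume x: "x \<in> A.C" "dist (h u) x < min d1 d2" "y = \<alpha> x - 1"
          have "G y = \<beta> x - 1" using G_\<alpha>[OF A.in_H(3)[OF x(1)], of "-1"] x(3) by simp
          moreover have "G z = \<beta> (h u) - 1" using Gz B.\<alpha>_h[OF u] by simp
          ultimately show ?thesis using d2(2)[of x] x(2) by (simp add: dist_norm norm_minus_commute)
        qed
      qed
      then show "\<forall>\<^sub>F y in at z. dist (G y) (G z) < \<epsilon>"
        unfolding eventually_at using \<delta>(1) by blast
    qed
    then show "(G \<longlongrightarrow> G z) (at z within ball (\<alpha> (g u)) \<delta>0)" by (rule tendsto_within_subset) simp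
  qed auto
  then show ?thesis using \<delta>0(1) analytic_at_ball[of G] by blast
qed

lemma G_entire: "G holomorphic_on UNIV"
proof -
  have "G analytic_on {w}" for w
  proof -
    obtain x k where x: "x \<in> T" "w = \<alpha> x + of_int k" by (rule exists_preimage)
    then have "G analytic_on {\<alpha> x}" using G_analytic_C G_analytic_g by blast
    then show ?thesis unfolding x(2) by (rule G_analytic_translate)
  qed
  then have "G analytic_on UNIV" using analytic_on_analytic_at by blast
  then show ?thesis by (rule analytic_imp_holomorphic)
qed

end

text \<open>As both functions satisfy the covering condition, the transition functions in both
  directions are entire and inverse to each other. The normalisation at \<open>d\<close> makes the
  translation trivial.\<close>

lemma tile_pair_unique:
  assumes "tile_pair g h \<alpha> \<beta> F" "tile_pair g h \<beta> \<alpha> F" "d \<in> tile.H g h" "\<alpha> d = 0" "\<beta> d = 0" "z \<in> tile.H g h"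
  shows "\<alpha> z = \<beta> z"
proof -
  interpret P: tile_pair g h \<alpha> \<beta> F by fact
  interpret Q: tile_pair g h \<beta> \<alpha> F by fact
  have inv1: "Q.G (P.G w) = w" for w
  proof -
    obtain x k where x: "x \<in> P.T" "w = \<alpha> x + of_int k" by (rule P.exists_preimage)
    then show ?thesis using P.G_T[OF x(1)] Q.G_T[OF x(1)] by simp
  qed
  have inv2: "P.G (Q.G w) = w" for w
  proof -
    obtain x k where x: "x \<in> P.T" "w = \<beta> x + of_int k" by (rule Q.exists_preimage)
    then show ?thesis using P.G_T[OF x(1)] Q.G_T[OF x(1)] by simp
  qed
  have "P.G (w + 1) = P.G w + 1" for w using P.G_translate[of w 1] by simp
  then have "P.G w = w + P.G 0" for w
    by (rule entire_translation[OF P.G_entire holomorphic_on_imp_continuous_on[OF Q.G_entire] inv1 inv2])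
  moreover have "P.G 0 = 0" using P.G_\<alpha>0[OF assms(3)] assms(4,5) by simp
  moreover have "P.G (\<alpha> z) = \<beta> z" by (rule P.G_\<alpha>0[OF assms(6)])
  ultimately show ?thesis by simp
qed

section \<open>Initial curves\<close>

text \<open>The limits of the curve become genuine end points, so that the theory of arcs on the
  unit interval applies.\<close>

definition closed_up :: "(real \<Rightarrow> complex) \<Rightarrow> complex \<Rightarrow> complex \<Rightarrow> real \<Rightarrow> complex" where
  "closed_up \<gamma> a b u = (if u \<le> 0 then a else if u \<ge> 1 then b else \<gamma> (2 * u - 1))"

lemma closed_up_simps: "closed_up \<gamma> a b 0 = a" "closed_up \<gamma> a b 1 = b" "u \<in> {0<..<1} \<Longrightarrow> closed_up \<gamma> a b u = \<gamma> (2 * u - 1)"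
  by (auto simp: closed_up_def)

lemma closed_up_open_image: "closed_up \<gamma> a b ` {0<..<1} = \<gamma> ` {-1<..<1}"
proof (intro equalityI subsetI)
  fix y assume "y \<in> \<gamma> ` {-1<..<1}"
  then obtain t where "t \<in> {-1<..<1}" "y = \<gamma> t" by blast
  then have *: "(t + 1) / 2 \<in> {0<..<1}" by auto
  have "2 * ((t + 1) / 2) - 1 = t" by (simp add: field_simps)
  then have "y = closed_up \<gamma> a b ((t + 1) / 2)" using closed_up_simps(3)[OF *] \<open>y = \<gamma> t\<close> by simp
  with * have "(t + 1) / 2 \<in> {0<..<1}" "y = closed_up \<gamma> a b ((t + 1) / 2)" by blast+
  then show "y \<in> closed_up \<gamma> a b ` {0<..<1}" by blast
qed (auto simp: closed_up_def)

lemma unit_interval_split: "{0..1::real} = {0<..<1} \<union> {0, 1}"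
  by auto

lemma path_image_closed_up: "path_image (closed_up \<gamma> a b) = \<gamma> ` {-1<..<1} \<union> {a, b}"
  unfolding path_image_def unit_interval_split image_Un closed_up_open_image by (simp add: closed_up_simps)

lemma path_closed_up:
  assumes "continuous_on {-1<..<1} \<gamma>" "(\<gamma> \<longlongrightarrow> a) (at_right (-1))" "(\<gamma> \<longlongrightarrow> b) (at_left 1)"
  shows "path (closed_up \<gamma> a b)"
  unfolding path_def
proof (rule continuous_on_IccI)
  have inside: "\<forall>\<^sub>F u in at_right 0. \<gamma> (2 * u - 1) = closed_up \<gamma> a b u"
    using eventually_at_right_real[OF zero_less_one] by eventually_elim (simp add: closed_up_simps(3))
  have "filterlim (\<lambda>u. 2 * u - 1) (at_right (-1)) (at_right (0::real))"
    unfolding filterlim_at by (auto simp: eventually_at_filter intro!: tendsto_eq_intros)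
  from filterlim_compose[OF assms(2) this]
  show "(closed_up \<gamma> a b \<longlongrightarrow> closed_up \<gamma> a b 0) (at_right 0)"
    using inside by (simp add: closed_up_simps tendsto_cong)
  have inside: "\<forall>\<^sub>F u in at_left 1. \<gamma> (2 * u - 1) = closed_up \<gamma> a b u"
    using eventually_at_left_real[OF zero_less_one] by eventually_elim (simp add: closed_up_simps(3))
  have "filterlim (\<lambda>u. 2 * u - 1) (at_left 1) (at_left (1::real))"
    unfolding filterlim_at by (auto simp: eventually_at_filter intro!: tendsto_eq_intros)
  from filterlim_compose[OF assms(3) this]
  show "(closed_up \<gamma> a b \<longlongrightarrow> closed_up \<gamma> a b 1) (at_left 1)"
    using inside by (simp add: closed_up_simps tendsto_cong)
  fix x :: real assume x: "0 < x" "x < 1"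
  have "continuous_on {0<..<1} (\<lambda>u. \<gamma> (2 * u - 1))"
    by (rule continuous_on_compose2[OF assms(1)]) (auto intro!: continuous_intros)
  then have "continuous_on {0<..<1} (closed_up \<gamma> a b)"
    by (rule continuous_on_eq) (simp add: closed_up_simps)
  then show "closed_up \<gamma> a b \<midarrow>x\<rightarrow> closed_up \<gamma> a b x"
    using x by (simp add: continuous_on_eq_continuous_at isCont_def)
qed simp

lemma inj_on_closed_up:
  assumes "inj_on \<gamma> {-1<..<1}" shows "inj_on (closed_up \<gamma> a b) {0<..<1}"
proof (rule inj_onI)
  fix x y :: real assume "x \<in> {0<..<1}" "y \<in> {0<..<1}" "closed_up \<gamma> a b x = closed_up \<gamma> a b y"
  then show "x = y" using inj_onD[OF assms, of "2 * x - 1" "2 * y - 1"] by (simp add: closed_up_simps)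
qed

lemma arc_closed_up:
  assumes "continuous_on {-1<..<1} \<gamma>" "(\<gamma> \<longlongrightarrow> a) (at_right (-1))" "(\<gamma> \<longlongrightarrow> b) (at_left 1)"
    "inj_on \<gamma> {-1<..<1}" "a \<noteq> b" "a \<notin> \<gamma> ` {-1<..<1}" "b \<notin> \<gamma> ` {-1<..<1}"
  shows "arc (closed_up \<gamma> a b)"
  unfolding arc_def
proof
  show "path (closed_up \<gamma> a b)" by (rule path_closed_up[OF assms(1-3)])
  have "inj_on (closed_up \<gamma> a b) {0<..<1}" by (rule inj_on_closed_up[OF assms(4)])
  moreover have "a \<notin> closed_up \<gamma> a b ` {0<..<1}" "b \<notin> closed_up \<gamma> a b ` {0<..<1}"
    unfolding closed_up_open_image by (rule assms)+
  ultimately show "inj_on (closed_up \<gamma> a b) {0..1}"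
    unfolding unit_interval_split inj_on_Un using assms(5) by (auto simp: closed_up_simps)
qed

text \<open>Otherwise a part of the arc would close up to a Jordan curve inside the given one.\<close>

lemma Jordan_curve_endpoint:
  fixes p c :: "real \<Rightarrow> complex"
  assumes p: "path p" "inj_on p {0<..<1}" and p01: "p 0 \<noteq> p 1"
    and c: "simple_path c" "pathfinish c = pathstart c" "path_image p \<subseteq> path_image c"
    and x: "x \<in> path_image c" "x \<notin> path_image p"
  shows "p 0 \<notin> p ` {0<..<1}" "p 1 \<notin> p ` {0<..<1}"
proof -
  have no_loop: False if uv: "{u, v} \<subseteq> {0..1}" "u < v" "p u = p v" "{u<..<v} \<subseteq> {0<..<1}" "u \<in> {0<..<1} \<or> v \<in> {0<..<1}"
    and ends: "\<And>w. w \<in> {u<..<v} \<Longrightarrow> p w \<noteq> p u" for u v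
  proof -
    have "simple_path (subpath u v p)"
      unfolding simple_path_subpath_eq
    proof (intro conjI allI impI)
      show "path (subpath u v p)" using p(1) uv(1) by auto
      show "u \<noteq> v" using uv(2) by simp
      fix x y assume xy: "x \<in> closed_segment u v \<and> y \<in> closed_segment u v \<and> p x = p y"
      then have "x \<in> {u..v}" "y \<in> {u..v}" using uv(2) by (auto simp: closed_segment_eq_real_ivl)
      then consider "x \<in> {u<..<v}" "y \<in> {u<..<v}" | "x \<in> {u<..<v}" "y \<in> {u, v}" | "x \<in> {u, v}" "y \<in> {u<..<v}"
        | "x \<in> {u, v}" "y \<in> {u, v}" by force
      then show "x = y \<or> x = u \<and> y = v \<or> x = v \<and> y = u"
      proof cases
        case 1 then show ?thesis using inj_onD[OF p(2), of x y] xy uv(4) by blast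
      next
        case 2 then show ?thesis using ends xy uv(3) by auto
      next
        case 3 then show ?thesis using ends[of y] xy uv(3) by auto
      qed auto
    qed
    moreover have "pathfinish (subpath u v p) = pathstart (subpath u v p)" using uv(3) by simp
    moreover have sub: "path_image (subpath u v p) \<subseteq> path_image p" using path_image_subpath_subset[of u v p] uv(1) by simp
    \<comment> \<open>\<open>closed_Jordan_curve_subset\<close> forces equality with the whole
      curve, but \<open>x\<close> is missing.\<close>
    ultimately have "path_image (subpath u v p) = path_image c"
      using closed_Jordan_curve_subset[OF c(1,2)] c(3) by blast
    then show False using sub x by blast
  qed
  show "p 0 \<notin> p ` {0<..<1}"
  proof
    assume "p 0 \<in> p ` {0<..<1}"
    then obtain t where t: "t \<in> {0<..<1}" "p 0 = p t" by blast
    show False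
    proof (rule no_loop[of 0 t])
      fix w assume w: "w \<in> {0<..<t}"
      then show "p w \<noteq> p 0" using inj_onD[OF p(2), of w t] t by auto
    qed (use t in auto)
  qed
  show "p 1 \<notin> p ` {0<..<1}"
  proof
    assume "p 1 \<in> p ` {0<..<1}"
    then obtain t where t: "t \<in> {0<..<1}" "p 1 = p t" by blast
    show False
    proof (rule no_loop[of t 1])
      fix w assume w: "w \<in> {t<..<1}"
      then show "p w \<noteq> p t" using inj_onD[OF p(2), of w t] t by auto
    qed (use t in auto)
  qed
qed

theorem theorem1:
  fixes F :: "complex \<Rightarrow> complex" and \<gamma> :: "real \<Rightarrow> complex"
    and H :: "complex set" and d :: complex and \<alpha> \<beta> :: "complex \<Rightarrow> complex"
  assumes "initial_curve F \<gamma>"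
    and "H = initial_region F \<gamma>"
    and "d \<in> H"
    and "\<alpha> analytic_on H" and "inj_on \<alpha> H"
    and "Abel_function_on F H \<alpha>"
    and "\<alpha> d = 0"
    and "(\<Union>k::int. (\<lambda>w. w + of_int k) ` (\<alpha> ` H)) = UNIV"
    and "\<beta> analytic_on H" and "inj_on \<beta> H"
    and "Abel_function_on F H \<beta>"
    and "\<beta> d = 0"
    and "(\<Union>k::int. (\<lambda>w. w + of_int k) ` (\<beta> ` H)) = UNIV"
  shows "\<forall>z\<in>H. \<alpha> z = \<beta> z"
proof -
  define a b where "a = curve_start \<gamma>" and "b = curve_end \<gamma>"
  have cont: "continuous_on {-1<..<1} \<gamma>" and an: "F analytic_on curve_image \<gamma>"
    and inj: "inj_on \<gamma> {-1<..<1}" "inj_on (F \<circ> \<gamma>) {-1<..<1}"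
    and dis: "curve_image \<gamma> \<inter> curve_image (F \<circ> \<gamma>) = {}"
    and lim: "(\<gamma> \<longlongrightarrow> a) (at_right (-1))" "(\<gamma> \<longlongrightarrow> b) (at_left 1)" and ab: "a \<noteq> b" "F a = a" "F b = b"
    and limF: "((F \<circ> \<gamma>) \<longlongrightarrow> a) (at_right (-1))" "((F \<circ> \<gamma>) \<longlongrightarrow> b) (at_left 1)"
    and Jc: "closed_Jordan_curve (initial_boundary F \<gamma>)"
    using assms(1) unfolding initial_curve_def a_def b_def by auto
  have contF: "continuous_on {-1<..<1} (F \<circ> \<gamma>)"
    by (intro continuous_on_compose cont holomorphic_on_imp_continuous_on analytic_imp_holomorphic an)
  \<comment> \<open>A fixed point on \<open>\<gamma>\<close> would also lie on the image
    \<open>F \<circ> \<gamma>\<close>, which is disjoint from \<open>\<gamma>\<close>.\<close>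
  have fix_notin: "x \<notin> curve_image \<gamma>" if "F x = x" for x
  proof
    assume "x \<in> curve_image \<gamma>"
    then obtain t where "t \<in> {-1<..<1}" "x = \<gamma> t" by blast
    then have "x \<in> curve_image (F \<circ> \<gamma>)" using that by (metis comp_apply imageI)
    then show False using dis \<open>x \<in> curve_image \<gamma>\<close> by blast
  qed
  define g h where "g = closed_up \<gamma> a b" and "h = closed_up (F \<circ> \<gamma>) a b"
  have img: "g ` {0<..<1} = curve_image \<gamma>" "h ` {0<..<1} = curve_image (F \<circ> \<gamma>)"
    by (simp_all add: g_def h_def closed_up_open_image del: image_comp)
  have pim: "path_image g = curve_image \<gamma> \<union> {a, b}" "path_image h = curve_image (F \<circ> \<gamma>) \<union> {a, b}"
    by (simp_all add: g_def h_def path_image_closed_up)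
  have ends: "g 0 = a" "g 1 = b" "h 0 = a" "h 1 = b" by (simp_all add: g_def h_def closed_up_simps)
  have B: "initial_boundary F \<gamma> = path_image g \<union> path_image h"
    unfolding pim initial_boundary_def a_def b_def by blast
  have arc_g: "arc g" unfolding g_def
    by (rule arc_closed_up[OF cont lim inj(1) ab(1)]) (use fix_notin ab in auto)
  have nh: "a \<notin> curve_image (F \<circ> \<gamma>)" "b \<notin> curve_image (F \<circ> \<gamma>)"
  proof -
    obtain c where c: "simple_path c" "pathfinish c = pathstart c" "path_image c = initial_boundary F \<gamma>"
      using Jc unfolding closed_Jordan_curve_def by blast
    have "\<gamma> 0 \<in> path_image c" "path_image h \<subseteq> path_image c" unfolding c(3) B pim by auto
    moreover have "\<gamma> 0 \<notin> path_image h"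
    proof -
      have "\<gamma> 0 \<in> curve_image \<gamma>" by auto
      then show ?thesis unfolding pim using dis fix_notin ab by blast
    qed
    moreover have "path h" "inj_on h {0<..<1}"
      unfolding h_def by (rule path_closed_up[OF contF limF], rule inj_on_closed_up[OF inj(2)])
    moreover have "h 0 \<noteq> h 1" using ends ab by simp
    ultimately have "h 0 \<notin> h ` {0<..<1}" "h 1 \<notin> h ` {0<..<1}"
      using Jordan_curve_endpoint[of h c "\<gamma> 0"] c(1,2) by blast+
    then show "a \<notin> curve_image (F \<circ> \<gamma>)" "b \<notin> curve_image (F \<circ> \<gamma>)" unfolding ends img by blast+
  qed
  have arc_h: "arc h" unfolding h_def
    by (rule arc_closed_up[OF contF limF inj(2) ab(1) nh])
  interpret two_arcs g h
  proof
    show "path_image g \<inter> path_image h = {g 0, g 1}"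
      unfolding pim ends using dis nh fix_notin ab by blast
  qed (use arc_g arc_h ends in auto)
  have J: "J = initial_boundary F \<gamma>" by (simp add: J_def B)
  have HH: "g ` {0<..<1} \<union> C \<union> h ` {0<..<1} = H"
    unfolding img C_def J assms(2) initial_region_def ..
  have tile: "tile g h \<phi> F" if "\<phi> analytic_on H" "inj_on \<phi> H" "Abel_function_on F H \<phi>" for \<phi>
  proof (intro tile.intro two_arcs_axioms tile_axioms.intro)
    show "F analytic_on g ` {0<..<1}" using an by (simp only: img)
    show Fg: "F (g u) = h u" if "u \<in> {0<..<1}" for u using that by (simp add: g_def h_def closed_up_simps)
    show "\<phi> analytic_on g ` {0<..<1} \<union> C \<union> h ` {0<..<1}" "inj_on \<phi> (g ` {0<..<1} \<union> C \<union> h ` {0<..<1})"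
      using that by (simp_all only: HH)
    show "\<phi> (h u) = \<phi> (g u) + 1" if u: "u \<in> {0<..<1}" for u
    proof -
      have "g u \<in> H" "h u \<in> H" using u HH by blast+
      then have "g u \<in> H \<inter> F -` H" using Fg[OF u] by simp
      then have "\<phi> (F (g u)) = \<phi> (g u) + 1"
        using \<open>Abel_function_on F H \<phi>\<close> unfolding Abel_function_on_def by blast
      then show ?thesis using Fg[OF u] by simp
    qed
  qed
  have tileH: "tile.H g h = H" by (simp only: tile.H_def[OF tile[OF assms(4-6)]] HH)
  have "tile_pair g h \<alpha> \<beta> F" "tile_pair g h \<beta> \<alpha> F"
    by (intro tile_pair.intro tile_pair_axioms.intro tile assms; unfold tileH; fact)+
  then show ?thesis
    using tile_pair_unique[of g h \<alpha> \<beta> F d] assms(3,7,12) unfolding tileH by blast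
qed

end
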